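(* Let $(A,[\cdot,\cdot],\rho)$ be a Lie algebroid and let $N:A\to A$ be a Nijenhuis $\mathcal{C}^\infty$-linear bundle map, i.e. $[NX,NY]-N([NX,Y]+[X,NY]-N[X,Y])=0$ for all $X,Y\in\Gamma(A)$. Consider the graded vector space $E$ with $E_{-k}=\Gamma(\wedge^kA)$, write $|P|=-k$ for $P\in\Gamma(\wedge^kA)$, and set $l_1:=0$, $l_2(P_1,P_2):=(-1)^{|P_1|}[P_1,P_2]_{SN}$ and, for $i>2$, $$l_i(P_1,\dots,P_i):=\sum_{\sigma\in Sh(2,i-2)}\epsilon(\sigma)(-1)^{|P_{\sigma(1)}|}[P_{\sigma(1)},P_{\sigma(2)}]_{SN}\wedge P_{\sigma(3)}\wedge\cdots\wedge P_{\sigma(i)}.$$ Let $\mu:=\sum_{i\geq1}a_il_i$ with $a_i\in\mathbb{R}$ (an $L_\infty$-structure on $E$). Then the extension by derivation $\underline{N}$ of $N$ is a Nijenhuis vector valued $1$-form with respect to $\mu$, with square $\underline{N^2}$; that is, $$[\underline{N},[\underline{N},\mu]_{RN}]_{RN}=[\underline{N^2},\mu]_{RN}\quad\text{and}\quad[\underline{N},\underline{N^2}]_{RN}=0.$$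
   Context: $[\cdot,\cdot]_{SN}$ is the Schouten-Nijenhuis bracket on $\Gamma(\wedge A)$ extending the Lie algebroid bracket: $[X,f]_{SN}=\rho(X)f$, $[P,Q]_{SN}=-(-1)^{(p-1)(q-1)}[Q,P]_{SN}$ and $[P,Q\wedge R]_{SN}=[P,Q]_{SN}\wedge R+(-1)^{(p-1)q}Q\wedge[P,R]_{SN}$ for $P\in\Gamma(\wedge^pA)$, $Q\in\Gamma(\wedge^qA)$. For a $\mathcal{C}^\infty$-linear bundle map $N:A\to A$, $\underline{N}$ is defined on $\Gamma(\wedge A)$ by $\underline{N}(f)=0$ for functions $f$ and $\underline{N}(P_1\wedge\cdots\wedge P_p)=\sum_{i=1}^pP_1\wedge\cdots\wedge N(P_i)\wedge\cdots\wedge P_p$ for $P_i\in\Gamma(A)$. $N^2=N\circ N$ and $\underline{N^2}$ is its extension by derivation. A symmetric vector valued $k$-form on a graded vector space $E$ is a graded symmetric $k$-linear map $K:E^k\to E$; it has degree $\bar K$ if $|K(X_1,\dots,X_k)|=\sum|X_i|+\bar K$. Formal sums of forms of different arities are allowed. For a $k$-form $K$ and an $l$-form $L$, $$\iota_KL(X_1,\dots,X_{k+l-1})=\sum_{\sigma\in Sh(k,l-1)}\epsilon(\sigma)L(K(X_{\sigma(1)},\dots,X_{\sigma(k)}),X_{\sigma(k+1)},\dots,X_{\sigma(k+l-1)}),$$ where $Sh(i,j)$ is the set of $(i,j)$-unshuffles and $\epsilon(\sigma)$ the Koszul sign ($X_{\sigma(1)}\odot\cdots\odot X_{\sigma(n)}=\epsilon(\sigma)X_1\odot\cdots\odot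 X_n$ in the graded symmetric algebra). The Richardson-Nijenhuis bracket is $[K,L]_{RN}=\iota_KL-(-1)^{\bar K\bar L}\iota_LK$, extended arity by arity to formal sums. An $L_\infty$-structure is a formal sum $\mu$ of symmetric vector valued $i$-forms, $i\ge1$, of degree $1$ with $[\mu,\mu]_{RN}=0$. A degree $0$ vector valued form $\mathcal{N}$ is Nijenhuis with respect to $\mu$ with square $\mathcal{K}$ (of degree $0$) if $[\mathcal{N},[\mathcal{N},\mu]_{RN}]_{RN}=[\mathcal{K},\mu]_{RN}$ and $[\mathcal{N},\mathcal{K}]_{RN}=0$. *)

theory Defs
  imports
    "HOL-Analysis.Analysis"
    "HOL-Library.Poly_Mapping"
    "HOL-Library.Function_Algebras"
    "HOL-Combinatorics.Permutations"
begin

instantiation "fun" :: (type, real_vector) real_vector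
begin

definition scaleR_fun_def: "c *\<^sub>R f = (\<lambda>x. c *\<^sub>R f x)"

instance
  by standard (simp_all add: scaleR_fun_def fun_eq_iff algebra_simps)

end

lemma scaleR_fun_apply [simp]: "(c *\<^sub>R f) x = c *\<^sub>R f x"
  by (simp add: scaleR_fun_def)


section \<open>The exterior algebra of a real vector space\<close>

text \<open>
  The exterior algebra of \<^typ>\<open>'v\<close> is the unital associative real algebra generated by the
  elements of \<^typ>\<open>'v\<close> subject to linearity and to \<open>v * v = 0\<close>, i.e. the quotient of the tensor
  algebra by the ideal generated by the squares of vectors.  The free algebra on the set
  \<^typ>\<open>'v\<close> is the monoid algebra of words.
\<close>

datatype 'v fword = Word (letters: "'v list")

instantiation fword :: (type) monoid_add
begin

definition zero_fword_def: "0 = Word []"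
definition plus_fword_def: "u + v = Word (letters u @ letters v)"

instance
  by standard (simp_all add: zero_fword_def plus_fword_def)

end

type_synonym 'v free_alg = "'v fword \<Rightarrow>\<^sub>0 real"

abbreviation gen :: "'v \<Rightarrow> 'v free_alg" where
  "gen v \<equiv> Poly_Mapping.single (Word [v]) 1"

abbreviation const :: "real \<Rightarrow> 'v free_alg" where
  "const c \<equiv> Poly_Mapping.single 0 c"

inductive_set ext_ideal :: "('v::real_vector) free_alg set" where
  zero: "0 \<in> ext_ideal"
| add: "gen (u + v) - gen u - gen v \<in> ext_ideal"
| scale: "gen (c *\<^sub>R v) - const c * gen v \<in> ext_ideal"
| square: "gen v * gen v \<in> ext_ideal"
| plus: "a \<in> ext_ideal \<Longrightarrow> b \<in> ext_ideal \<Longrightarrow> a + b \<in> ext_ideal"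
| mult: "a \<in> ext_ideal \<Longrightarrow> x * a * y \<in> ext_ideal"

lemma ext_ideal_uminus: "a \<in> ext_ideal \<Longrightarrow> - a \<in> ext_ideal"
  using ext_ideal.mult[of a "-1" 1] by simp

lemma ext_ideal_minus: "a \<in> ext_ideal \<Longrightarrow> b \<in> ext_ideal \<Longrightarrow> a - b \<in> ext_ideal"
  using ext_ideal.plus[OF _ ext_ideal_uminus, of a b] by simp

lemma ext_ideal_mult_left: "a \<in> ext_ideal \<Longrightarrow> x * a \<in> ext_ideal"
  using ext_ideal.mult[of a x 1] by simp

lemma ext_ideal_mult_right: "a \<in> ext_ideal \<Longrightarrow> a * x \<in> ext_ideal"
  using ext_ideal.mult[of a 1 x] by simp

definition ext_rel :: "('v::real_vector) free_alg \<Rightarrow> 'v free_alg \<Rightarrow> bool" where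
  "ext_rel a b \<longleftrightarrow> a - b \<in> ext_ideal"

lemma equivp_ext_rel: "equivp (ext_rel :: ('a::real_vector) free_alg \<Rightarrow> _)"
proof (rule equivpI)
  show "reflp ext_rel"
    by (simp add: reflp_def ext_rel_def ext_ideal.zero)
  show "symp ext_rel"
    unfolding symp_def ext_rel_def using ext_ideal_uminus by (metis minus_diff_eq)
  show "transp (ext_rel :: 'a free_alg \<Rightarrow> _)"
  proof (rule transpI)
    fix x y z :: "'a free_alg"
    assume "ext_rel x y" "ext_rel y z"
    then show "ext_rel x z"
      using ext_ideal.plus[of "x - y" "y - z"] by (simp add: ext_rel_def)
  qed
qed

quotient_type (overloaded) 'v ext = "('v::real_vector) free_alg" / ext_rel
  by (rule equivp_ext_rel)

lemma free_alg_induct [case_names single sum]: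
  fixes a :: "'v free_alg"
  assumes single: "\<And>k c. P (Poly_Mapping.single k c)"
    and sum: "\<And>a b. P a \<Longrightarrow> P b \<Longrightarrow> P (a + b)"
  shows "P a"
proof (induction a rule: update_induct)
  case const
  show ?case using single[of 0 0] by simp
next
  case (update f k c)
  have "Poly_Mapping.update k c f = f + Poly_Mapping.single k c"
    by (rule poly_mapping_eqI)
      (use update in \<open>auto simp: lookup_update lookup_add lookup_single when_def in_keys_iff\<close>)
  then show ?case using sum[OF update(3) single] by simp
qed

lemma const_commute: "const c * a = a * const c"
  for a :: "'v free_alg"
proof (induction a rule: free_alg_induct)
  case (single k v)
  then show ?case by (simp add: mult_single mult.commute)
next
  case (sum p q)
  then show ?case by (simp add: algebra_simps)
qed

lemma letters_empty_iff: "u + v = (0 :: 'v fword) \<longleftrightarrow> u = 0 \<and> v = 0"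
  by (cases u; cases v) (auto simp: zero_fword_def plus_fword_def)

lemma lookup_mult_zero:
  "Poly_Mapping.lookup (a * b) 0 = Poly_Mapping.lookup a 0 * Poly_Mapping.lookup b 0"
  for a b :: "'v free_alg"
proof (induction a rule: free_alg_induct)
  case (single k v)
  show ?case
  proof (induction b rule: free_alg_induct)
    case (single l w)
    then show ?case
      by (auto simp: mult_single lookup_single when_def letters_empty_iff)
  next
    case (sum p q)
    then show ?case by (simp add: lookup_add algebra_simps)
  qed
next
  case (sum p q)
  then show ?case by (simp add: lookup_add algebra_simps)
qed

lemma ext_ideal_augmentation:
  assumes "a \<in> ext_ideal"
  shows "Poly_Mapping.lookup a 0 = 0"
proof -
  have "Poly_Mapping.lookup (gen v) 0 = 0" for v :: 'a
    by (simp add: lookup_single when_def zero_fword_def)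
  with assms show ?thesis
    by induction (simp_all add: lookup_add lookup_minus lookup_mult_zero)
qed

instantiation ext :: (real_vector) real_algebra_1
begin

lift_definition zero_ext :: "'a ext" is "0" .

lift_definition one_ext :: "'a ext" is "1" .

lift_definition plus_ext :: "'a ext \<Rightarrow> 'a ext \<Rightarrow> 'a ext" is "(+)"
  unfolding ext_rel_def by (metis add_diff_add ext_ideal.plus)

lift_definition minus_ext :: "'a ext \<Rightarrow> 'a ext \<Rightarrow> 'a ext" is "(-)"
proof -
  fix a a' b b' :: "'a free_alg"
  assume "ext_rel a a'" "ext_rel b b'"
  then have "(a - a') - (b - b') \<in> ext_ideal"
    unfolding ext_rel_def by (rule ext_ideal_minus)
  then show "ext_rel (a - b) (a' - b')"
    by (simp add: ext_rel_def algebra_simps)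
qed

lift_definition uminus_ext :: "'a ext \<Rightarrow> 'a ext" is "uminus"
  unfolding ext_rel_def by (metis ext_ideal_uminus minus_diff_minus)

lift_definition times_ext :: "'a ext \<Rightarrow> 'a ext \<Rightarrow> 'a ext" is "(*)"
proof -
  fix a a' b b' :: "'a free_alg"
  assume "ext_rel a a'" "ext_rel b b'"
  then have "(a - a') * b + a' * (b - b') \<in> ext_ideal"
    unfolding ext_rel_def
    by (intro ext_ideal.plus ext_ideal_mult_left ext_ideal_mult_right)
  then show "ext_rel (a * b) (a' * b')"
    by (simp add: ext_rel_def algebra_simps)
qed

lift_definition scaleR_ext :: "real \<Rightarrow> 'a ext \<Rightarrow> 'a ext" is "\<lambda>c a. const c * a"
  unfolding ext_rel_def by (metis ext_ideal_mult_left right_diff_distrib)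

instance
proof
  fix a b c :: "'a ext" and r s :: real
  have R: "ext_rel x y" if "x = y" for x y :: "'a free_alg"
    using that by (simp add: ext_rel_def ext_ideal.zero)
  show "a + b + c = a + (b + c)" by transfer (rule R, simp add: algebra_simps)
  show "a + b = b + a" by transfer (rule R, simp add: algebra_simps)
  show "0 + a = a" by transfer (rule R, simp)
  show "- a + a = 0" by transfer (rule R, simp)
  show "a - b = a + - b" by transfer (rule R, simp)
  show "r *\<^sub>R (a + b) = r *\<^sub>R a + r *\<^sub>R b"
    by transfer (rule R, simp add: algebra_simps)
  show "(r + s) *\<^sub>R a = r *\<^sub>R a + s *\<^sub>R a"
    by transfer (rule R, simp add: single_add algebra_simps)
  show "r *\<^sub>R s *\<^sub>R a = (r * s) *\<^sub>R a"
    by transfer (rule R, simp add: mult_single mult.assoc[symmetric])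
  show "1 *\<^sub>R a = a" by transfer (rule R, simp)
  show "a * b * c = a * (b * c)" by transfer (rule R, simp add: algebra_simps)
  show "(a + b) * c = a * c + b * c" by transfer (rule R, simp add: algebra_simps)
  show "a * (b + c) = a * b + a * c" by transfer (rule R, simp add: algebra_simps)
  show "r *\<^sub>R a * b = r *\<^sub>R (a * b)" by transfer (rule R, simp add: mult.assoc)
  show "a * r *\<^sub>R b = r *\<^sub>R (a * b)"
    by transfer (rule R, metis const_commute mult.assoc)
  show "1 * a = a" by transfer (rule R, simp)
  show "a * 1 = a" by transfer (rule R, simp)
  show "(0 :: 'a ext) \<noteq> 1"
  proof transfer
    show "\<not> ext_rel (0 :: 'a free_alg) 1"
      using ext_ideal_augmentation[of "0 - 1 :: 'a free_alg"]
      by (auto simp: ext_rel_def lookup_minus)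
  qed
qed

end

lift_definition vec :: "'v::real_vector \<Rightarrow> 'v ext" is gen .

definition ext_power :: "nat \<Rightarrow> 'v::real_vector set \<Rightarrow> 'v ext set" where
  "ext_power k W = span {prod_list (map vec vs) |vs. set vs \<subseteq> W \<and> length vs = k}"


section \<open>Smooth manifolds\<close>

primrec cont_diff ::
  "nat \<Rightarrow> 'a::real_normed_vector set \<Rightarrow> ('a \<Rightarrow> 'b::real_normed_vector) \<Rightarrow> bool" where
  "cont_diff 0 S f \<longleftrightarrow> continuous_on S f"
| "cont_diff (Suc k) S f \<longleftrightarrow>
     (\<forall>x\<in>S. f differentiable (at x)) \<and>
     (\<forall>v. cont_diff k S (\<lambda>x. frechet_derivative f (at x) v))"

definition smooth_on ::
  "'a::real_normed_vector set \<Rightarrow> ('a \<Rightarrow> 'b::real_normed_vector) \<Rightarrow> bool" where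
  "smooth_on S f \<longleftrightarrow> (\<forall>k. cont_diff k S f)"

type_synonym ('m, 'b) atlas = "('m set \<times> ('m \<Rightarrow> 'b)) set"

text \<open>
  The model space is any finite-dimensional normed space, so that dimension 0 is included.
\<close>

locale smooth_manifold =
  fixes atlas ::
    "('m::{t2_space, second_countable_topology}, 'b::real_normed_vector) atlas"
  assumes finite_dim: "\<exists>B::'b set. finite B \<and> span B = UNIV"
    and chart_open: "(U, \<phi>) \<in> atlas \<Longrightarrow> open U \<and> open (\<phi> ` U)"
    and chart_homeo: "(U, \<phi>) \<in> atlas \<Longrightarrow> homeomorphism U (\<phi> ` U) \<phi> (inv_into U \<phi>)"
    and chart_cover: "(\<Union>(U, \<phi>)\<in>atlas. U) = UNIV"
    and chart_compatible: "(U, \<phi>) \<in> atlas \<Longrightarrow> (V, \<psi>) \<in> atlas \<Longrightarrow>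
          smooth_on (\<phi> ` (U \<inter> V)) (\<psi> \<circ> inv_into U \<phi>)"

definition smooth_fun ::
  "('m, 'b::real_normed_vector) atlas \<Rightarrow> 'm set \<Rightarrow> ('m \<Rightarrow> real) \<Rightarrow> bool" where
  "smooth_fun atlas W f \<longleftrightarrow>
     (\<forall>(U, \<phi>)\<in>atlas. smooth_on (\<phi> ` (U \<inter> W)) (f \<circ> inv_into U \<phi>))"

definition smooth_functions :: "('m, 'b::real_normed_vector) atlas \<Rightarrow> ('m \<Rightarrow> real) set" where
  "smooth_functions atlas = {f. smooth_fun atlas UNIV f}"

text \<open>
  Tangent vectors are the point derivations of the algebra of smooth functions; they are
  normalised to vanish on non-smooth functions, so that equality is equality as derivations.
\<close>

definition tangent_space ::
  "('m, 'b::real_normed_vector) atlas \<Rightarrow> 'm \<Rightarrow> (('m \<Rightarrow> real) \<Rightarrow> real) set" where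
  "tangent_space atlas p = {v.
     (\<forall>f\<in>smooth_functions atlas. \<forall>g\<in>smooth_functions atlas. v (f + g) = v f + v g) \<and>
     (\<forall>f\<in>smooth_functions atlas. \<forall>c. v (c *\<^sub>R f) = c * v f) \<and>
     (\<forall>f\<in>smooth_functions atlas. \<forall>g\<in>smooth_functions atlas.
        v (f * g) = f p * v g + g p * v f) \<and>
     (\<forall>f. f \<notin> smooth_functions atlas \<longrightarrow> v f = 0)}"


section \<open>Vector bundles and their exterior powers\<close>

text \<open>
  A vector bundle is given by its fibres \<open>A p\<close>, which are subspaces of a common
  (possibly infinite-dimensional) space \<^typ>\<open>'v\<close> such as their direct sum, and by local
  trivialisations \<open>(p, c) \<mapsto> \<Sum>i<r. c i *\<^sub>R e i p\<close> over open sets \<open>U\<close>, recorded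
  as local frames \<open>(U, e)\<close> whose transition matrices are smooth.
\<close>

type_synonym ('m, 'v) frames = "('m set \<times> (nat \<Rightarrow> 'm \<Rightarrow> 'v)) set"

locale vector_bundle = smooth_manifold atlas
  for atlas :: "('m::{t2_space, second_countable_topology}, 'b::real_normed_vector) atlas" +
  fixes A :: "'m \<Rightarrow> 'v::real_vector set"
    and r :: nat
    and frames :: "('m, 'v) frames"
  assumes fibre_subspace: "subspace (A p)"
    and frame_open: "(U, e) \<in> frames \<Longrightarrow> open U"
    and frame_cover: "(\<Union>(U, e)\<in>frames. U) = UNIV"
    and frame_basis: "(U, e) \<in> frames \<Longrightarrow> p \<in> U \<Longrightarrow>
          inj_on (\<lambda>i. e i p) {..<r} \<and>
          independent ((\<lambda>i. e i p) ` {..<r}) \<and>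
          span ((\<lambda>i. e i p) ` {..<r}) = A p"
    and frame_transition: "(U, e) \<in> frames \<Longrightarrow> (V, e') \<in> frames \<Longrightarrow>
          \<exists>g. (\<forall>i<r. \<forall>j<r. smooth_fun atlas (U \<inter> V) (g i j)) \<and>
              (\<forall>p\<in>U \<inter> V. \<forall>i<r. e' i p = (\<Sum>j<r. g i j p *\<^sub>R e j p))"

definition sections ::
  "('m, 'b::real_normed_vector) atlas \<Rightarrow> ('m \<Rightarrow> 'v::real_vector set) \<Rightarrow> nat \<Rightarrow>
   ('m, 'v) frames \<Rightarrow> ('m \<Rightarrow> 'v) set" where
  "sections atlas A r frames = {X. (\<forall>p. X p \<in> A p) \<and>
     (\<forall>(U, e)\<in>frames. \<exists>c. (\<forall>i<r. smooth_fun atlas U (c i)) \<and>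
        (\<forall>p\<in>U. X p = (\<Sum>i<r. c i p *\<^sub>R e i p)))}"

text \<open>
  Sections of the exterior powers, in all integer degrees.  Smoothness refers to the induced
  local frames \<open>e i\<^sub>1 \<and> \<dots> \<and> e i\<^sub>k\<close> with \<open>i\<^sub>1 < \<dots> < i\<^sub>k\<close>.  Since sections are functions into the
  algebra \<^typ>\<open>'v ext\<close>, the wedge product of sections is pointwise multiplication \<open>P * Q\<close>.
\<close>

definition wedge_sections ::
  "('m, 'b::real_normed_vector) atlas \<Rightarrow> ('m \<Rightarrow> 'v::real_vector set) \<Rightarrow> nat \<Rightarrow>
   ('m, 'v) frames \<Rightarrow> int \<Rightarrow> ('m \<Rightarrow> 'v ext) set" where
  "wedge_sections atlas A r frames k = (if k < 0 then {0} else
     {P. (\<forall>p. P p \<in> ext_power (nat k) (A p)) \<and>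
       (\<forall>(U, e)\<in>frames. \<exists>c.
          (\<forall>I. I \<subseteq> {..<r} \<and> card I = nat k \<longrightarrow> smooth_fun atlas U (c I)) \<and>
          (\<forall>p\<in>U. P p = (\<Sum>I | I \<subseteq> {..<r} \<and> card I = nat k.
              c I p *\<^sub>R prod_list (map (\<lambda>i. vec (e i p)) (sorted_list_of_set I)))))})"

definition fsec :: "('m \<Rightarrow> real) \<Rightarrow> 'm \<Rightarrow> ('v::real_vector) ext" where
  "fsec f = (\<lambda>p. f p *\<^sub>R 1)"

definition vsec :: "('m \<Rightarrow> 'v) \<Rightarrow> 'm \<Rightarrow> ('v::real_vector) ext" where
  "vsec X = (\<lambda>p. vec (X p))"

definition fscale :: "('m \<Rightarrow> real) \<Rightarrow> ('m \<Rightarrow> 'x::real_vector) \<Rightarrow> 'm \<Rightarrow> 'x" where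
  "fscale f X = (\<lambda>p. f p *\<^sub>R X p)"


section \<open>Lie algebroids\<close>

definition anchor_app ::
  "('m \<Rightarrow> 'v \<Rightarrow> ('m \<Rightarrow> real) \<Rightarrow> real) \<Rightarrow> ('m \<Rightarrow> 'v) \<Rightarrow> ('m \<Rightarrow> real) \<Rightarrow> 'm \<Rightarrow> real" where
  "anchor_app \<rho> X f = (\<lambda>p. \<rho> p (X p) f)"

locale lie_algebroid = vector_bundle atlas A r frames
  for atlas :: "('m::{t2_space, second_countable_topology}, 'b::real_normed_vector) atlas"
    and A :: "'m \<Rightarrow> 'v::real_vector set"
    and r :: nat
    and frames :: "('m, 'v) frames" +
  fixes br :: "('m \<Rightarrow> 'v) \<Rightarrow> ('m \<Rightarrow> 'v) \<Rightarrow> ('m \<Rightarrow> 'v)"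
    and \<rho> :: "'m \<Rightarrow> 'v \<Rightarrow> ('m \<Rightarrow> real) \<Rightarrow> real"
  assumes anchor_tangent: "v \<in> A p \<Longrightarrow> \<rho> p v \<in> tangent_space atlas p"
    and anchor_add: "u \<in> A p \<Longrightarrow> v \<in> A p \<Longrightarrow> \<rho> p (u + v) = \<rho> p u + \<rho> p v"
    and anchor_scale: "v \<in> A p \<Longrightarrow> \<rho> p (c *\<^sub>R v) = c *\<^sub>R \<rho> p v"
    and anchor_smooth: "X \<in> sections atlas A r frames \<Longrightarrow> f \<in> smooth_functions atlas \<Longrightarrow>
          anchor_app \<rho> X f \<in> smooth_functions atlas"
    and br_closed: "X \<in> sections atlas A r frames \<Longrightarrow> Y \<in> sections atlas A r frames \<Longrightarrow>
          br X Y \<in> sections atlas A r frames"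
    and br_add: "X \<in> sections atlas A r frames \<Longrightarrow> Y \<in> sections atlas A r frames \<Longrightarrow>
          Z \<in> sections atlas A r frames \<Longrightarrow> br X (Y + Z) = br X Y + br X Z"
    and br_scale: "X \<in> sections atlas A r frames \<Longrightarrow> Y \<in> sections atlas A r frames \<Longrightarrow>
          br X (c *\<^sub>R Y) = c *\<^sub>R br X Y"
    and br_skew: "X \<in> sections atlas A r frames \<Longrightarrow> Y \<in> sections atlas A r frames \<Longrightarrow>
          br X Y = - br Y X"
    and br_jacobi: "X \<in> sections atlas A r frames \<Longrightarrow> Y \<in> sections atlas A r frames \<Longrightarrow>
          Z \<in> sections atlas A r frames \<Longrightarrow>
          br X (br Y Z) + br Y (br Z X) + br Z (br X Y) = 0"
    and br_leibniz: "X \<in> sections atlas A r frames \<Longrightarrow> Y \<in> sections atlas A r frames \<Longrightarrow>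
          f \<in> smooth_functions atlas \<Longrightarrow>
          br X (fscale f Y) = fscale f (br X Y) + fscale (anchor_app \<rho> X f) Y"

definition bundle_app :: "('m \<Rightarrow> 'v \<Rightarrow> 'v) \<Rightarrow> ('m \<Rightarrow> 'v) \<Rightarrow> 'm \<Rightarrow> 'v" where
  "bundle_app N X = (\<lambda>p. N p (X p))"

definition bundle_endo ::
  "('m, 'b::real_normed_vector) atlas \<Rightarrow> ('m \<Rightarrow> 'v::real_vector set) \<Rightarrow> nat \<Rightarrow>
   ('m, 'v) frames \<Rightarrow> ('m \<Rightarrow> 'v \<Rightarrow> 'v) \<Rightarrow> bool" where
  "bundle_endo atlas A r frames N \<longleftrightarrow>
     (\<forall>p. \<forall>u\<in>A p. N p u \<in> A p) \<and>
     (\<forall>p. \<forall>u\<in>A p. \<forall>v\<in>A p. N p (u + v) = N p u + N p v) \<and>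
     (\<forall>p. \<forall>u\<in>A p. \<forall>c. N p (c *\<^sub>R u) = c *\<^sub>R N p u) \<and>
     (\<forall>X\<in>sections atlas A r frames. bundle_app N X \<in> sections atlas A r frames)"

definition nijenhuis_endo ::
  "('m, 'b::real_normed_vector) atlas \<Rightarrow> ('m \<Rightarrow> 'v::real_vector set) \<Rightarrow> nat \<Rightarrow>
   ('m, 'v) frames \<Rightarrow> (('m \<Rightarrow> 'v) \<Rightarrow> ('m \<Rightarrow> 'v) \<Rightarrow> ('m \<Rightarrow> 'v)) \<Rightarrow>
   ('m \<Rightarrow> 'v \<Rightarrow> 'v) \<Rightarrow> bool" where
  "nijenhuis_endo atlas A r frames br N \<longleftrightarrow> bundle_endo atlas A r frames N \<and>
     (\<forall>X\<in>sections atlas A r frames. \<forall>Y\<in>sections atlas A r frames.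
        br (bundle_app N X) (bundle_app N Y)
        - bundle_app N (br (bundle_app N X) Y + br X (bundle_app N Y)
                        - bundle_app N (br X Y)) = 0)"

text \<open>
  \<open>D\<close> is the extension of \<open>N\<close> by derivation; these conditions determine \<open>D\<close> on all sections of
  the exterior powers, because locally every such section is a combination of decomposable ones.
\<close>

definition derivation_extension ::
  "('m, 'b::real_normed_vector) atlas \<Rightarrow> ('m \<Rightarrow> 'v::real_vector set) \<Rightarrow> nat \<Rightarrow>
   ('m, 'v) frames \<Rightarrow> ('m \<Rightarrow> 'v \<Rightarrow> 'v) \<Rightarrow> (('m \<Rightarrow> 'v ext) \<Rightarrow> ('m \<Rightarrow> 'v ext)) \<Rightarrow> bool" where
  "derivation_extension atlas A r frames N D \<longleftrightarrow>
     (let \<Gamma> = wedge_sections atlas A r frames in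
     (\<forall>k. \<forall>P\<in>\<Gamma> k. D P \<in> \<Gamma> k) \<and>
     (\<forall>k. \<forall>P\<in>\<Gamma> k. \<forall>Q\<in>\<Gamma> k. D (P + Q) = D P + D Q) \<and>
     (\<forall>k. \<forall>P\<in>\<Gamma> k. \<forall>f\<in>smooth_functions atlas. D (fscale f P) = fscale f (D P)) \<and>
     (\<forall>f\<in>smooth_functions atlas. D (fsec f) = 0) \<and>
     (\<forall>Ps. Ps \<noteq> [] \<and> set Ps \<subseteq> sections atlas A r frames \<longrightarrow>
        D (prod_list (map vsec Ps)) =
          (\<Sum>i<length Ps. prod_list (map vsec (Ps[i := bundle_app N (Ps ! i)])))))"

text \<open>
  \<open>SN\<close> is the Schouten-Nijenhuis bracket, a bilinear operation of degree \<open>-1\<close>; again the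
  conditions determine it on homogeneous sections.  Linearity in the first argument follows from
  skew-symmetry, and the bracket of two functions vanishes since there are no sections of degree
  \<open>-1\<close>.
\<close>

definition schouten_nijenhuis ::
  "('m, 'b::real_normed_vector) atlas \<Rightarrow> ('m \<Rightarrow> 'v::real_vector set) \<Rightarrow> nat \<Rightarrow>
   ('m, 'v) frames \<Rightarrow> (('m \<Rightarrow> 'v) \<Rightarrow> ('m \<Rightarrow> 'v) \<Rightarrow> ('m \<Rightarrow> 'v)) \<Rightarrow>
   ('m \<Rightarrow> 'v \<Rightarrow> ('m \<Rightarrow> real) \<Rightarrow> real) \<Rightarrow>
   (('m \<Rightarrow> 'v ext) \<Rightarrow> ('m \<Rightarrow> 'v ext) \<Rightarrow> ('m \<Rightarrow> 'v ext)) \<Rightarrow> bool" where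
  "schouten_nijenhuis atlas A r frames br \<rho> SN \<longleftrightarrow>
     (let \<Gamma> = wedge_sections atlas A r frames in
     (\<forall>p q. \<forall>P\<in>\<Gamma> p. \<forall>Q\<in>\<Gamma> q. SN P Q \<in> \<Gamma> (p + q - 1)) \<and>
     (\<forall>p q. \<forall>P\<in>\<Gamma> p. \<forall>Q\<in>\<Gamma> q. \<forall>R\<in>\<Gamma> q. SN P (Q + R) = SN P Q + SN P R) \<and>
     (\<forall>p q. \<forall>P\<in>\<Gamma> p. \<forall>Q\<in>\<Gamma> q. \<forall>c. SN P (c *\<^sub>R Q) = c *\<^sub>R SN P Q) \<and>
     (\<forall>X\<in>sections atlas A r frames. \<forall>Y\<in>sections atlas A r frames.
        SN (vsec X) (vsec Y) = vsec (br X Y)) \<and>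
     (\<forall>X\<in>sections atlas A r frames. \<forall>f\<in>smooth_functions atlas.
        SN (vsec X) (fsec f) = fsec (anchor_app \<rho> X f)) \<and>
     (\<forall>p q. \<forall>P\<in>\<Gamma> p. \<forall>Q\<in>\<Gamma> q.
        SN P Q = - ((-1) powi ((p - 1) * (q - 1)) *\<^sub>R SN Q P)) \<and>
     (\<forall>p q s. \<forall>P\<in>\<Gamma> p. \<forall>Q\<in>\<Gamma> q. \<forall>R\<in>\<Gamma> s.
        SN P (Q * R) = SN P Q * R + (-1) powi ((p - 1) * q) *\<^sub>R (Q * SN P R)))"


section \<open>Vector valued forms on a graded vector space\<close>

text \<open>
  A graded vector space is a family \<open>E d\<close> of subspaces of a real vector space.  Its homogeneous
  elements are represented as pairs \<open>(d, x)\<close> with \<open>x \<in> E d\<close>, and a \<open>k\<close>-form is given by its values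
  on lists of \<open>k\<close> homogeneous elements, which determine it by multilinearity.
  A formal sum of forms of a common degree has one component for each arity \<open>i \<ge> 1\<close>
  (component 0 is never used).
\<close>

record 'x vform =
  deg :: int
  comp :: "nat \<Rightarrow> (int \<times> 'x) list \<Rightarrow> 'x"

definition hom_lists :: "(int \<Rightarrow> 'x set) \<Rightarrow> nat \<Rightarrow> (int \<times> 'x) list set" where
  "hom_lists E n = {xs. length xs = n \<and> (\<forall>(d, x)\<in>set xs. x \<in> E d)}"

definition total_degree :: "(int \<times> 'x) list \<Rightarrow> int" where
  "total_degree xs = sum_list (map fst xs)"

text \<open>
  The permuted list \<^term>\<open>permute_list \<sigma> xs\<close> is \<open>X\<^bsub>\<sigma>(0)\<^esub>, X\<^bsub>\<sigma>(1)\<^esub>, \<dots>\<close>; its Koszul sign is the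
  product of \<open>(-1)\<^bsup>|X\<^sub>a||X\<^sub>b|\<^esup>\<close> over all pairs that \<open>\<sigma>\<close> puts in the opposite order.
\<close>

definition koszul_sign :: "(nat \<Rightarrow> nat) \<Rightarrow> (int \<times> 'x) list \<Rightarrow> real" where
  "koszul_sign \<sigma> xs =
     (\<Prod>(i, j) | i < j \<and> j < length xs \<and> \<sigma> j < \<sigma> i. (-1) powi (fst (xs ! \<sigma> i) * fst (xs ! \<sigma> j)))"

definition unshuffles :: "nat \<Rightarrow> nat \<Rightarrow> (nat \<Rightarrow> nat) set" where
  "unshuffles i j = {\<sigma>. \<sigma> permutes {..<i + j} \<and>
     strict_mono_on {..<i} \<sigma> \<and> strict_mono_on {i..<i + j} \<sigma>}"

definition vector_valued_form :: "(int \<Rightarrow> 'x::real_vector set) \<Rightarrow> 'x vform \<Rightarrow> bool" where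
  "vector_valued_form E K \<longleftrightarrow> (\<forall>n\<ge>1. \<forall>xs\<in>hom_lists E n.
     comp K n xs \<in> E (total_degree xs + deg K) \<and>
     (\<forall>\<sigma>. \<sigma> permutes {..<n} \<longrightarrow>
        comp K n (permute_list \<sigma> xs) = koszul_sign \<sigma> xs *\<^sub>R comp K n xs) \<and>
     (\<forall>j<n. \<forall>d. \<forall>x\<in>E d. \<forall>y\<in>E d. \<forall>c.
        comp K n (xs[j := (d, x + y)]) = comp K n (xs[j := (d, x)]) + comp K n (xs[j := (d, y)]) \<and>
        comp K n (xs[j := (d, c *\<^sub>R x)]) = c *\<^sub>R comp K n (xs[j := (d, x)])))"

definition iota ::
  "int \<Rightarrow> nat \<Rightarrow> ((int \<times> 'x) list \<Rightarrow> 'x) \<Rightarrow> nat \<Rightarrow> ((int \<times> 'x) list \<Rightarrow> 'x) \<Rightarrow>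
   (int \<times> 'x) list \<Rightarrow> 'x::real_vector" where
  "iota dK k K l L xs = (\<Sum>\<sigma>\<in>unshuffles k (l - 1).
     let ys = permute_list \<sigma> xs; zs = take k ys in
       koszul_sign \<sigma> xs *\<^sub>R L ((total_degree zs + dK, K zs) # drop k ys))"

definition rn_bracket :: "'x::real_vector vform \<Rightarrow> 'x vform \<Rightarrow> 'x vform" where
  "rn_bracket K L = \<lparr>deg = deg K + deg L,
     comp = (\<lambda>n xs. \<Sum>(k, l) | 1 \<le> k \<and> 1 \<le> l \<and> k + l = n + 1.
       iota (deg K) k (comp K k) l (comp L l) xs
       - (-1) powi (deg K * deg L) *\<^sub>R iota (deg L) l (comp L l) k (comp K k) xs)\<rparr>"

definition vform_eq :: "(int \<Rightarrow> 'x set) \<Rightarrow> 'x vform \<Rightarrow> 'x vform \<Rightarrow> bool" where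
  "vform_eq E K L \<longleftrightarrow> deg K = deg L \<and> (\<forall>n\<ge>1. \<forall>xs\<in>hom_lists E n. comp K n xs = comp L n xs)"

definition zero_vform :: "int \<Rightarrow> 'x::zero vform" where
  "zero_vform d = \<lparr>deg = d, comp = (\<lambda>n xs. 0)\<rparr>"

definition vform_of_map :: "('x \<Rightarrow> 'x) \<Rightarrow> 'x::zero vform" where
  "vform_of_map D = \<lparr>deg = 0, comp = (\<lambda>n xs. if n = 1 then D (snd (xs ! 0)) else 0)\<rparr>"

definition nijenhuis_vform ::
  "(int \<Rightarrow> 'x::real_vector set) \<Rightarrow> 'x vform \<Rightarrow> 'x vform \<Rightarrow> 'x vform \<Rightarrow> bool" where
  "nijenhuis_vform E \<mu> N K \<longleftrightarrow>
     vector_valued_form E N \<and> deg N = 0 \<and> vector_valued_form E K \<and> deg K = 0 \<and>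
     vform_eq E (rn_bracket N (rn_bracket N \<mu>)) (rn_bracket K \<mu>) \<and>
     vform_eq E (rn_bracket N K) (zero_vform 0)"


section \<open>The forms on multisections\<close>

definition multisection_space ::
  "('m, 'b::real_normed_vector) atlas \<Rightarrow> ('m \<Rightarrow> 'v::real_vector set) \<Rightarrow> nat \<Rightarrow>
   ('m, 'v) frames \<Rightarrow> int \<Rightarrow> ('m \<Rightarrow> 'v ext) set" where
  "multisection_space atlas A r frames d = wedge_sections atlas A r frames (- d)"

definition l_form ::
  "(('m \<Rightarrow> 'v::real_vector ext) \<Rightarrow> ('m \<Rightarrow> 'v ext) \<Rightarrow> ('m \<Rightarrow> 'v ext)) \<Rightarrow> nat \<Rightarrow>
   (int \<times> ('m \<Rightarrow> 'v ext)) list \<Rightarrow> ('m \<Rightarrow> 'v ext)" where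
  "l_form SN i xs =
     (if i \<le> 1 then 0
      else if i = 2 then (-1) powi fst (xs ! 0) *\<^sub>R SN (snd (xs ! 0)) (snd (xs ! 1))
      else (\<Sum>\<sigma>\<in>unshuffles 2 (i - 2).
        let ys = permute_list \<sigma> xs in
          (koszul_sign \<sigma> xs * (-1) powi fst (ys ! 0)) *\<^sub>R
            (SN (snd (ys ! 0)) (snd (ys ! 1)) * prod_list (map snd (drop 2 ys)))))"

definition mu_form ::
  "(('m \<Rightarrow> 'v::real_vector ext) \<Rightarrow> ('m \<Rightarrow> 'v ext) \<Rightarrow> ('m \<Rightarrow> 'v ext)) \<Rightarrow> (nat \<Rightarrow> real) \<Rightarrow>
   ('m \<Rightarrow> 'v ext) vform" where
  "mu_form SN a = \<lparr>deg = 1, comp = (\<lambda>i xs. a i *\<^sub>R l_form SN i xs)\<rparr>"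

end

theory Submission
  imports Defs
begin

text \<open>
  Why the theorem holds.  Let \<open>D\<close> and \<open>K\<close> be the derivations that extend \<open>N\<close> and \<open>N \<circ> N\<close>, let \<open>[P, Q]\<close>
  be the Schouten-Nijenhuis bracket, and for a bilinear operation \<open>B\<close> put
  \<open>(\<delta>\<^sub>D B) (P, Q) = B (D P, Q) + B (P, D Q) - D (B (P, Q))\<close> (\<^verbatim>\<open>bracket_deriv\<close>).

  All the forms \<open>l\<^sub>i\<close> arise from the bracket in the same way.  Because the bracket is a graded
  biderivation of the exterior product, the sum over unshuffles that defines \<open>l\<^sub>i\<close> satisfies a
  recursion on the list of arguments,
  \<open>W\<^sub>B (x, xs) = (-1)\<^bsup>|x|\<^esup> (B (x, \<Prod>xs) + x \<and> W\<^sub>B xs)\<close> (\<^verbatim>\<open>bracket_sum\<close>), in which no permutation is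
  left.  As \<open>D\<close> is a derivation of degree 0 of the exterior product, induction along this recursion
  gives \<open>[D, W\<^sub>B] = W\<^bsub>\<delta>\<^sub>D B\<^esub>\<close> for the Richardson-Nijenhuis bracket (\<^verbatim>\<open>unshuffle_sum_bracket\<close>).  Hence
  the theorem follows, simultaneously for all arities and all coefficients \<open>a\<^sub>i\<close>, from the two
  identities \<open>\<delta>\<^sub>D (\<delta>\<^sub>D [_, _]) = \<delta>\<^sub>K [_, _]\<close> and \<open>D \<circ> K = K \<circ> D\<close>.

  The operation \<open>\<delta>\<^sub>D\<close> maps biderivations to biderivations, so both sides of the first identity are
  biderivations and it is enough to compare them on functions and on sections of \<open>A\<close>.  On two
  functions both vanish for degree reasons; on a section \<open>X\<close> and a function \<open>f\<close> both are
  \<open>\<rho> (N (N X)) f\<close>; on two sections their difference is twice the torsion of \<open>N\<close>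
  (\<^verbatim>\<open>nijenhuis_bracket_deriv\<close>).  Similarly \<open>D \<circ> K - K \<circ> D\<close> is a derivation that kills functions and
  sections of \<open>A\<close>.

  Functions and sections of \<open>A\<close> generate the multisections only locally.  The passage from
  generators to all multisections is \<^verbatim>\<open>tensorial_map_eq_0\<close>: an additive map that commutes with the
  multiplication by smooth functions and kills all products of sections of \<open>A\<close> is zero.  Near a
  given point one multiplies a multisection by a power of a cutoff function; the result is a global
  finite combination of products of sections.  This needs smooth cutoff functions on the base
  manifold, which in turn need the chain rule for iterated derivatives on a finite-dimensional
  normed space and the bounded coordinates on such a space.
\<close>

section \<open>Unshuffles and Koszul signs by recursion on the list\<close>

text \<open>
  The recursion from a list \<open>xs\<close> to \<open>x # xs\<close>: the first letter \<open>x\<close> is put at position \<open>a\<close> and the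
  remaining letters are arranged by \<open>\<sigma>\<close>, whose values are shifted by one.
\<close>

definition ins_zero :: "nat \<Rightarrow> (nat \<Rightarrow> nat) \<Rightarrow> nat \<Rightarrow> nat" where
  "ins_zero a \<sigma> i = (if i < a then Suc (\<sigma> i) else if i = a then 0 else Suc (\<sigma> (i - 1)))"

lemma ins_zero_permutes:
  assumes "\<sigma> permutes {..<n}" and "a \<le> n"
  shows "ins_zero a \<sigma> permutes {..<Suc n}"
proof (rule bij_imp_permutes)
  have lt: "\<sigma> i < n \<longleftrightarrow> i < n" for i
    using permutes_in_image[OF assms(1), of i] by simp
  have inj: "inj \<sigma>"
    using assms(1) by (rule permutes_inj)
  have "inj_on (ins_zero a \<sigma>) {..<Suc n}"
    by (auto simp: inj_on_def ins_zero_def dest!: injD[OF inj] split: if_splits)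
  moreover have "ins_zero a \<sigma> ` {..<Suc n} \<subseteq> {..<Suc n}"
    using assms(2) by (auto simp: ins_zero_def lt)
  ultimately show "bij_betw (ins_zero a \<sigma>) {..<Suc n} {..<Suc n}"
    by (simp add: bij_betw_def endo_inj_surj)
  show "ins_zero a \<sigma> x = x" if "x \<notin> {..<Suc n}" for x
    using that assms permutes_not_in[OF assms(1), of "x - 1"] by (auto simp: ins_zero_def)
qed

lemma permutes_eq_ins_zero:
  assumes \<sigma>: "\<sigma> permutes {..<Suc n}" and a: "\<sigma> a = 0"
  shows "\<exists>\<tau>. \<tau> permutes {..<n} \<and> \<sigma> = ins_zero a \<tau> \<and> a \<le> n"
proof -
  define s where "s i = (if i < a then i else Suc i)" for i
  define \<tau> where "\<tau> i = \<sigma> (s i) - 1" for i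
  have inj: "inj \<sigma>"
    using \<sigma> by (rule permutes_inj)
  have an: "a \<le> n"
    using permutes_in_image[OF \<sigma>, of a] a by simp
  have lt: "\<sigma> i \<le> n \<longleftrightarrow> i \<le> n" for i
    using permutes_in_image[OF \<sigma>, of i] by (simp add: less_Suc_eq_le)
  have pos: "\<sigma> i > 0" if "i \<noteq> a" for i
    using that a injD[OF inj, of i a] by (metis gr0I)
  have sa: "s i \<noteq> a" for i
    by (simp add: s_def)
  have "\<tau> permutes {..<n}"
  proof (rule bij_imp_permutes)
    have "inj_on \<tau> {..<n}"
    proof (rule inj_onI)
      fix i j assume "\<tau> i = \<tau> j"
      then have "\<sigma> (s i) = \<sigma> (s j)"
        using pos[OF sa, of i] pos[OF sa, of j] by (simp add: \<tau>_def)
      then have "s i = s j"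
        using injD[OF inj] by blast
      then show "i = j"
        by (auto simp: s_def split: if_splits)
    qed
    moreover have "\<tau> ` {..<n} \<subseteq> {..<n}"
    proof
      fix y assume "y \<in> \<tau> ` {..<n}"
      then obtain i where i: "i < n" "y = \<sigma> (s i) - 1"
        by (auto simp: \<tau>_def)
      then have "s i \<le> n"
        by (auto simp: s_def)
      then show "y \<in> {..<n}"
        using lt[of "s i"] pos[OF sa, of i] i by auto
    qed
    ultimately show "bij_betw \<tau> {..<n} {..<n}"
      by (simp add: bij_betw_def endo_inj_surj)
    show "\<tau> x = x" if "x \<notin> {..<n}" for x
      using that an permutes_not_in[OF \<sigma>, of "Suc x"] by (simp add: \<tau>_def s_def)
  qed
  moreover have "\<sigma> = ins_zero a \<tau>"
  proof
    fix i
    consider "i < a" | "i = a" | "i > a" by linarith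
    then show "\<sigma> i = ins_zero a \<tau> i"
      by cases (use pos[of i] a in \<open>auto simp: ins_zero_def \<tau>_def s_def\<close>)
  qed
  ultimately show ?thesis
    using an by blast
qed

lemma permute_list_ins_zero:
  assumes "\<sigma> permutes {..<length xs}" and "a \<le> length xs"
  shows "permute_list (ins_zero a \<sigma>) (x # xs) =
    take a (permute_list \<sigma> xs) @ x # drop a (permute_list \<sigma> xs)"
proof (rule nth_equalityI)
  fix i assume i: "i < length (permute_list (ins_zero a \<sigma>) (x # xs))"
  consider "i < a" | "i = a" | "i > a" by linarith
  then show "permute_list (ins_zero a \<sigma>) (x # xs) ! i =
      (take a (permute_list \<sigma> xs) @ x # drop a (permute_list \<sigma> xs)) ! i"
    by cases (use i assms in \<open>auto simp: permute_list_def ins_zero_def nth_append nth_Cons'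
      less_Suc_eq_le simp del: upt_Suc\<close>)
qed (use assms in simp)

text \<open>
  Moving \<open>x\<close> to position \<open>a\<close> creates exactly the inversions of \<open>x\<close> with the \<open>a\<close> letters in front of it; the
  other inversions are those of \<open>\<sigma>\<close>.
\<close>

lemma koszul_sign_ins_zero:
  assumes \<sigma>: "\<sigma> permutes {..<length xs}" and a: "a \<le> length xs"
  shows "koszul_sign (ins_zero a \<sigma>) (x # xs) =
    (-1) powi (fst x * total_degree (take a (permute_list \<sigma> xs))) * koszul_sign \<sigma> xs"
proof -
  let ?n = "length xs" and ?\<tau> = "ins_zero a \<sigma>"
  define s where "s i = (if i < a then i else Suc i)" for i
  define g where "g = (\<lambda>(i, j). (-1::real) powi (fst ((x # xs) ! ?\<tau> i) * fst ((x # xs) ! ?\<tau> j)))"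
  define I where "I = {(i, j). i < j \<and> j < ?n \<and> \<sigma> j < \<sigma> i}"
  have s\<tau>: "?\<tau> (s i) = Suc (\<sigma> i)" for i
    by (simp add: s_def ins_zero_def)
  have sa: "s i \<noteq> a" for i
    by (simp add: s_def)
  have smono: "s i < s j \<longleftrightarrow> i < j" for i j
    by (auto simp: s_def)
  have \<tau>0: "?\<tau> i = 0 \<longleftrightarrow> i = a" for i
    by (simp add: ins_zero_def)
  have sex: "\<exists>i'. i = s i'" if "i \<noteq> a" for i
  proof (cases "i < a")
    case True
    then show ?thesis by (intro exI[of _ i]) (simp add: s_def)
  next
    case False
    then show ?thesis using that by (intro exI[of _ "i - 1"]) (auto simp: s_def)
  qed
  have slt: "s j < Suc ?n \<longleftrightarrow> j < ?n" for j
    using a by (auto simp: s_def)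
  have inv: "{(i, j). i < j \<and> j < length (x # xs) \<and> ?\<tau> j < ?\<tau> i} =
      (\<lambda>i. (i, a)) ` {..<a} \<union> map_prod s s ` I"
  proof (intro set_eqI iffI; clarify)
    fix i j assume ij: "i < j" "j < length (x # xs)" "?\<tau> j < ?\<tau> i"
      and "(i, j) \<notin> map_prod s s ` I"
    show "(i, j) \<in> (\<lambda>i. (i, a)) ` {..<a}"
    proof (cases "j = a")
      case True
      then show ?thesis using ij by auto
    next
      case False
      have "i \<noteq> a" using ij(3) \<tau>0[of a] by auto
      with False obtain i' j' where "i = s i'" "j = s j'"
        using sex by metis
      then have "(i', j') \<in> I"
        using ij by (auto simp: I_def smono s\<tau> slt)
      then show ?thesis
        using \<open>(i, j) \<notin> map_prod s s ` I\<close> \<open>i = s i'\<close> \<open>j = s j'\<close> by force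
    qed
  next
    fix i j assume "(i, j) \<in> (\<lambda>i. (i, a)) ` {..<a} \<union> map_prod s s ` I"
    then show "i < j \<and> j < length (x # xs) \<and> ?\<tau> j < ?\<tau> i"
    proof
      assume "(i, j) \<in> (\<lambda>i. (i, a)) ` {..<a}"
      then show ?thesis using a by (auto simp: ins_zero_def)
    next
      assume "(i, j) \<in> map_prod s s ` I"
      then show ?thesis by (auto simp: I_def smono s\<tau> slt)
    qed
  qed
  have fin: "finite I"
    by (rule finite_subset[of _ "{..<?n} \<times> {..<?n}"]) (auto simp: I_def)
  have disj: "(\<lambda>i. (i, a)) ` {..<a} \<inter> map_prod s s ` I = {}"
    using sa by auto
  have "inj s"
    using smono by (metis injI linorder_neqE_nat less_irrefl)
  then have "inj_on (map_prod s s) I"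
    by (meson prod.inj_map inj_on_subset subset_UNIV)
  then have "prod g (map_prod s s ` I) = koszul_sign \<sigma> xs"
    by (simp add: prod.reindex g_def koszul_sign_def I_def s\<tau> case_prod_beta)
  moreover have "prod g ((\<lambda>i. (i, a)) ` {..<a}) =
      (-1) powi (fst x * total_degree (take a (permute_list \<sigma> xs)))"
  proof -
    have "prod g ((\<lambda>i. (i, a)) ` {..<a}) = (\<Prod>i<a. (-1) powi (fst x * fst (permute_list \<sigma> xs ! i)))"
      using a by (subst prod.reindex)
        (auto simp: g_def inj_on_def ins_zero_def permute_list_def mult.commute intro!: prod.cong)
    also have "\<dots> = (-1) powi (\<Sum>i<a. fst x * fst (permute_list \<sigma> xs ! i))"
      by (induction a) (auto simp: power_int_add)
    also have "(\<Sum>i<a. fst x * fst (permute_list \<sigma> xs ! i)) =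
        fst x * total_degree (take a (permute_list \<sigma> xs))"
    proof -
      have "map fst (take a (permute_list \<sigma> xs)) = map (\<lambda>i. fst (permute_list \<sigma> xs ! i)) [0..<a]"
        using a by (intro nth_equalityI) auto
      then show ?thesis
        by (simp add: total_degree_def sum_distrib_left interv_sum_list_conv_sum_set_nat
            atLeast0LessThan)
    qed
    finally show ?thesis .
  qed
  ultimately show ?thesis
    using disj fin unfolding koszul_sign_def inv g_def[symmetric]
    by (subst prod.union_disjoint) auto
qed

lemma unshuffles_zero: "unshuffles 0 j = {id}" and unshuffles_zero_right: "unshuffles j 0 = {id}"
proof -
  have *: "\<sigma> = id" if \<sigma>: "\<sigma> permutes {..<j}" and m: "strict_mono_on {..<j} \<sigma>" for \<sigma>
  proof
    fix i
    show "\<sigma> i = id i"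
    proof (cases "i < j")
      case False
      then show ?thesis using permutes_not_in[OF \<sigma>] by simp
    next
      case True
      then show ?thesis
      proof (induction i rule: less_induct)
        case (less i)
        \<comment> \<open>The preimage of \<open>i\<close> is not smaller than \<open>i\<close> because \<open>\<sigma>\<close> fixes the smaller numbers; if it
            were larger, monotonicity would force \<open>\<sigma> i < i\<close>, a value that is already taken.\<close>
        have "\<sigma> i < j"
          using permutes_in_image[OF \<sigma>, of i] less.prems by simp
        obtain q where q: "\<sigma> q = i"
          using permutes_surj[OF \<sigma>] by (metis surjD)
        then have "q < j"
          using permutes_in_image[OF \<sigma>, of q] less.prems by simp
        have "\<not> q < i"
          using less.IH[of q] \<open>q < j\<close> q by auto
        moreover have "\<not> i < q"
        proof
          assume "i < q"
          then have "\<sigma> i < i"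
            using strict_mono_onD[OF m, of i q] \<open>q < j\<close> less.prems q by simp
          then have "\<sigma> (\<sigma> i) = \<sigma> i"
            using less.IH[of "\<sigma> i"] \<open>\<sigma> i < j\<close> by simp
          then show False
            using permutes_inj[OF \<sigma>] \<open>\<sigma> i < i\<close> by (metis injD less_irrefl)
        qed
        ultimately show ?case using q by (metis id_apply linorder_neqE_nat)
      qed
    qed
  qed
  have "{..<0::nat} = {}" by simp
  then show "unshuffles 0 j = {id}" "unshuffles j 0 = {id}"
    unfolding unshuffles_def using *
    by (auto simp: permutes_id strict_mono_on_def atLeast0LessThan simp del: id_apply)
      (auto simp: permutes_id)
qed

text \<open>
  Both blocks of an unshuffle are increasing, so the letter 0 stands at the head of one of them.
\<close>

lemma unshuffles_Suc:
  "unshuffles (Suc k) (Suc j) =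
    ins_zero 0 ` unshuffles k (Suc j) \<union> ins_zero (Suc k) ` unshuffles (Suc k) j"
proof (intro set_eqI iffI)
  fix \<sigma> assume "\<sigma> \<in> unshuffles (Suc k) (Suc j)"
  then have \<sigma>: "\<sigma> permutes {..<Suc (Suc k + j)}"
    and m1: "strict_mono_on {..<Suc k} \<sigma>" and m2: "strict_mono_on {Suc k..<Suc (Suc k + j)} \<sigma>"
    by (auto simp: unshuffles_def)
  obtain a where a0: "\<sigma> a = 0"
    using permutes_surj[OF \<sigma>] by (metis surjD)
  obtain \<tau> where \<tau>: "\<tau> permutes {..<Suc k + j}" and eq: "\<sigma> = ins_zero a \<tau>" and a: "a \<le> Suc k + j"
    using permutes_eq_ins_zero[OF \<sigma> a0] by blast
  have "a = 0 \<or> a = Suc k"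
  proof (rule ccontr)
    assume "\<not> (a = 0 \<or> a = Suc k)"
    then have "\<sigma> (a - 1) < \<sigma> a"
    proof (cases "a < Suc k")
      case True
      then show ?thesis
        using strict_mono_onD[OF m1, of "a - 1" a] \<open>\<not> (a = 0 \<or> a = Suc k)\<close> by simp
    next
      case False
      then have "Suc k \<le> a - 1" "a - 1 < a"
        using \<open>\<not> (a = 0 \<or> a = Suc k)\<close> by linarith+
      then show ?thesis
        using strict_mono_onD[OF m2, of "a - 1" a] a by simp
    qed
    then show False using a0 by simp
  qed
  then show "\<sigma> \<in> ins_zero 0 ` unshuffles k (Suc j) \<union> ins_zero (Suc k) ` unshuffles (Suc k) j"
  proof
    assume [simp]: "a = 0"
    have "\<tau> x < \<tau> y" if "x < y" "y < k \<or> k \<le> x \<and> y < Suc (k + j)" for x y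
      using strict_mono_onD[OF m1, of "Suc x" "Suc y"] strict_mono_onD[OF m2, of "Suc x" "Suc y"] that
      by (auto simp: eq ins_zero_def)
    then have "\<tau> \<in> unshuffles k (Suc j)"
      using \<tau> by (auto simp: unshuffles_def strict_mono_on_def)
    then show ?thesis using eq by auto
  next
    assume [simp]: "a = Suc k"
    have "\<tau> x < \<tau> y" if "x < y" "y < Suc k" for x y
      using strict_mono_onD[OF m1, of x y] that by (auto simp: eq ins_zero_def)
    moreover have "\<tau> x < \<tau> y" if "x < y" "Suc k \<le> x" "y < Suc (k + j)" for x y
      using strict_mono_onD[OF m2, of "Suc x" "Suc y"] that by (auto simp: eq ins_zero_def)
    ultimately have "\<tau> \<in> unshuffles (Suc k) j"
      using \<tau> by (auto simp: unshuffles_def strict_mono_on_def)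
    then show ?thesis using eq by auto
  qed
next
  fix \<sigma> assume "\<sigma> \<in> ins_zero 0 ` unshuffles k (Suc j) \<union> ins_zero (Suc k) ` unshuffles (Suc k) j"
  then show "\<sigma> \<in> unshuffles (Suc k) (Suc j)"
  proof
    assume "\<sigma> \<in> ins_zero 0 ` unshuffles k (Suc j)"
    then obtain \<tau> where eq: "\<sigma> = ins_zero 0 \<tau>" and \<tau>: "\<tau> permutes {..<Suc k + j}"
      and m1: "strict_mono_on {..<k} \<tau>" and m2: "strict_mono_on {k..<k + Suc j} \<tau>"
      by (auto simp: unshuffles_def)
    have "\<sigma> x < \<sigma> y" if "x < y" "y < Suc k \<or> Suc k \<le> x \<and> y < Suc (Suc (k + j))" for x y
      using strict_mono_onD[OF m1, of "x - 1" "y - 1"] strict_mono_onD[OF m2, of "x - 1" "y - 1"] that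
      by (auto simp: eq ins_zero_def)
    then show ?thesis
      using ins_zero_permutes[OF \<tau>, of 0] eq by (auto simp: unshuffles_def strict_mono_on_def)
  next
    assume "\<sigma> \<in> ins_zero (Suc k) ` unshuffles (Suc k) j"
    then obtain \<tau> where eq: "\<sigma> = ins_zero (Suc k) \<tau>" and \<tau>: "\<tau> permutes {..<Suc k + j}"
      and m1: "strict_mono_on {..<Suc k} \<tau>" and m2: "strict_mono_on {Suc k..<Suc k + j} \<tau>"
      by (auto simp: unshuffles_def)
    have "\<sigma> x < \<sigma> y" if "x < y" "y < Suc k" for x y
      using strict_mono_onD[OF m1, of x y] that by (auto simp: eq ins_zero_def)
    moreover have "\<sigma> x < \<sigma> y" if "x < y" "Suc k \<le> x" "y < Suc (Suc (k + j))" for x y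
      using strict_mono_onD[OF m2, of "x - 1" "y - 1"] that by (auto simp: eq ins_zero_def)
    ultimately show ?thesis
      using ins_zero_permutes[OF \<tau>, of "Suc k"] eq by (auto simp: unshuffles_def strict_mono_on_def)
  qed
qed

text \<open>
  The signed sum of \<open>F u v\<close> over all ways to distribute a list into a first block \<open>u\<close> of \<open>k\<close> entries
  and a second block \<open>v\<close>.  An entry that goes to the second block passes all of \<open>u\<close>, which explains
  the sign.
\<close>

fun unshuffle_sum ::
  "nat \<Rightarrow> ((int \<times> 'x) list \<Rightarrow> (int \<times> 'x) list \<Rightarrow> 'x::real_vector) \<Rightarrow> (int \<times> 'x) list \<Rightarrow> 'x" where
  "unshuffle_sum 0 F xs = F [] xs"
| "unshuffle_sum (Suc k) F [] = 0"
| "unshuffle_sum (Suc k) F (x # xs) = unshuffle_sum k (\<lambda>u v. F (x # u) v) xs +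
     unshuffle_sum (Suc k) (\<lambda>u v. (-1) powi (fst x * total_degree u) *\<^sub>R F u (x # v)) xs"

lemma unshuffle_sum_short: "length xs < k \<Longrightarrow> unshuffle_sum k F xs = 0"
  by (induction k F xs rule: unshuffle_sum.induct) auto

lemma unshuffle_sum_all: "length xs = k \<Longrightarrow> unshuffle_sum k F xs = F xs []"
  by (induction k F xs rule: unshuffle_sum.induct) (auto simp: unshuffle_sum_short)

lemma koszul_sign_id [simp]: "koszul_sign id xs = 1"
proof -
  have "{(i, j). i < j \<and> j < length xs \<and> id j < id i} = {}" by auto
  then show ?thesis unfolding koszul_sign_def by (simp only: prod.empty)
qed

text \<open>
  This removes permutations from all later arguments.
\<close>

lemma sum_unshuffles:
  "k + j = length xs \<Longrightarrow>
   (\<Sum>\<sigma>\<in>unshuffles k j. koszul_sign \<sigma> xs *\<^sub>R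
     F (take k (permute_list \<sigma> xs)) (drop k (permute_list \<sigma> xs))) = unshuffle_sum k F xs"
proof (induction k F xs arbitrary: j rule: unshuffle_sum.induct)
  case (1 F xs)
  then show ?case by (simp add: unshuffles_zero del: id_apply)
next
  case (2 k F)
  then show ?case by simp
next
  case (3 k F x xs)
  show ?case
  proof (cases j)
    case 0
    then show ?thesis
      using 3(3) by (simp add: unshuffles_zero_right unshuffle_sum_all unshuffle_sum_short del: id_apply)
  next
    case (Suc i)
    have len: "k + Suc i = length xs"
      using 3(3) Suc by simp
    have fin: "finite (unshuffles p q)" for p q
      unfolding unshuffles_def by (rule finite_subset[OF _ finite_permutations]) auto
    have disj: "ins_zero 0 ` unshuffles k (Suc i) \<inter> ins_zero (Suc k) ` unshuffles (Suc k) i = {}"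
      by (auto simp: ins_zero_def fun_eq_iff split: if_splits)
    have inj: "inj (ins_zero a)" for a
    proof (rule injI)
      fix \<sigma> \<tau> assume eq: "ins_zero a \<sigma> = ins_zero a \<tau>"
      show "\<sigma> = \<tau>"
      proof
        fix i
        show "\<sigma> i = \<tau> i"
          using fun_cong[OF eq, of i] fun_cong[OF eq, of "Suc i"]
          by (cases "i < a") (auto simp: ins_zero_def)
      qed
    qed
    let ?G = "\<lambda>\<sigma>. koszul_sign \<sigma> (x # xs) *\<^sub>R
       F (take (Suc k) (permute_list \<sigma> (x # xs))) (drop (Suc k) (permute_list \<sigma> (x # xs)))"
    have "sum ?G (unshuffles (Suc k) (Suc i)) =
        (\<Sum>\<sigma>\<in>unshuffles k (Suc i). ?G (ins_zero 0 \<sigma>)) +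
        (\<Sum>\<sigma>\<in>unshuffles (Suc k) i. ?G (ins_zero (Suc k) \<sigma>))"
      unfolding unshuffles_Suc by (subst sum.union_disjoint)
        (use disj fin in \<open>auto simp: sum.reindex inj_on_subset[OF inj]\<close>)
    also have "(\<Sum>\<sigma>\<in>unshuffles k (Suc i). ?G (ins_zero 0 \<sigma>)) =
        unshuffle_sum k (\<lambda>u v. F (x # u) v) xs"
      unfolding 3(1)[OF len, symmetric]
    proof (rule sum.cong[OF refl])
      fix \<sigma> assume "\<sigma> \<in> unshuffles k (Suc i)"
      then have \<sigma>: "\<sigma> permutes {..<length xs}"
        using len by (simp add: unshuffles_def)
      show "?G (ins_zero 0 \<sigma>) = koszul_sign \<sigma> xs *\<^sub>R
          F (x # take k (permute_list \<sigma> xs)) (drop k (permute_list \<sigma> xs))"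
        using permute_list_ins_zero[OF \<sigma>, of 0 x] koszul_sign_ins_zero[OF \<sigma>, of 0 x]
        by (simp add: total_degree_def)
    qed
    also have "(\<Sum>\<sigma>\<in>unshuffles (Suc k) i. ?G (ins_zero (Suc k) \<sigma>)) =
        unshuffle_sum (Suc k) (\<lambda>u v. (-1) powi (fst x * total_degree u) *\<^sub>R F u (x # v)) xs"
    proof (subst 3(2)[of i, symmetric])
      show "Suc k + i = length xs" using len by simp
      show "(\<Sum>\<sigma>\<in>unshuffles (Suc k) i. ?G (ins_zero (Suc k) \<sigma>)) =
        (\<Sum>\<sigma>\<in>unshuffles (Suc k) i. koszul_sign \<sigma> xs *\<^sub>R
          (-1) powi (fst x * total_degree (take (Suc k) (permute_list \<sigma> xs))) *\<^sub>R
          F (take (Suc k) (permute_list \<sigma> xs)) (x # drop (Suc k) (permute_list \<sigma> xs)))"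
      proof (rule sum.cong[OF refl])
        fix \<sigma> assume "\<sigma> \<in> unshuffles (Suc k) i"
        then have \<sigma>: "\<sigma> permutes {..<length xs}"
          using len by (simp add: unshuffles_def)
        have l: "Suc k \<le> length xs" using len by simp
        show "?G (ins_zero (Suc k) \<sigma>) = koszul_sign \<sigma> xs *\<^sub>R
            (-1) powi (fst x * total_degree (take (Suc k) (permute_list \<sigma> xs))) *\<^sub>R
            F (take (Suc k) (permute_list \<sigma> xs)) (x # drop (Suc k) (permute_list \<sigma> xs))"
          using permute_list_ins_zero[OF \<sigma> l, of x] koszul_sign_ins_zero[OF \<sigma> l, of x] l
          by (simp add: mult.commute del: take_Suc drop_Suc)
      qed
    qed
    finally show ?thesis using Suc by simp
  qed
qed

lemma unshuffle_sum_cong: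
  assumes "\<And>u v. mset u + mset v = mset xs \<Longrightarrow> length u = k \<Longrightarrow> F u v = G u v"
  shows "unshuffle_sum k F xs = unshuffle_sum k G xs"
  using assms
proof (induction k F xs arbitrary: G rule: unshuffle_sum.induct)
  case (1 F xs)
  have "F [] xs = G [] xs"
    by (rule 1(1)) simp_all
  then show ?case by (simp only: unshuffle_sum.simps)
next
  case (2 k F)
  show ?case by simp
next
  case (3 k F x xs)
  have "F (x # u) v = G (x # u) v" if "mset u + mset v = mset xs" "length u = k" for u v
    by (rule 3(3)) (use that in simp_all)
  then have A: "unshuffle_sum k (\<lambda>u v. F (x # u) v) xs = unshuffle_sum k (\<lambda>u v. G (x # u) v) xs"
    using 3(1)[of "\<lambda>u v. G (x # u) v"] by blast
  have "F u (x # v) = G u (x # v)" if "mset u + mset v = mset xs" "length u = Suc k" for u v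
    by (rule 3(3)) (use that in simp_all)
  then have B: "unshuffle_sum (Suc k) (\<lambda>u v. (-1) powi (fst x * total_degree u) *\<^sub>R F u (x # v)) xs
    = unshuffle_sum (Suc k) (\<lambda>u v. (-1) powi (fst x * total_degree u) *\<^sub>R G u (x # v)) xs"
    using 3(2)[of "\<lambda>u v. (-1) powi (fst x * total_degree u) *\<^sub>R G u (x # v)"] by (metis (no_types))
  show ?case by (simp only: unshuffle_sum.simps A B)
qed

section \<open>Brackets and derivations on a graded commutative algebra\<close>

text \<open>
  The map \<open>h\<close> is linear on a subspace only: a derivation, or a bracket with a fixed element, is
  linear on each homogeneous component and arbitrary elsewhere.
\<close>

lemma unshuffle_sum_linear:
  assumes S: "subspace S"
    and add: "\<And>x y. x \<in> S \<Longrightarrow> y \<in> S \<Longrightarrow> h (x + y) = h x + h y"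
    and scale: "\<And>c x. x \<in> S \<Longrightarrow> h (c *\<^sub>R x) = c *\<^sub>R h x"
    and F: "\<And>u v. mset u + mset v = mset xs \<Longrightarrow> length u = k \<Longrightarrow> F u v \<in> S"
  shows "unshuffle_sum k F xs \<in> S \<and>
    h (unshuffle_sum k F xs) = unshuffle_sum k (\<lambda>u v. h (F u v)) xs"
  using F
proof (induction k F xs rule: unshuffle_sum.induct)
  case (1 F xs)
  have "F [] xs \<in> S"
    by (rule 1) simp_all
  then show ?case by simp
next
  case (2 k F)
  show ?case using scale[of 0 0] subspace_0[OF S] by simp
next
  case (3 k F x xs)
  have 1: "F (x # u) v \<in> S" if "mset u + mset v = mset xs" "length u = k" for u v
    by (rule 3(3)) (use that in simp_all)
  have 2: "F u (x # v) \<in> S" if "mset u + mset v = mset xs" "length u = Suc k" for u v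
    by (rule 3(3)) (use that in simp_all)
  let ?F = "\<lambda>u v. (-1) powi (fst x * total_degree u) *\<^sub>R F u (x # v)"
  have IH1: "unshuffle_sum k (\<lambda>u v. F (x # u) v) xs \<in> S \<and> h (unshuffle_sum k (\<lambda>u v. F (x # u) v) xs)
      = unshuffle_sum k (\<lambda>u v. h (F (x # u) v)) xs"
    by (rule 3(1)) (fact 1)
  have IH2: "unshuffle_sum (Suc k) ?F xs \<in> S \<and> h (unshuffle_sum (Suc k) ?F xs) =
      unshuffle_sum (Suc k) (\<lambda>u v. h (?F u v)) xs"
    by (rule 3(2)) (simp add: subspace_scale[OF S] 2)
  have eq: "unshuffle_sum (Suc k) (\<lambda>u v. h (?F u v)) xs =
      unshuffle_sum (Suc k) (\<lambda>u v. (-1) powi (fst x * total_degree u) *\<^sub>R h (F u (x # v))) xs"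
    by (rule unshuffle_sum_cong) (simp add: scale 2)
  show ?case
    using IH1 IH2 eq add subspace_add[OF S] by simp
qed

lemma unshuffle_sum_add:
  "unshuffle_sum k (\<lambda>u v. F u v + G u v) xs = unshuffle_sum k F xs + unshuffle_sum k G xs"
proof (induction k F xs arbitrary: G rule: unshuffle_sum.induct)
  case (3 k F x xs)
  show ?case
    by (simp only: unshuffle_sum.simps scaleR_add_right 3) (simp only: add_ac)
qed simp_all

text \<open>
  The recursive form of the unshuffle sum of \<open>(-1)\<^bsup>|P|\<^esup> B (P, Q)\<close> times the product of the other
  entries: either the first entry is one of the two arguments of \<open>B\<close>, and the Leibniz rule collects
  these terms into \<open>B\<close> of the first entry with the whole product, or it is a factor in front of
  the bracket.
\<close>

fun bracket_sum ::
  "('x::real_algebra_1 \<Rightarrow> 'x \<Rightarrow> 'x) \<Rightarrow> (int \<times> 'x) list \<Rightarrow> 'x" where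
  "bracket_sum B [] = 0"
| "bracket_sum B (x # xs) = (-1) powi fst x *\<^sub>R
     (B (snd x) (prod_list (map snd xs)) + snd x * bracket_sum B xs)"

text \<open>
  The failure of \<open>D\<close> to be a derivation of the operation \<open>B\<close>; up to the factor \<open>(-1)\<^bsup>|P|\<^esup>\<close> that makes
  a graded skew-symmetric \<open>B\<close> graded symmetric, this is the Richardson-Nijenhuis bracket of \<open>D\<close> and \<open>B\<close>.
\<close>

definition bracket_deriv :: "('x \<Rightarrow> 'x) \<Rightarrow> ('x \<Rightarrow> 'x \<Rightarrow> 'x) \<Rightarrow> 'x \<Rightarrow> 'x \<Rightarrow> 'x::ring" where
  "bracket_deriv D B P Q = B (D P) Q + B P (D Q) - D (B P Q)"

locale graded_commutative_algebra =
  fixes \<Gamma> :: "int \<Rightarrow> 'x::real_algebra_1 set"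
  assumes subspace: "subspace (\<Gamma> k)"
    and one: "1 \<in> \<Gamma> 0"
    and mult: "P \<in> \<Gamma> p \<Longrightarrow> Q \<in> \<Gamma> q \<Longrightarrow> P * Q \<in> \<Gamma> (p + q)"
    and commute: "P \<in> \<Gamma> p \<Longrightarrow> Q \<in> \<Gamma> q \<Longrightarrow> P * Q = (-1) powi (p * q) *\<^sub>R (Q * P)"
begin

text \<open>
  As in the graded space of multisections, the degree stored in a pair is the negative of the
  exterior degree.
\<close>

definition homogeneous :: "(int \<times> 'x) list \<Rightarrow> bool" where
  "homogeneous xs \<longleftrightarrow> (\<forall>x\<in>set xs. snd x \<in> \<Gamma> (- fst x))"

definition derivation :: "('x \<Rightarrow> 'x) \<Rightarrow> bool" where
  "derivation D \<longleftrightarrow>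
     (\<forall>k. \<forall>P\<in>\<Gamma> k. D P \<in> \<Gamma> k) \<and>
     (\<forall>k. \<forall>P\<in>\<Gamma> k. \<forall>Q\<in>\<Gamma> k. D (P + Q) = D P + D Q) \<and>
     (\<forall>k. \<forall>P\<in>\<Gamma> k. \<forall>c. D (c *\<^sub>R P) = c *\<^sub>R D P) \<and>
     (\<forall>p q. \<forall>P\<in>\<Gamma> p. \<forall>Q\<in>\<Gamma> q. D (P * Q) = D P * Q + P * D Q)"

definition biderivation :: "('x \<Rightarrow> 'x \<Rightarrow> 'x) \<Rightarrow> bool" where
  "biderivation B \<longleftrightarrow>
     (\<forall>p q. \<forall>P\<in>\<Gamma> p. \<forall>Q\<in>\<Gamma> q. B P Q \<in> \<Gamma> (p + q - 1)) \<and>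
     (\<forall>p q. \<forall>P\<in>\<Gamma> p. \<forall>Q\<in>\<Gamma> q. \<forall>R\<in>\<Gamma> q. B P (Q + R) = B P Q + B P R) \<and>
     (\<forall>p q. \<forall>P\<in>\<Gamma> p. \<forall>Q\<in>\<Gamma> q. \<forall>c. B P (c *\<^sub>R Q) = c *\<^sub>R B P Q) \<and>
     (\<forall>p q. \<forall>P\<in>\<Gamma> p. \<forall>Q\<in>\<Gamma> q. B P Q = - ((-1) powi ((p - 1) * (q - 1)) *\<^sub>R B Q P)) \<and>
     (\<forall>p q s. \<forall>P\<in>\<Gamma> p. \<forall>Q\<in>\<Gamma> q. \<forall>R\<in>\<Gamma> s.
        B P (Q * R) = B P Q * R + (-1) powi ((p - 1) * q) *\<^sub>R (Q * B P R))"

lemma zero_closed: "0 \<in> \<Gamma> k"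
  using subspace by (rule subspace_0)

lemma add_closed: "P \<in> \<Gamma> k \<Longrightarrow> Q \<in> \<Gamma> k \<Longrightarrow> P + Q \<in> \<Gamma> k"
  using subspace by (rule subspace_add)

lemma diff_closed: "P \<in> \<Gamma> k \<Longrightarrow> Q \<in> \<Gamma> k \<Longrightarrow> P - Q \<in> \<Gamma> k"
  using subspace by (rule subspace_diff)

lemma scale_closed: "P \<in> \<Gamma> k \<Longrightarrow> c *\<^sub>R P \<in> \<Gamma> k"
  using subspace by (rule subspace_scale)

lemma mult_closed: "P \<in> \<Gamma> p \<Longrightarrow> Q \<in> \<Gamma> q \<Longrightarrow> p + q = s \<Longrightarrow> P * Q \<in> \<Gamma> s"
  using mult by blast

lemma homogeneous_Nil [simp]: "homogeneous []"
  and homogeneous_Cons [simp]: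
    "homogeneous (x # xs) \<longleftrightarrow> snd x \<in> \<Gamma> (- fst x) \<and> homogeneous xs"
  by (auto simp: homogeneous_def)

lemma homogeneous_mset: 
  assumes "mset u + mset v = mset xs" "homogeneous xs"
  shows "homogeneous u" "homogeneous v" "total_degree u + total_degree v = total_degree xs"
proof -
  have "mset (u @ v) = mset xs" using assms(1) by simp
  then have "set (u @ v) = set xs" by (rule mset_eq_setD)
  then show "homogeneous u" "homogeneous v"
    using assms(2) by (auto simp: homogeneous_def)
  have "sum_list (map fst (u @ v)) = sum_list (map fst xs)"
    by (metis \<open>mset (u @ v) = mset xs\<close> mset_map sum_mset_sum_list)
  then show "total_degree u + total_degree v = total_degree xs"
    by (simp add: total_degree_def)
qed

lemma prod_closed: "homogeneous xs \<Longrightarrow> prod_list (map snd xs) \<in> \<Gamma> (- total_degree xs)"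
proof (induction xs)
  case Nil
  then show ?case using one by (simp add: total_degree_def)
next
  case (Cons x xs)
  then show ?case using mult[of "snd x" "- fst x" _ "- total_degree xs"]
    by (simp add: total_degree_def algebra_simps)
qed

context
  fixes D
  assumes D: "derivation D"
begin

lemma D_closed: "P \<in> \<Gamma> k \<Longrightarrow> D P \<in> \<Gamma> k"
  and D_add: "P \<in> \<Gamma> k \<Longrightarrow> Q \<in> \<Gamma> k \<Longrightarrow> D (P + Q) = D P + D Q"
  and D_scale: "P \<in> \<Gamma> k \<Longrightarrow> D (c *\<^sub>R P) = c *\<^sub>R D P"
  and D_mult: "P \<in> \<Gamma> p \<Longrightarrow> Q \<in> \<Gamma> q \<Longrightarrow> D (P * Q) = D P * Q + P * D Q"
  using D unfolding derivation_def by blast+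

lemma D_zero: "D 0 = 0"
  using D_scale[OF zero_closed, of 0] by simp

lemma D_one: "D 1 = 0"
  using D_mult[OF one one] by simp

lemma D_diff: "P \<in> \<Gamma> k \<Longrightarrow> Q \<in> \<Gamma> k \<Longrightarrow> D (P - Q) = D P - D Q"
  using D_add[of P k "(-1) *\<^sub>R Q"] D_scale[of Q k "-1"] scale_closed[of Q k "-1"] by simp

text \<open>
  The Leibniz rule for a product of many factors, with each differentiated factor moved to the front.
\<close>

lemma unshuffle_sum_prod:
  assumes "homogeneous xs"
  shows "unshuffle_sum 1 (\<lambda>u v. D (snd (u ! 0)) * prod_list (map snd v)) xs =
    D (prod_list (map snd xs))"
  using assms
proof (induction xs)
  case Nil
  then show ?case by (simp add: D_one)
next
  case (Cons x xs)
  have "unshuffle_sum 1 (\<lambda>u v. (-1) powi (fst x * total_degree u) *\<^sub>R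
      (D (snd (u ! 0)) * (snd x * prod_list (map snd v)))) xs =
    unshuffle_sum 1 (\<lambda>u v. snd x * (D (snd (u ! 0)) * prod_list (map snd v))) xs"
  proof (rule unshuffle_sum_cong)
    fix u v :: "(int \<times> 'x) list"
    assume uv: "mset u + mset v = mset xs" "length u = 1"
    then obtain y where [simp]: "u = [y]" by (cases u) auto
    have "homogeneous u" using homogeneous_mset[OF uv(1)] Cons.prems by simp
    then have "D (snd y) \<in> \<Gamma> (- fst y)" by (simp add: D_closed)
    then have "D (snd y) * snd x = (-1) powi (fst y * fst x) *\<^sub>R (snd x * D (snd y))"
      using commute[of "D (snd y)" "- fst y" "snd x" "- fst x"] Cons.prems by simp
    then have "D (snd y) * (snd x * R) = (-1) powi (fst y * fst x) *\<^sub>R (snd x * (D (snd y) * R))" for R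
      by (simp add: mult.assoc[symmetric])
    then show "(-1) powi (fst x * total_degree u) *\<^sub>R
      (D (snd (u ! 0)) * (snd x * prod_list (map snd v))) =
      snd x * (D (snd (u ! 0)) * prod_list (map snd v))"
      by (simp add: total_degree_def mult.commute)
  qed
  also have "\<dots> = snd x * unshuffle_sum 1 (\<lambda>u v. D (snd (u ! 0)) * prod_list (map snd v)) xs"
    using unshuffle_sum_linear[of UNIV "(*) (snd x)" xs 1 
        "\<lambda>u v. D (snd (u ! 0)) * prod_list (map snd v)"]
    by (simp add: distrib_left)
  also have "\<dots> = snd x * D (prod_list (map snd xs))"
    using Cons by simp
  finally show ?case
    using D_mult[of "snd x" _ "prod_list (map snd xs)", OF _ prod_closed] Cons.prems by auto
qed

end

context
  fixes B
  assumes B: "biderivation B"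
begin

lemmas B_closed = B[unfolded biderivation_def, THEN conjunct1, rule_format]
lemmas B_add = B[unfolded biderivation_def, THEN conjunct2, THEN conjunct1, rule_format]
lemmas B_scale = B[unfolded biderivation_def, THEN conjunct2, THEN conjunct2, THEN conjunct1,
    rule_format]
lemmas B_skew = B[unfolded biderivation_def, THEN conjunct2, THEN conjunct2, THEN conjunct2,
    THEN conjunct1, rule_format]
lemmas B_mult = B[unfolded biderivation_def, THEN conjunct2, THEN conjunct2, THEN conjunct2,
    THEN conjunct2, rule_format]

lemma B_zero: "P \<in> \<Gamma> p \<Longrightarrow> B P 0 = 0"
  using B_scale[of P p 0 0 0] zero_closed by simp

lemma B_zero_left: "P \<in> \<Gamma> p \<Longrightarrow> B 0 P = 0"
  using B_skew[of 0 0 P p] zero_closed B_zero by simp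

lemma B_one: "P \<in> \<Gamma> p \<Longrightarrow> B P 1 = 0"
  using B_mult[of P p 1 0 1 0] one by simp

lemma bracket_sum_closed:
  "homogeneous xs \<Longrightarrow> bracket_sum B xs \<in> \<Gamma> (- total_degree xs - 1)"
proof (induction xs)
  case Nil
  then show ?case by (simp add: zero_closed)
next
  case (Cons x xs)
  have "B (snd x) (prod_list (map snd xs)) \<in> \<Gamma> (- total_degree (x # xs) - 1)"
    using B_closed[of "snd x" "- fst x" _ "- total_degree xs"] Cons.prems prod_closed
    by (simp add: total_degree_def)
  moreover have "snd x * bracket_sum B xs \<in> \<Gamma> (- total_degree (x # xs) - 1)"
    using Cons by (intro mult_closed[of _ "- fst x" _ "- total_degree xs - 1"])
      (auto simp: total_degree_def)
  ultimately show ?case by (simp only: bracket_sum.simps) (intro scale_closed add_closed)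
qed

text \<open>
  Graded symmetry in the first two entries is the only symmetry that the computation of
  \<open>[D, W\<^sub>B]\<close> needs: it moves the entry to which \<open>D\<close> is applied past the first entry.  It is the graded
  commutativity of the product together with the graded skew-symmetry of \<open>B\<close>.
\<close>

lemma bracket_sum_swap:
  assumes "homogeneous (x # y # zs)"
  shows "bracket_sum B (x # y # zs) = (-1) powi (fst x * fst y) *\<^sub>R bracket_sum B (y # x # zs)"
proof -
  obtain d P e Q where [simp]: "x = (d, P)" "y = (e, Q)"
    by (metis surj_pair)
  have P: "P \<in> \<Gamma> (- d)" and Q: "Q \<in> \<Gamma> (- e)" and zs: "homogeneous zs"
    using assms by auto
  let ?Z = "prod_list (map snd zs)" and ?W = "bracket_sum B zs"
  have "P * Q = (-1) powi (d * e) *\<^sub>R (Q * P)"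
    using commute[OF P Q] by simp
  then have PQ: "P * (Q * R) = (-1) powi (d * e) *\<^sub>R (Q * (P * R))" for R
    by (simp add: mult.assoc[symmetric])
  have BPQ: "B P Q = - ((-1) powi ((d + 1) * (e + 1)) *\<^sub>R B Q P)"
    using B_skew[OF P Q] by (simp add: algebra_simps)
  have 1: "B P (Q * ?Z) = B P Q * ?Z + (-1) powi ((d + 1) * e) *\<^sub>R (Q * B P ?Z)"
    using B_mult[OF P Q prod_closed[OF zs]] by (simp add: algebra_simps)
  have 2: "B Q (P * ?Z) = B Q P * ?Z + (-1) powi ((e + 1) * d) *\<^sub>R (P * B Q ?Z)"
    using B_mult[OF Q P prod_closed[OF zs]] by (simp add: algebra_simps)
  show ?thesis
    by (cases "even d"; cases "even e")
      (simp_all add: 1 2 BPQ PQ algebra_simps)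
qed

text \<open>
  The identity \<open>[D, W\<^sub>B] = W\<^bsub>\<delta>\<^sub>D B\<^esub>\<close>.  In the recursive step, the sum over the entries to which \<open>D\<close>
  is applied splits into the first entry and the rest; the rest passes through the recursion for
  \<open>W\<^sub>B\<close>, where it produces \<open>D\<close> of the product and, by induction, the same sum for the shorter list.
\<close>

lemma unshuffle_sum_bracket:
  assumes D: "derivation D" and "homogeneous xs"
  shows "unshuffle_sum 1 (\<lambda>u v. bracket_sum B ((total_degree u, D (snd (u ! 0))) # v)) xs =
    D (bracket_sum B xs) + bracket_sum (bracket_deriv D B) xs"
  using assms(2)
proof (induction xs)
  case Nil
  then show ?case by (simp add: D_zero[OF D])
next
  case (Cons x xs)
  obtain d P where [simp]: "x = (d, P)" by (metis surj_pair)
  have P: "P \<in> \<Gamma> (- d)" and xs: "homogeneous xs"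
    using Cons.prems by auto
  let ?G = "\<lambda>u v. D (snd (u ! 0)) * prod_list (map snd v)"
  let ?L = "\<lambda>u v. bracket_sum B ((total_degree u, D (snd (u ! 0))) # v)"
  let ?Z = "prod_list (map snd xs)"
  have Z: "?Z \<in> \<Gamma> (- total_degree xs)"
    by (rule prod_closed[OF xs])
  have "unshuffle_sum 1 (\<lambda>u v. (-1) powi (d * total_degree u) *\<^sub>R
      bracket_sum B ((total_degree u, D (snd (u ! 0))) # x # v)) xs =
    unshuffle_sum 1 (\<lambda>u v. (-1) powi d *\<^sub>R (B P (?G u v) + P * ?L u v)) xs"
  proof (rule unshuffle_sum_cong)
    fix u v :: "(int \<times> 'x) list"
    assume uv: "mset u + mset v = mset xs" "length u = 1"
    then obtain y where [simp]: "u = [y]" by (cases u) auto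
    have "homogeneous u" "homogeneous v" using homogeneous_mset[OF uv(1) xs] by auto
    then have "homogeneous ((total_degree u, D (snd (u ! 0))) # x # v)"
      using P by (simp add: D_closed[OF D] total_degree_def)
    from bracket_sum_swap[OF this]
    have swap: "bracket_sum B ((total_degree u, D (snd (u ! 0))) # x # v) =
        (-1) powi (total_degree u * d) *\<^sub>R
        bracket_sum B (x # (total_degree u, D (snd (u ! 0))) # v)"
      by (simp only: fst_conv \<open>x = (d, P)\<close>)
    have "(-1::real) powi (d * total_degree u) * (-1) powi (total_degree u * d) = 1"
      by (simp add: mult.commute[of d])
    then show "(-1) powi (d * total_degree u) *\<^sub>R
      bracket_sum B ((total_degree u, D (snd (u ! 0))) # x # v) =
      (-1) powi d *\<^sub>R (B P (?G u v) + P * ?L u v)"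
      unfolding swap scaleR_scaleR
      by (simp only: scaleR_one bracket_sum.simps(2)[of B "(d, P)"] \<open>x = (d, P)\<close> fst_conv snd_conv
          list.map prod_list.Cons)
  qed
  also have "\<dots> = (-1) powi d *\<^sub>R (B P (unshuffle_sum 1 ?G xs) + P * unshuffle_sum 1 ?L xs)"
  proof -
    have "?G u v \<in> \<Gamma> (- total_degree xs)" if uv: "mset u + mset v = mset xs" "length u = 1" for u v
    proof -
      obtain y where [simp]: "u = [y]" using uv by (cases u) auto
      show ?thesis
        using homogeneous_mset[OF uv(1) xs]
        by (intro mult_closed[of _ "- fst y" _ "- total_degree v"] D_closed[OF D] prod_closed)
          (auto simp: total_degree_def)
    qed
    then have 1: "unshuffle_sum 1 (\<lambda>u v. B P (?G u v)) xs = B P (unshuffle_sum 1 ?G xs)"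
      using unshuffle_sum_linear[of "\<Gamma> (- total_degree xs)" "B P" xs 1 ?G,
          OF subspace B_add[OF P] B_scale[OF P]] by simp
    have 2: "unshuffle_sum 1 (\<lambda>u v. P * ?L u v) xs = P * unshuffle_sum 1 ?L xs"
      using unshuffle_sum_linear[of UNIV "(*) P" xs 1 ?L] by (simp add: distrib_left)
    have 3: "unshuffle_sum k (\<lambda>u v. F u v + G u v) xs = unshuffle_sum k F xs + unshuffle_sum k G xs"
      for k and F G :: "_ \<Rightarrow> _ \<Rightarrow> 'x" and xs
      by (rule unshuffle_sum_add)
    have 4: "unshuffle_sum 1 (\<lambda>u v. (-1) powi d *\<^sub>R F u v) xs =
        (-1) powi d *\<^sub>R unshuffle_sum 1 F xs" for F :: "_ \<Rightarrow> _ \<Rightarrow> 'x"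
      using unshuffle_sum_linear[of UNIV "\<lambda>y. (-1) powi d *\<^sub>R y" xs 1 F]
      by (simp add: scaleR_add_right)
    show ?thesis unfolding 4 3 1 2 ..
  qed
  also have "unshuffle_sum 1 ?G xs = D ?Z"
    by (rule unshuffle_sum_prod[OF D xs])
  also have "unshuffle_sum 1 ?L xs = D (bracket_sum B xs) + bracket_sum (bracket_deriv D B) xs"
    using Cons.IH xs by blast
  finally have *: "unshuffle_sum 1 ?L (x # xs) = bracket_sum B ((d, D P) # xs) +
      (-1) powi d *\<^sub>R (B P (D ?Z) + P * (D (bracket_sum B xs) + bracket_sum (bracket_deriv D B) xs))"
    by (simp add: total_degree_def)
  have W: "bracket_sum B xs \<in> \<Gamma> (- total_degree xs - 1)"
    by (rule bracket_sum_closed[OF xs])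
  have DW: "D (bracket_sum B (x # xs)) =
      (-1) powi d *\<^sub>R (D (B P ?Z) + D P * bracket_sum B xs + P * D (bracket_sum B xs))"
  proof -
    have 1: "B P ?Z \<in> \<Gamma> (- d - total_degree xs - 1)"
      using B_closed[OF P Z] by simp
    moreover have 2: "P * bracket_sum B xs \<in> \<Gamma> (- d - total_degree xs - 1)"
      by (rule mult_closed[OF P W]) simp
    ultimately show ?thesis
      by (simp add: D_scale[OF D add_closed[OF 1 2]] D_add[OF D 1 2] D_mult[OF D P W] add.assoc)
  qed
  have "bracket_sum (bracket_deriv D B) (x # xs) = (-1) powi d *\<^sub>R
      (B (D P) ?Z + B P (D ?Z) - D (B P ?Z) + P * bracket_sum (bracket_deriv D B) xs)"
    by (simp only: bracket_sum.simps bracket_deriv_def[of D B P] \<open>x = (d, P)\<close> fst_conv snd_conv)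
  then show ?case
    unfolding * DW by (simp add: scaleR_add_right scaleR_diff_right distrib_left)
qed

text \<open>
  A derivation of degree 0 respects each of the defining identities of a biderivation, hence so does
  the derivative along it.
\<close>

lemma biderivation_bracket_deriv:
  assumes D: "derivation D"
  shows "biderivation (bracket_deriv D B)"
proof -
  note closed = D_closed[OF D]
  have 1: "bracket_deriv D B P Q \<in> \<Gamma> (p + q - 1)" if P: "P \<in> \<Gamma> p" and Q: "Q \<in> \<Gamma> q" for p q P Q
    unfolding bracket_deriv_def
    using B_closed[OF closed[OF P] Q] B_closed[OF P closed[OF Q]] closed[OF B_closed[OF P Q]]
    by (intro diff_closed add_closed)
  have 2: "bracket_deriv D B P (Q + R) = bracket_deriv D B P Q + bracket_deriv D B P R"
    if P: "P \<in> \<Gamma> p" and Q: "Q \<in> \<Gamma> q" and R: "R \<in> \<Gamma> q" for p q P Q R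
    unfolding bracket_deriv_def D_add[OF D Q R] B_add[OF P Q R] B_add[OF closed[OF P] Q R]
      B_add[OF P closed[OF Q] closed[OF R]] D_add[OF D B_closed[OF P Q] B_closed[OF P R]]
    by simp
  have 3: "bracket_deriv D B P (c *\<^sub>R Q) = c *\<^sub>R bracket_deriv D B P Q"
    if P: "P \<in> \<Gamma> p" and Q: "Q \<in> \<Gamma> q" for p q P Q c
    unfolding bracket_deriv_def D_scale[OF D Q] B_scale[OF P Q] B_scale[OF closed[OF P] Q]
      B_scale[OF P closed[OF Q]] D_scale[OF D B_closed[OF P Q]]
    by (simp add: scaleR_add_right scaleR_diff_right)
  have 4: "bracket_deriv D B P Q = - ((-1) powi ((p - 1) * (q - 1)) *\<^sub>R bracket_deriv D B Q P)"
    if P: "P \<in> \<Gamma> p" and Q: "Q \<in> \<Gamma> q" for p q P Q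
  proof -
    define s :: real where "s = (-1) powi ((p - 1) * (q - 1))"
    have skew: "B P Q = - (s *\<^sub>R B Q P)" if "P \<in> \<Gamma> p" "Q \<in> \<Gamma> q" for P Q
      using B_skew[OF that] by (simp only: s_def)
    have "D (B P Q) = D ((- s) *\<^sub>R B Q P)"
      using skew[OF P Q] by simp
    also have "\<dots> = (- s) *\<^sub>R D (B Q P)"
      by (rule D_scale[OF D B_closed[OF Q P]])
    finally have "D (B P Q) = - (s *\<^sub>R D (B Q P))"
      by simp
    then show ?thesis
      unfolding bracket_deriv_def s_def[symmetric] skew[OF closed[OF P] Q] skew[OF P closed[OF Q]]
      by (simp add: scaleR_add_right scaleR_diff_right)
  qed
  have 5: "bracket_deriv D B P (Q * R) =
      bracket_deriv D B P Q * R + (-1) powi ((p - 1) * q) *\<^sub>R (Q * bracket_deriv D B P R)"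
    if P: "P \<in> \<Gamma> p" and Q: "Q \<in> \<Gamma> q" and R: "R \<in> \<Gamma> s" for p q s P Q R
  proof -
    define e :: real where "e = (-1) powi ((p - 1) * q)"
    have leibniz: "B P (Q * R) = B P Q * R + e *\<^sub>R (Q * B P R)"
      if "P \<in> \<Gamma> p" "Q \<in> \<Gamma> q" "R \<in> \<Gamma> s" for P Q R
      using B_mult[OF that] by (simp only: e_def)
    have 1: "B P (D Q * R + Q * D R) = B P (D Q * R) + B P (Q * D R)"
      by (rule B_add[OF P mult[OF closed[OF Q] R] mult[OF Q closed[OF R]]])
    have 2: "D (B P Q * R + e *\<^sub>R (Q * B P R)) = D (B P Q * R) + D (e *\<^sub>R (Q * B P R))"
    proof (rule D_add[OF D])
      show "B P Q * R \<in> \<Gamma> (p + q + s - 1)"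
        by (rule mult_closed[OF B_closed[OF P Q] R]) simp
      have "Q * B P R \<in> \<Gamma> (p + q + s - 1)"
        by (rule mult_closed[OF Q B_closed[OF P R]]) simp
      then show "e *\<^sub>R (Q * B P R) \<in> \<Gamma> (p + q + s - 1)"
        by (rule scale_closed)
    qed
    have 3: "D (e *\<^sub>R (Q * B P R)) = e *\<^sub>R D (Q * B P R)"
      by (rule D_scale[OF D mult[OF Q B_closed[OF P R]]])
    show ?thesis
      unfolding bracket_deriv_def D_mult[OF D Q R] 1 leibniz[OF P Q R] 2 3
        D_mult[OF D Q B_closed[OF P R]] D_mult[OF D B_closed[OF P Q] R]
        leibniz[OF P closed[OF Q] R] leibniz[OF P Q closed[OF R]] leibniz[OF closed[OF P] Q R]
        e_def[symmetric]
      by (simp add: algebra_simps)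
  qed
  show ?thesis
    unfolding biderivation_def
    by (intro conjI allI ballI) (rule 1 2 3 4 5; assumption)+
qed

end

lemma bracket_sum_cong:
  assumes "\<And>p q P Q. P \<in> \<Gamma> p \<Longrightarrow> Q \<in> \<Gamma> q \<Longrightarrow> B P Q = B' P Q" and "homogeneous xs"
  shows "bracket_sum B xs = bracket_sum B' xs"
  using assms(2)
proof (induction xs)
  case (Cons x xs)
  then have "B (snd x) (prod_list (map snd xs)) = B' (snd x) (prod_list (map snd xs))"
    by (intro assms(1)[of _ "- fst x" _ "- total_degree xs"] prod_closed) simp_all
  then show ?case using Cons by simp
qed simp

end

context graded_commutative_algebra
begin

context
  fixes B
  assumes B: "biderivation B"
begin

text \<open>
  The Leibniz rule for a product of many factors, with each bracket moved to the front.
\<close>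

lemma unshuffle_sum_leibniz:
  assumes P: "P \<in> \<Gamma> p" and "homogeneous xs"
  shows "unshuffle_sum 1 (\<lambda>u v. B P (snd (u ! 0)) * prod_list (map snd v)) xs =
    B P (prod_list (map snd xs))"
  using assms(2)
proof (induction xs)
  case Nil
  then show ?case by (simp add: B_one[OF B P])
next
  case (Cons x xs)
  let ?G = "\<lambda>u v. B P (snd (u ! 0)) * prod_list (map snd v)"
  have x: "snd x \<in> \<Gamma> (- fst x)" and xs: "homogeneous xs"
    using Cons.prems by auto
  have "unshuffle_sum 1 (\<lambda>u v. (-1) powi (fst x * total_degree u) *\<^sub>R
      (B P (snd (u ! 0)) * (snd x * prod_list (map snd v)))) xs =
    unshuffle_sum 1 (\<lambda>u v. (-1) powi ((p - 1) * (- fst x)) *\<^sub>R (snd x * ?G u v)) xs"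
  proof (rule unshuffle_sum_cong)
    fix u v :: "(int \<times> 'x) list"
    assume uv: "mset u + mset v = mset xs" "length u = 1"
    then obtain y where [simp]: "u = [y]" by (cases u) auto
    have "snd y \<in> \<Gamma> (- fst y)" using homogeneous_mset[OF uv(1) xs] by simp
    note BP = B_closed[OF B P this]
    define s t :: real where "s = (-1) powi ((p + - fst y - 1) * - fst x)"
      and "t = (-1) powi ((p - 1) * (- fst x))"
    have "B P (snd y) * snd x = s *\<^sub>R (snd x * B P (snd y))"
      using commute[OF BP x] by (simp only: s_def)
    then have "B P (snd y) * (snd x * R) = s *\<^sub>R (snd x * (B P (snd y) * R))" for R
      by (simp add: mult.assoc[symmetric])
    moreover have "(-1) powi (fst x * fst y) * s = t"
      unfolding s_def t_def
      by (cases "even (fst x)"; cases "even (fst y)"; cases "even p") simp_all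
    ultimately show "(-1) powi (fst x * total_degree u) *\<^sub>R
        (B P (snd (u ! 0)) * (snd x * prod_list (map snd v))) =
        (-1) powi ((p - 1) * (- fst x)) *\<^sub>R (snd x * ?G u v)"
      unfolding t_def[symmetric] by (simp add: total_degree_def)
  qed
  also have "\<dots> = (-1) powi ((p - 1) * (- fst x)) *\<^sub>R (snd x * unshuffle_sum 1 ?G xs)"
    using unshuffle_sum_linear[of UNIV
        "\<lambda>y. (-1) powi ((p - 1) * (- fst x)) *\<^sub>R (snd x * y)" xs 1 ?G]
    by (simp add: distrib_left scaleR_add_right)
  also have "\<dots> = (-1) powi ((p - 1) * (- fst x)) *\<^sub>R (snd x * B P (prod_list (map snd xs)))"
    using Cons by simp
  finally show ?case
    using B_mult[OF B P x prod_closed[OF xs]] by simp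
qed

lemma unshuffle_sum_bracket_sum:
  assumes "homogeneous xs"
  shows "unshuffle_sum 2 (\<lambda>u v. (-1) powi fst (u ! 0) *\<^sub>R
      (B (snd (u ! 0)) (snd (u ! 1)) * prod_list (map snd v))) xs = bracket_sum B xs"
  using assms unfolding numeral_2_eq_2
proof (induction xs)
  case Nil
  then show ?case by simp
next
  case (Cons x xs)
  let ?F = "\<lambda>u v. (-1) powi fst (u ! 0) *\<^sub>R
      (B (snd (u ! 0)) (snd (u ! 1)) * prod_list (map snd v))"
  have x: "snd x \<in> \<Gamma> (- fst x)" and xs: "homogeneous xs"
    using Cons.prems by auto
  have "unshuffle_sum (Suc 0) (\<lambda>u v. ?F (x # u) v) xs =
      unshuffle_sum 1 (\<lambda>u v. (-1) powi fst x *\<^sub>R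
        (B (snd x) (snd (u ! 0)) * prod_list (map snd v))) xs"
    by simp
  also have "\<dots> = (-1) powi fst x *\<^sub>R
      unshuffle_sum 1 (\<lambda>u v. B (snd x) (snd (u ! 0)) * prod_list (map snd v)) xs"
    using unshuffle_sum_linear[of UNIV "\<lambda>y. (-1) powi fst x *\<^sub>R y" xs 1
        "\<lambda>u v. B (snd x) (snd (u ! 0)) * prod_list (map snd v)"]
    by (simp add: scaleR_add_right)
  also have "\<dots> = (-1) powi fst x *\<^sub>R B (snd x) (prod_list (map snd xs))"
    by (simp only: unshuffle_sum_leibniz[OF x xs])
  finally have 1: "unshuffle_sum (Suc 0) (\<lambda>u v. ?F (x # u) v) xs =
      (-1) powi fst x *\<^sub>R B (snd x) (prod_list (map snd xs))" .
  have "unshuffle_sum (Suc (Suc 0))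
      (\<lambda>u v. (-1) powi (fst x * total_degree u) *\<^sub>R ?F u (x # v)) xs =
    unshuffle_sum (Suc (Suc 0)) (\<lambda>u v. (-1) powi fst x *\<^sub>R (snd x * ?F u v)) xs"
  proof (rule unshuffle_sum_cong)
    fix u v :: "(int \<times> 'x) list"
    assume uv: "mset u + mset v = mset xs" "length u = Suc (Suc 0)"
    then obtain y z where [simp]: "u = [y, z]" by (auto simp: length_Suc_conv)
    have "snd y \<in> \<Gamma> (- fst y)" "snd z \<in> \<Gamma> (- fst z)" 
      using homogeneous_mset[OF uv(1) xs] by simp_all
    note Byz = B_closed[OF B this]
    define s :: real where "s = (-1) powi ((- fst y + - fst z - 1) * - fst x)"
    have "B (snd y) (snd z) * snd x = s *\<^sub>R (snd x * B (snd y) (snd z))"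
      using commute[OF Byz x] by (simp only: s_def)
    then have "B (snd y) (snd z) * (snd x * R) = s *\<^sub>R (snd x * (B (snd y) (snd z) * R))" for R
      by (simp add: mult.assoc[symmetric])
    moreover have "(-1) powi (fst x * (fst y + fst z)) * ((-1) powi fst y * s) =
        (-1) powi fst x * (-1) powi fst y"
      unfolding s_def
      by (cases "even (fst x)"; cases "even (fst y)"; cases "even (fst z)") simp_all
    ultimately show "(-1) powi (fst x * total_degree u) *\<^sub>R ?F u (x # v) =
        (-1) powi fst x *\<^sub>R (snd x * ?F u v)"
      by (simp only: \<open>u = [y, z]\<close> total_degree_def list.map sum_list.Cons sum_list.Nil add_0_right
          nth_Cons_0 One_nat_def nth_Cons_Suc prod_list.Cons scaleR_scaleR mult_scaleR_right)
  qed
  also have "\<dots> = (-1) powi fst x *\<^sub>R (snd x * unshuffle_sum (Suc (Suc 0)) ?F xs)"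
    using unshuffle_sum_linear[of UNIV
        "\<lambda>y. (-1) powi fst x *\<^sub>R (snd x * y)" xs "Suc (Suc 0)" ?F]
    by (simp add: distrib_left scaleR_add_right)
  finally show ?case
    using 1 Cons.IH[OF xs] by (simp add: scaleR_add_right)
qed

text \<open>
  Only the component of arity 1 of the map contributes to the Richardson-Nijenhuis bracket; the
  summands that insert another component insert a zero entry, which \<open>W\<^sub>B\<close> kills.
\<close>

lemma rn_bracket_vform_of_map:
  assumes D: "derivation D"
    and L: "\<And>n xs. n \<ge> 1 \<Longrightarrow> length xs = n \<Longrightarrow> homogeneous xs \<Longrightarrow>
      comp L n xs = a n *\<^sub>R bracket_sum B xs"
    and n: "n \<ge> 1" "length xs = n" and xs: "homogeneous xs"
  shows "comp (rn_bracket (vform_of_map D) L) n xs = a n *\<^sub>R bracket_sum (bracket_deriv D B) xs"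
proof -
  let ?N = "vform_of_map D"
  let ?S = "{(k, l). 1 \<le> k \<and> 1 \<le> l \<and> k + l = n + 1}"
  define t where "t = (\<lambda>(k, l). iota 0 k (comp ?N k) l (comp L l) xs
      - iota (deg L) l (comp L l) k (comp ?N k) xs)"
  have "comp (rn_bracket ?N L) n xs = sum t ?S"
    by (simp add: rn_bracket_def t_def vform_of_map_def case_prod_beta)
  also have "\<dots> = sum t {(1, n)}"
  proof (rule sum.mono_neutral_right)
    show "finite ?S"
      by (rule finite_subset[of _ "{..n + 1} \<times> {..n + 1}"]) auto
    show "{(1, n)} \<subseteq> ?S" using n by auto
    show "\<forall>i\<in>?S - {(1, n)}. t i = 0"
    proof
      fix i assume "i \<in> ?S - {(1, n)}"
      then obtain k l where i: "i = (k, l)" and kl: "1 \<le> k" "1 \<le> l" "k + l = n + 1" and "(k, l) \<noteq> (1, n)"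
        by (cases i) auto
      then have "k \<noteq> 1" by auto
      then have N0: "comp ?N k = (\<lambda>xs. 0)" by (simp add: vform_of_map_def)
      have "iota 0 k (comp ?N k) l (comp L l) xs = 0"
        unfolding iota_def Let_def
      proof (rule sum.neutral, intro ballI)
        fix \<sigma> assume "\<sigma> \<in> unshuffles k (l - 1)"
        then have \<sigma>: "\<sigma> permutes {..<length xs}"
          using kl n by (simp add: unshuffles_def)
        let ?v = "drop k (permute_list \<sigma> xs)"
        have "set ?v \<subseteq> set xs"
          using set_drop_subset set_permute_list[OF \<sigma>] by metis
        then have v: "homogeneous ?v"
          using xs by (auto simp: homogeneous_def)
        have "comp L l ((d, 0) # ?v) = a l *\<^sub>R bracket_sum B ((d, 0) # ?v)" for d
          by (rule L) (use kl n v zero_closed in auto)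
        then have "comp L l ((d, 0) # ?v) = 0" for d
          using B_zero_left[OF B prod_closed[OF v]] by simp
        then show "koszul_sign \<sigma> xs *\<^sub>R comp L l
          ((total_degree (take k (permute_list \<sigma> xs)) + 0, comp ?N k (take k (permute_list \<sigma> xs))) # ?v) = 0"
          by (simp add: N0)
      qed
      moreover have "iota (deg L) l (comp L l) k (comp ?N k) xs = 0"
        by (simp add: iota_def N0 Let_def)
      ultimately show "t i = 0" by (simp add: t_def i)
    qed
  qed
  also have "\<dots> = iota 0 1 (comp ?N 1) n (comp L n) xs - iota (deg L) n (comp L n) 1 (comp ?N 1) xs"
    by (simp add: t_def)
  also have "iota (deg L) n (comp L n) 1 (comp ?N 1) xs = D (comp L n xs)"
    by (simp add: iota_def unshuffles_zero_right vform_of_map_def n del: id_apply)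
  also have "\<dots> = a n *\<^sub>R D (bracket_sum B xs)"
    by (simp add: L[OF n xs] D_scale[OF D bracket_sum_closed[OF B xs]])
  also have "iota 0 1 (comp ?N 1) n (comp L n) xs =
      (\<Sum>\<sigma>\<in>unshuffles 1 (n - 1). koszul_sign \<sigma> xs *\<^sub>R
        (\<lambda>u v. comp L n ((total_degree u, D (snd (u ! 0))) # v))
          (take 1 (permute_list \<sigma> xs)) (drop 1 (permute_list \<sigma> xs)))"
    by (simp add: iota_def vform_of_map_def Let_def)
  also have "\<dots> = unshuffle_sum 1 (\<lambda>u v. comp L n ((total_degree u, D (snd (u ! 0))) # v)) xs"
    by (rule sum_unshuffles) (use n in simp)
  also have "\<dots> = unshuffle_sum 1
      (\<lambda>u v. a n *\<^sub>R bracket_sum B ((total_degree u, D (snd (u ! 0))) # v)) xs"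
  proof (rule unshuffle_sum_cong)
    fix u v :: "(int \<times> 'x) list"
    assume uv: "mset u + mset v = mset xs" "length u = 1"
    then obtain y where [simp]: "u = [y]" by (cases u) auto
    have "length (u @ v) = length xs" using uv(1) by (metis mset_append mset_eq_length)
    then have "length v + 1 = n" using uv(2) n by simp
    then show "comp L n ((total_degree u, D (snd (u ! 0))) # v) =
        a n *\<^sub>R bracket_sum B ((total_degree u, D (snd (u ! 0))) # v)"
      using homogeneous_mset[OF uv(1) xs]
      by (intro L[OF n(1)]) (auto simp: total_degree_def D_closed[OF D])
  qed
  also have "\<dots> = a n *\<^sub>R
      unshuffle_sum 1 (\<lambda>u v. bracket_sum B ((total_degree u, D (snd (u ! 0))) # v)) xs"
    using unshuffle_sum_linear[of UNIV "\<lambda>y. a n *\<^sub>R y" xs 1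
        "\<lambda>u v. bracket_sum B ((total_degree u, D (snd (u ! 0))) # v)"]
    by (simp add: scaleR_add_right)
  also have "\<dots> = a n *\<^sub>R (D (bracket_sum B xs) + bracket_sum (bracket_deriv D B) xs)"
    by (simp only: unshuffle_sum_bracket[OF B D xs])
  finally show ?thesis
    by (simp add: scaleR_add_right)
qed

end

lemma hom_lists_iff: "xs \<in> hom_lists (\<lambda>d. \<Gamma> (- d)) n \<longleftrightarrow> length xs = n \<and> homogeneous xs"
  by (auto simp: hom_lists_def homogeneous_def)

lemma vector_valued_form_vform_of_map:
  assumes D: "derivation D"
  shows "vector_valued_form (\<lambda>d. \<Gamma> (- d)) (vform_of_map D)"
  unfolding vector_valued_form_def
proof (intro allI ballI impI conjI)
  fix n :: nat and xs assume n: "1 \<le> n" and "xs \<in> hom_lists (\<lambda>d. \<Gamma> (- d)) n"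
  then have len: "length xs = n" and xs: "homogeneous xs"
    by (auto simp: hom_lists_iff)
  have one: "\<exists>x. xs = [x]" if "n = 1"
    using len that by (auto simp: length_Suc_conv)
  show "comp (vform_of_map D) n xs \<in> \<Gamma> (- (total_degree xs + deg (vform_of_map D)))"
    using one xs zero_closed D_closed[OF D]
    by (cases "n = 1") (auto simp: vform_of_map_def total_degree_def)
  show "comp (vform_of_map D) n (permute_list \<sigma> xs) =
      koszul_sign \<sigma> xs *\<^sub>R comp (vform_of_map D) n xs" if "\<sigma> permutes {..<n}" for \<sigma>
  proof (cases "n = 1")
    case True
    have "{..<1::nat} = {0}" by auto
    then have "\<sigma> = id" using that True by simp
    then show ?thesis by (simp del: id_apply)
  next
    case False
    then show ?thesis by (simp add: vform_of_map_def)
  qed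
  fix j d x y c assume j: "j < n" and x: "x \<in> \<Gamma> (- d)" and y: "y \<in> \<Gamma> (- d)"
  show "comp (vform_of_map D) n (xs[j := (d, x + y)]) =
      comp (vform_of_map D) n (xs[j := (d, x)]) + comp (vform_of_map D) n (xs[j := (d, y)])"
    using one j D_add[OF D x y] by (cases "n = 1") (auto simp: vform_of_map_def)
  show "comp (vform_of_map D) n (xs[j := (d, c *\<^sub>R x)]) = c *\<^sub>R comp (vform_of_map D) n (xs[j := (d, x)])"
    using one j D_scale[OF D x] by (cases "n = 1") (auto simp: vform_of_map_def)
qed

lemma rn_bracket_commuting_maps:
  assumes D: "derivation D" and K: "derivation K"
    and comm: "\<And>k P. P \<in> \<Gamma> k \<Longrightarrow> D (K P) = K (D P)"
    and n: "length xs = n" and xs: "homogeneous xs"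
  shows "comp (rn_bracket (vform_of_map D) (vform_of_map K)) n xs = 0"
  unfolding rn_bracket_def
proof (simp only: vform.simps, rule sum.neutral, clarify)
  fix k l :: nat assume kl: "1 \<le> k" "1 \<le> l" "k + l = n + 1"
  show "iota (deg (vform_of_map D)) k (comp (vform_of_map D) k) l (comp (vform_of_map K) l) xs -
     (-1) powi (deg (vform_of_map D) * deg (vform_of_map K)) *\<^sub>R
       iota (deg (vform_of_map K)) l (comp (vform_of_map K) l) k (comp (vform_of_map D) k) xs = 0"
  proof (cases "k = 1 \<and> l = 1")
    case True
    then have "length xs = 1" using kl n by simp
    then obtain x where [simp]: "xs = [x]" by (auto simp: length_Suc_conv)
    have "snd x \<in> \<Gamma> (- fst x)" using xs by simp
    then show ?thesis
      using True comm by (simp add: iota_def vform_of_map_def unshuffles_zero_right del: id_apply)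
  next
    case False
    then show ?thesis
      by (auto simp: iota_def vform_of_map_def Let_def D_zero[OF D] D_zero[OF K] intro!: sum.neutral)
  qed
qed

text \<open>
  The theorem for an abstract graded commutative algebra: since the bracket with \<open>D\<close> acts on \<open>W\<^sub>B\<close>
  through \<open>B\<close> alone, the Nijenhuis identity for the whole formal sum is an identity between
  biderivations.
\<close>

lemma nijenhuis_vform_bracket_sum:
  assumes B: "biderivation B" and D: "derivation D" and K: "derivation K"
    and comm: "\<And>k P. P \<in> \<Gamma> k \<Longrightarrow> D (K P) = K (D P)"
    and square: "\<And>p q P Q. P \<in> \<Gamma> p \<Longrightarrow> Q \<in> \<Gamma> q \<Longrightarrow>
      bracket_deriv D (bracket_deriv D B) P Q = bracket_deriv K B P Q"
    and mu: "\<And>n xs. n \<ge> 1 \<Longrightarrow> length xs = n \<Longrightarrow> homogeneous xs \<Longrightarrow>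
      comp \<mu> n xs = a n *\<^sub>R bracket_sum B xs"
  shows "nijenhuis_vform (\<lambda>d. \<Gamma> (- d)) \<mu> (vform_of_map D) (vform_of_map K)"
proof -
  have deg: "deg (vform_of_map D) = 0" "deg (vform_of_map K) = 0"
    by (simp_all add: vform_of_map_def)
  have deg_rn: "deg (rn_bracket F G) = deg F + deg G" for F G :: "'x vform"
    by (simp add: rn_bracket_def)
  have "comp (rn_bracket (vform_of_map D) (rn_bracket (vform_of_map D) \<mu>)) n xs =
      comp (rn_bracket (vform_of_map K) \<mu>) n xs"
    if n: "n \<ge> 1" "length xs = n" and xs: "homogeneous xs" for n xs
  proof -
    have "comp (rn_bracket (vform_of_map D) (rn_bracket (vform_of_map D) \<mu>)) n xs =
        a n *\<^sub>R bracket_sum (bracket_deriv D (bracket_deriv D B)) xs"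
      by (rule rn_bracket_vform_of_map[OF biderivation_bracket_deriv[OF B D] D _ n xs])
        (rule rn_bracket_vform_of_map[OF B D mu])
    also have "\<dots> = a n *\<^sub>R bracket_sum (bracket_deriv K B) xs"
      by (simp only: bracket_sum_cong[OF square xs])
    also have "\<dots> = comp (rn_bracket (vform_of_map K) \<mu>) n xs"
      by (rule rn_bracket_vform_of_map[OF B K mu n xs, symmetric])
    finally show ?thesis .
  qed
  moreover have "comp (rn_bracket (vform_of_map D) (vform_of_map K)) n xs = 0"
    if "length xs = n" "homogeneous xs" for n xs
    using rn_bracket_commuting_maps[OF D K comm that] .
  ultimately show ?thesis
    using vector_valued_form_vform_of_map[OF D] vector_valued_form_vform_of_map[OF K]
    by (auto simp: nijenhuis_vform_def vform_eq_def hom_lists_iff deg deg_rn zero_vform_def)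
qed

end

instance "fun" :: (type, real_algebra_1) real_algebra_1
  by standard (simp_all add: fun_eq_iff)

text \<open>
  The cases of arity at most 2, where the forms are given by separate formulas, agree with the
  recursion because a biderivation vanishes when one argument is 1.
\<close>

lemma l_form_eq_bracket_sum:
  fixes \<Gamma> :: "int \<Rightarrow> ('m \<Rightarrow> 'v::real_vector ext) set"
  assumes "graded_commutative_algebra \<Gamma>"
    and B: "graded_commutative_algebra.biderivation \<Gamma> B"
    and xs: "graded_commutative_algebra.homogeneous \<Gamma> xs" and n: "length xs = n"
  shows "l_form B n xs = bracket_sum B xs"
proof -
  interpret graded_commutative_algebra \<Gamma> by fact
  have single: "bracket_sum B [y] = 0" if "snd y \<in> \<Gamma> (- fst y)" for y
    using B_one[OF B that] by simp
  consider "n = 0" | "n = 1" | "n = 2" | "n > 2" by linarith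
  then show ?thesis
  proof cases
    case 1
    then show ?thesis using n by (simp add: l_form_def)
  next
    case 2
    then obtain y where "xs = [y]" using n by (auto simp: length_Suc_conv)
    then show ?thesis using single xs 2 by (simp add: l_form_def)
  next
    case 3
    then obtain y z where "xs = [y, z]" using n by (auto simp: length_Suc_conv numeral_2_eq_2)
    then show ?thesis using single[of z] xs 3 by (simp add: l_form_def)
  next
    case 4
    let ?F = "\<lambda>u v. (-1) powi fst (u ! 0) *\<^sub>R
      (B (snd (u ! 0)) (snd (u ! 1)) * prod_list (map snd v))"
    have "l_form B n xs = (\<Sum>\<sigma>\<in>unshuffles 2 (n - 2). koszul_sign \<sigma> xs *\<^sub>R
        ?F (take 2 (permute_list \<sigma> xs)) (drop 2 (permute_list \<sigma> xs)))"
      using 4 by (simp add: l_form_def Let_def)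
    also have "\<dots> = unshuffle_sum 2 ?F xs"
      by (rule sum_unshuffles) (use 4 n in simp)
    finally show ?thesis
      using unshuffle_sum_bracket_sum[OF B xs] by simp
  qed
qed

section \<open>Coordinates on a finite-dimensional normed space\<close>

lemma continuous_map_linear_combination:
  fixes B :: "'b::real_normed_vector set"
  assumes "finite B"
  shows "continuous_map (product_topology (\<lambda>_. euclideanreal) B) euclidean (\<lambda>f. \<Sum>b\<in>B. f b *\<^sub>R b)"
proof (rule continuous_map_sum[OF assms])
  fix b assume "b \<in> B"
  then have 1: "continuous_map (product_topology (\<lambda>_. euclideanreal) B) euclideanreal (\<lambda>f. f b)"
    by (rule continuous_map_product_projection)
  have 2: "continuous_map euclideanreal euclidean (\<lambda>t. t *\<^sub>R b)"
    by (simp add: continuous_intros)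
  show "continuous_map (product_topology (\<lambda>_. euclideanreal) B) euclidean (\<lambda>f. f b *\<^sub>R b)"
    using continuous_map_compose[OF 1 2] by (simp add: o_def)
qed

lemma compact_coefficient_box:
  "compactin (product_topology (\<lambda>_. euclideanreal) B) (PiE B (\<lambda>_. {- M..M}))"
  by (simp add: compactin_PiE)

text \<open>
  The norm of a linear combination is a continuous positive function of its coefficients on the
  compact set of coefficient vectors whose absolute values sum to 1; it is bounded below there by
  a positive constant, and the general case follows by scaling.
\<close>

lemma finite_independent_coefficients_bounded:
  fixes B :: "'b::real_normed_vector set"
  assumes fin: "finite B" and ind: "independent B"
  shows "\<exists>c>0. \<forall>f. c * (\<Sum>b\<in>B. \<bar>f b\<bar>) \<le> norm (\<Sum>b\<in>B. f b *\<^sub>R b)"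
proof -
  let ?T = "product_topology (\<lambda>_. euclideanreal) B"
  let ?g = "\<lambda>f. norm (\<Sum>b\<in>B. f b *\<^sub>R b)" and ?s = "\<lambda>f. \<Sum>b\<in>B. \<bar>f b\<bar>"
  define K where "K = PiE B (\<lambda>_. {-1..1::real}) \<inter> {f \<in> topspace ?T. ?s f \<in> {1}}"
  have "continuous_map ?T euclideanreal (\<lambda>f. f b)" if "b \<in> B" for b
    using that by (rule continuous_map_product_projection)
  then have "continuous_map ?T euclideanreal ?s"
    using fin by (intro continuous_map_sum) (auto intro: continuous_map_real_abs)
  then have "closedin ?T {f \<in> topspace ?T. ?s f \<in> {1}}"
    by (rule closedin_continuous_map_preimage) simp
  then have K: "compactin ?T K"
    unfolding K_def by (intro compact_Int_closedin compact_coefficient_box)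
  have "continuous_map ?T euclideanreal ?g"
    by (intro continuous_map_norm continuous_map_linear_combination fin)
  then have cg: "compact (?g ` K)"
    using image_compactin[OF K] by fastforce
  have pos: "?g f > 0" if "f \<in> K" for f
  proof (rule ccontr)
    assume "\<not> ?g f > 0"
    then have "(\<Sum>b\<in>B. f b *\<^sub>R b) = 0" by simp
    then have "\<forall>b\<in>B. f b = 0"
      using ind fin by (auto simp: independent_explicit_finite_subsets)
    then show False using that by (simp add: K_def)
  qed
  have unit: "\<exists>h\<in>K. ?g f = ?s f * ?g h" if "?s f \<noteq> 0" for f :: "'b \<Rightarrow> real"
  proof
    \<comment> \<open>The restriction makes the coefficient vector a point of the product topology over \<open>B\<close>.\<close>
    let ?h = "restrict (\<lambda>b. f b / ?s f) B"
    have spos: "?s f > 0" using that by (simp add: sum_nonneg less_le)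
    have "\<bar>f b\<bar> \<le> ?s f" if "b \<in> B" for b
      using fin that by (intro member_le_sum) auto
    then have "\<bar>f b / ?s f\<bar> \<le> 1" if "b \<in> B" for b
      using spos that by (simp add: abs_divide)
    then have "f b / ?s f \<in> {-1..1}" if "b \<in> B" for b
      using that unfolding atLeastAtMost_iff by (metis abs_le_iff minus_le_iff)
    then have "?h \<in> PiE B (\<lambda>_. {-1..1})"
      by (auto simp del: atLeastAtMost_iff)
    moreover have "?s ?h = 1"
      using spos by (simp add: abs_divide sum_divide_distrib[symmetric])
    ultimately show "?h \<in> K"
      by (simp add: K_def del: restrict_PiE_iff)
    have "(\<Sum>b\<in>B. f b *\<^sub>R b) = ?s f *\<^sub>R (\<Sum>b\<in>B. ?h b *\<^sub>R b)"
      using spos by (simp add: scaleR_sum_right)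
    then show "?g f = ?s f * ?g ?h"
      using spos by simp
  qed
  show ?thesis
  proof (cases "K = {}")
    case True
    then have "?s f = 0" for f :: "'b \<Rightarrow> real" using unit[of f] by auto
    then show ?thesis by (intro exI[of _ 1]) simp
  next
    case False
    then obtain h where h: "h \<in> K" "\<And>f. f \<in> K \<Longrightarrow> ?g h \<le> ?g f"
      using compact_attains_inf[OF cg] by auto
    have "?g h * ?s f \<le> ?g f" for f
    proof (cases "?s f = 0")
      case False
      then obtain h' where "h' \<in> K" "?g f = ?s f * ?g h'" using unit by blast
      then show ?thesis
        using h(2)[of h'] by (simp add: mult.commute mult_left_mono sum_nonneg)
    qed simp
    then show ?thesis using pos[OF h(1)] by blast
  qed
qed

definition is_finite_basis :: "'b::real_vector set \<Rightarrow> bool" where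
  "is_finite_basis B \<longleftrightarrow> finite B \<and> independent B \<and> span B = UNIV"

lemma is_finite_basis_exists:
  assumes "finite B" "span B = (UNIV :: 'b::real_vector set)"
  shows "\<exists>C :: 'b set. is_finite_basis C"
proof -
  obtain C where "C \<subseteq> B" "independent C" "B \<subseteq> span C"
    using maximal_independent_subset[of B] by auto
  moreover have "span C = UNIV"
    using span_mono[OF \<open>B \<subseteq> span C\<close>] assms(2) by (simp add: span_span top_unique)
  ultimately show ?thesis
    using finite_subset[OF \<open>C \<subseteq> B\<close> assms(1)] by (intro exI[of _ C]) (simp add: is_finite_basis_def)
qed

lemma is_finite_basis_real: "is_finite_basis {1::real}"
proof -
  have "x \<in> span {1}" for x :: real
    using span_scale[OF span_base[of 1 "{1::real}"], of x] by simp
  then have "span {1::real} = UNIV" by auto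
  then show ?thesis by (simp add: is_finite_basis_def)
qed

context
  fixes B :: "'b::real_normed_vector set"
  assumes B: "is_finite_basis B"
begin

lemma basis_expansion: "v = (\<Sum>b\<in>B. representation B v b *\<^sub>R b)"
  using B sum_representation_eq[of B v B] by (simp add: is_finite_basis_def)

lemma bounded_linear_representation: "bounded_linear (\<lambda>v. representation B v b)"
proof -
  have fin: "finite B" and ind: "independent B" and sp: "v \<in> span B" for v
    using B by (auto simp: is_finite_basis_def)
  obtain c where c: "c > 0" "\<And>f. c * (\<Sum>b\<in>B. \<bar>f b\<bar>) \<le> norm (\<Sum>b\<in>B. f b *\<^sub>R b)"
    using finite_independent_coefficients_bounded[OF fin ind] by blast
  show ?thesis
  proof (rule bounded_linear_intro[where K = "1 / c"])
    show "representation B (x + y) b = representation B x b + representation B y b" for x y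
      by (simp add: representation_add[OF ind sp sp])
    show "representation B (r *\<^sub>R x) b = r *\<^sub>R representation B x b" for r x
      by (simp add: representation_scale[OF ind sp])
    show "norm (representation B x b) \<le> norm x * (1 / c)" for x
    proof (cases "b \<in> B")
      case True
      have "\<bar>representation B x b\<bar> \<le> (\<Sum>b\<in>B. \<bar>representation B x b\<bar>)"
        by (rule member_le_sum[OF True]) (auto simp: fin)
      also have "c * \<dots> \<le> norm x"
        using c(2)[of "representation B x"] basis_expansion[of x] by simp
      finally show ?thesis
        using c(1) by (simp add: field_simps)
    next
      case False
      then have "representation B x b = 0"
        by (metis representation_ne_zero)
      then show ?thesis using c(1) by simp
    qed
  qed
qed

lemma compact_coordinate_cube:
  "compact {v. \<forall>b\<in>B. \<bar>representation B v b - representation B p b\<bar> \<le> M}"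
proof -
  have fin: "finite B" and ind: "independent B" and sp: "v \<in> span B" for v
    using B by (auto simp: is_finite_basis_def)
  let ?F = "\<lambda>f. \<Sum>b\<in>B. f b *\<^sub>R b"
  let ?C = "{v. \<forall>b\<in>B. \<bar>representation B v b - representation B p b\<bar> \<le> M}"
  have "compact (?F ` PiE B (\<lambda>_. {- M..M}))"
    using image_compactin[OF compact_coefficient_box[of B M]
      continuous_map_linear_combination[OF fin]] by simp
  then have "compact ((+) p ` ?F ` PiE B (\<lambda>_. {- M..M}))"
    by (rule compact_translation)
  moreover have "closed ?C"
  proof -
    have "continuous_on UNIV (\<lambda>v. representation B v b)" for b
      by (rule bounded_linear.continuous_on[OF bounded_linear_representation continuous_on_id])
    then have "closed {v. \<bar>representation B v b - representation B p b\<bar> \<le> M}" for b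
      by (intro closed_Collect_le continuous_on_rabs continuous_on_diff continuous_on_const)
    then show ?thesis by (simp add: Collect_ball_eq closed_INT)
  qed
  moreover have "?C \<subseteq> (+) p ` ?F ` PiE B (\<lambda>_. {- M..M})"
  proof
    fix v assume v: "v \<in> ?C"
    let ?f = "restrict (representation B (v - p)) B"
    have "representation B (v - p) b \<in> {- M..M}" if "b \<in> B" for b
    proof -
      have "\<bar>representation B v b - representation B p b\<bar> \<le> M"
        using v that by blast
      then show ?thesis
        unfolding representation_diff[OF ind sp sp] atLeastAtMost_iff by linarith
    qed
    then have "?f \<in> PiE B (\<lambda>_. {- M..M})"
      by (simp del: atLeastAtMost_iff)
    moreover have "v = p + ?F ?f"
      using basis_expansion[of "v - p"] by simp
    ultimately show "v \<in> (+) p ` ?F ` PiE B (\<lambda>_. {- M..M})"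
      by (intro image_eqI[where x = "?F ?f"] imageI)
  qed
  ultimately have "compact ((+) p ` ?F ` PiE B (\<lambda>_. {- M..M}) \<inter> ?C)"
    by (intro compact_Int_closed)
  then show ?thesis
    using \<open>?C \<subseteq> (+) p ` ?F ` PiE B (\<lambda>_. {- M..M})\<close> by (simp add: Int_absorb1)
qed

end

section \<open>Iterated differentiability\<close>

lemma cont_diff_cong:
  "open S \<Longrightarrow> (\<And>x. x \<in> S \<Longrightarrow> f x = g x) \<Longrightarrow> cont_diff k S f \<Longrightarrow> cont_diff k S g"
proof (induction k arbitrary: f g)
  case 0
  then show ?case by (simp cong: continuous_on_cong)
next
  case (Suc k)
  have d: "(g has_derivative frechet_derivative f (at x)) (at x)" if "x \<in> S" for x
    using that Suc.prems has_derivative_transform_within_open[of f _ x UNIV S g]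
    by (auto simp: frechet_derivative_works)
  have "cont_diff k S (\<lambda>x. frechet_derivative g (at x) v)" for v
  proof (rule Suc.IH[OF Suc.prems(1)])
    show "cont_diff k S (\<lambda>x. frechet_derivative f (at x) v)"
      using Suc.prems by simp
    show "frechet_derivative f (at x) v = frechet_derivative g (at x) v" if "x \<in> S" for x
      using frechet_derivative_at[OF d[OF that]] by simp
  qed
  then show ?case using d by (auto simp: differentiable_def)
qed

lemma cont_diff_SucI:
  assumes S: "open S" and f': "\<And>x. x \<in> S \<Longrightarrow> (f has_derivative f' x) (at x)"
    and "\<And>v. cont_diff k S (\<lambda>x. f' x v)"
  shows "cont_diff (Suc k) S f"
proof -
  have "cont_diff k S (\<lambda>x. frechet_derivative f (at x) v)" for v
    by (rule cont_diff_cong[OF S _ assms(3)[of v]]) (simp add: frechet_derivative_at[OF f'])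
  then show ?thesis using f' by (auto simp: differentiable_def)
qed

lemma cont_diff_SucD:
  assumes "cont_diff (Suc k) S f"
  shows "\<And>x. x \<in> S \<Longrightarrow> (f has_derivative frechet_derivative f (at x)) (at x)"
    and "\<And>v. cont_diff k S (\<lambda>x. frechet_derivative f (at x) v)"
  using assms by (auto simp: frechet_derivative_works)

lemma cont_diff_Suc: "cont_diff (Suc k) S f \<Longrightarrow> cont_diff k S f"
proof (induction k arbitrary: f)
  case 0
  then show ?case
    by (auto intro!: continuous_at_imp_continuous_on differentiable_imp_continuous_within)
next
  case (Suc k)
  have "cont_diff k S (\<lambda>x. frechet_derivative f (at x) v)" for v
    by (rule Suc.IH[OF cont_diff_SucD(2)[OF Suc.prems]])
  then show ?case using Suc.prems by (simp only: cont_diff.simps) blast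
qed

lemma cont_diff_subset: "T \<subseteq> S \<Longrightarrow> cont_diff k S f \<Longrightarrow> cont_diff k T f"
  by (induction k arbitrary: f) (auto intro: continuous_on_subset)

lemma cont_diff_Un:
  "open S \<Longrightarrow> open T \<Longrightarrow> cont_diff k S f \<Longrightarrow> cont_diff k T f \<Longrightarrow> cont_diff k (S \<union> T) f"
  by (induction k arbitrary: f) (auto intro: continuous_on_open_Un)

lemma cont_diff_const: "open S \<Longrightarrow> cont_diff k S (\<lambda>x. c)"
  by (induction k arbitrary: c)
    (auto intro!: cont_diff_SucI[where f' = "\<lambda>x v. 0"] simp del: cont_diff.simps(2))

lemma cont_diff_add:
  "open S \<Longrightarrow> cont_diff k S f \<Longrightarrow> cont_diff k S g \<Longrightarrow> cont_diff k S (\<lambda>x. f x + g x)"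
proof (induction k arbitrary: f g)
  case 0
  then show ?case by (simp add: continuous_on_add)
next
  case (Suc k)
  show ?case
    by (rule cont_diff_SucI[OF Suc.prems(1) has_derivative_add[OF cont_diff_SucD(1)[OF Suc.prems(2)]
      cont_diff_SucD(1)[OF Suc.prems(3)]]])
      (use Suc cont_diff_SucD(2)[OF Suc.prems(2)] cont_diff_SucD(2)[OF Suc.prems(3)] in auto)
qed

lemma cont_diff_bounded_linear:
  assumes L: "bounded_linear L"
  shows "open S \<Longrightarrow> cont_diff k S f \<Longrightarrow> cont_diff k S (\<lambda>x. L (f x))"
proof (induction k arbitrary: f)
  case 0
  then show ?case by (simp add: bounded_linear.continuous_on[OF L])
next
  case (Suc k)
  show ?case
    by (rule cont_diff_SucI[OF Suc.prems(1) bounded_linear.has_derivative[OF L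
            cont_diff_SucD(1)[OF Suc.prems(2)]]])
      (use Suc cont_diff_SucD(2)[OF Suc.prems(2)] in auto)
qed

lemma cont_diff_mult:
  fixes f g :: "'a::real_normed_vector \<Rightarrow> real"
  shows "open S \<Longrightarrow> cont_diff k S f \<Longrightarrow> cont_diff k S g \<Longrightarrow> cont_diff k S (\<lambda>x. f x * g x)"
proof (induction k arbitrary: f g)
  case 0
  then show ?case by (simp add: continuous_on_mult)
next
  case (Suc k)
  note f = Suc.prems(2) and g = Suc.prems(3)
  have "cont_diff k S (\<lambda>x. f x * frechet_derivative g (at x) v + frechet_derivative f (at x) v * g x)"
    for v
    by (intro cont_diff_add Suc.IH Suc.prems(1) cont_diff_Suc[OF f] cont_diff_Suc[OF g]
        cont_diff_SucD(2)[OF f] cont_diff_SucD(2)[OF g])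
  then show ?case
  proof (intro cont_diff_SucI[OF Suc.prems(1)])
    fix x assume x: "x \<in> S"
    show "((\<lambda>x. f x * g x) has_derivative
      (\<lambda>v. f x * frechet_derivative g (at x) v + frechet_derivative f (at x) v * g x)) (at x)"
      by (rule has_derivative_mult[OF cont_diff_SucD(1)[OF f x] cont_diff_SucD(1)[OF g x]])
  qed
qed

lemma cont_diff_sum:
  "open S \<Longrightarrow> (\<And>i. i \<in> I \<Longrightarrow> cont_diff k S (f i)) \<Longrightarrow> cont_diff k S (\<lambda>x. \<Sum>i\<in>I. f i x)"
  by (induction I rule: infinite_finite_induct) (auto intro: cont_diff_const cont_diff_add)

text \<open>
  The directional derivative of \<open>f \<circ> g\<close> is \<open>Df\<close> at \<open>g x\<close> in a direction that varies with \<open>x\<close>, so it is not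
  of the form to which an induction hypothesis applies.  Expanding the direction in a basis turns it into a
  sum of products of functions that are covered.
\<close>

lemma cont_diff_compose:
  fixes g :: "'a::real_normed_vector \<Rightarrow> 'b::real_normed_vector" and f :: "'b \<Rightarrow> real"
  assumes B: "is_finite_basis (B :: 'b set)" and S: "open S" and T: "open T" and "g ` S \<subseteq> T"
  shows "cont_diff k T f \<Longrightarrow> cont_diff k S g \<Longrightarrow> cont_diff k S (\<lambda>x. f (g x))"
proof (induction k arbitrary: f)
  case 0
  then show ?case
    using continuous_on_compose2[of T f S g] assms(4) by auto
next
  case (Suc k)
  note f = Suc.prems(1) and g = Suc.prems(2)
  let ?D = "\<lambda>x v. \<Sum>b\<in>B. representation B (frechet_derivative g (at x) v) b *
      frechet_derivative f (at (g x)) b"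
  show ?case
  proof (rule cont_diff_SucI[OF S])
    fix x assume x: "x \<in> S"
    then have df: "(f has_derivative frechet_derivative f (at (g x))) (at (g x))"
      using assms(4) by (intro cont_diff_SucD(1)[OF f]) auto
    then interpret linear "frechet_derivative f (at (g x))"
      by (rule has_derivative_linear)
    have eq: "frechet_derivative f (at (g x)) w =
        (\<Sum>b\<in>B. representation B w b * frechet_derivative f (at (g x)) b)" for w
    proof -
      have "frechet_derivative f (at (g x)) w =
          frechet_derivative f (at (g x)) (\<Sum>b\<in>B. representation B w b *\<^sub>R b)"
        by (rule arg_cong[OF basis_expansion[OF B]])
      also have "\<dots> = (\<Sum>b\<in>B. representation B w b * frechet_derivative f (at (g x)) b)"
        by (simp add: sum scale)
      finally show ?thesis .
    qed
    have "frechet_derivative f (at (g x)) \<circ> frechet_derivative g (at x) = ?D x"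
      by (rule ext, unfold o_apply, rule eq)
    moreover have "f \<circ> g = (\<lambda>x. f (g x))"
      by (rule ext) simp
    ultimately show "((\<lambda>x. f (g x)) has_derivative ?D x) (at x)"
      using diff_chain_at[OF cont_diff_SucD(1)[OF g x] df] by simp
  next
    fix v
    show "cont_diff k S (\<lambda>x. ?D x v)"
    proof (intro cont_diff_sum[OF S] cont_diff_mult[OF S])
      fix b
      show "cont_diff k S (\<lambda>x. representation B (frechet_derivative g (at x) v) b)"
        by (rule cont_diff_bounded_linear[OF bounded_linear_representation[OF B] S
              cont_diff_SucD(2)[OF g]])
      show "cont_diff k S (\<lambda>x. frechet_derivative f (at (g x)) b)"
        by (rule Suc.IH[OF cont_diff_SucD(2)[OF f] cont_diff_Suc[OF g]])
    qed
  qed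
qed

section \<open>Bump functions\<close>

text \<open>
  The functions \<open>exp (- 1 / t) / t\<^sup>n\<close>, continued by zero; the span of this family is closed under
  differentiation, so smoothness is a simple induction.
\<close>

definition flat_exp :: "nat \<Rightarrow> real \<Rightarrow> real" where
  "flat_exp n t = (if t > 0 then exp (- (1 / t)) / t ^ n else 0)"

lemma flat_exp_tendsto_0: "(flat_exp n \<longlongrightarrow> 0) (at 0)"
proof -
  have "((\<lambda>t. inverse t ^ n / exp (inverse t)) \<longlongrightarrow> 0) (at_right (0::real))"
    by (rule filterlim_compose[OF tendsto_power_div_exp_0 filterlim_inverse_at_top_right])
  moreover have "\<forall>\<^sub>F t in at_right 0. inverse t ^ n / exp (inverse t) = flat_exp n t"
    unfolding eventually_at_right_field
    by (intro exI[of _ 1]) (auto simp: flat_exp_def exp_minus field_simps)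
  ultimately have "(flat_exp n \<longlongrightarrow> 0) (at_right 0)"
    by (rule Lim_transform_eventually)
  moreover have "(flat_exp n \<longlongrightarrow> 0) (at_left 0)"
  proof (rule Lim_transform_eventually[OF tendsto_const])
    show "\<forall>\<^sub>F t in at_left 0. 0 = flat_exp n t"
      unfolding eventually_at_left_field
      by (intro exI[of _ "-1"]) (auto simp: flat_exp_def)
  qed
  ultimately show ?thesis by (simp add: filterlim_split_at)
qed

lemma has_derivative_flat_exp:
  "(flat_exp n has_derivative (\<lambda>v. (- real n * flat_exp (Suc n) t + flat_exp (Suc (Suc n)) t) * v)) (at t)"
proof -
  let ?d = "- real n * flat_exp (Suc n) t + flat_exp (Suc (Suc n)) t"
  consider "t > 0" | "t = 0" | "t < 0" by linarith
  then have "(flat_exp n has_real_derivative ?d) (at t)"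
  proof cases
    case 1
    have "((\<lambda>t. exp (- (1 / t)) / t ^ n) has_real_derivative
        (exp (- (1 / t)) * (1 / t\<^sup>2) * t ^ n - exp (- (1 / t)) * (real n * t ^ (n - 1))) / (t ^ n * t ^ n)) (at t)"
      using 1 by (auto intro!: derivative_eq_intros simp: power2_eq_square)
    moreover have "(exp (- (1 / t)) * (1 / t\<^sup>2) * t ^ n - exp (- (1 / t)) * (real n * t ^ (n - 1))) / (t ^ n * t ^ n) = ?d"
      using 1 by (cases n) (auto simp: flat_exp_def field_simps power2_eq_square)
    ultimately have "((\<lambda>t. exp (- (1 / t)) / t ^ n) has_real_derivative ?d) (at t)"
      by simp
    then show ?thesis
      by (rule has_field_derivative_transform_within_open[of _ _ _ "{0<..}"])
        (use 1 in \<open>auto simp: flat_exp_def\<close>)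
  next
    case 2
    have "\<forall>\<^sub>F h in at 0. flat_exp (Suc n) h = (flat_exp n (0 + h) - flat_exp n 0) / h"
      by (auto simp: eventually_at flat_exp_def field_simps intro!: exI[of _ 1])
    then have "((\<lambda>h. (flat_exp n (0 + h) - flat_exp n 0) / h) \<longlongrightarrow> 0) (at 0)"
      by (rule Lim_transform_eventually[OF flat_exp_tendsto_0])
    then show ?thesis
      using 2 by (simp add: DERIV_def flat_exp_def)
  next
    case 3
    have "((\<lambda>t. 0) has_real_derivative 0) (at t)" by simp
    then have "(flat_exp n has_real_derivative 0) (at t)"
      by (rule has_field_derivative_transform_within_open[of _ _ _ "{..<0}"])
        (use 3 in \<open>auto simp: flat_exp_def\<close>)
    then show ?thesis using 3 by (simp add: flat_exp_def)
  qed
  then show ?thesis by (simp add: has_field_derivative_def mult.commute[of _ ?d])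
qed

lemma smooth_flat_exp: "smooth_on UNIV (flat_exp n)"
proof -
  have "cont_diff k UNIV (flat_exp n)" for k
  proof (induction k arbitrary: n)
    case 0
    have "isCont (flat_exp n) t" for t
      using has_derivative_flat_exp[of n t] by (rule has_derivative_continuous)
    then show ?case by (simp add: continuous_on_eq_continuous_at)
  next
    case (Suc k)
    show ?case
    proof (rule cont_diff_SucI[OF open_UNIV has_derivative_flat_exp])
      fix v :: real
      have "cont_diff k UNIV (\<lambda>t. - real n * flat_exp (Suc n) t)"
        by (rule cont_diff_mult[OF open_UNIV cont_diff_const[OF open_UNIV] Suc.IH])
      from cont_diff_add[OF open_UNIV this Suc.IH]
      have "cont_diff k UNIV (\<lambda>t. - real n * flat_exp (Suc n) t + flat_exp (Suc (Suc n)) t)" .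
      from cont_diff_mult[OF open_UNIV this cont_diff_const[OF open_UNIV]]
      show "cont_diff k UNIV (\<lambda>t. (- real n * flat_exp (Suc n) t + flat_exp (Suc (Suc n)) t) * v)" .
    qed
  qed
  then show ?thesis by (simp add: smooth_on_def)
qed

lemma smooth_on_cong: "open S \<Longrightarrow> (\<And>x. x \<in> S \<Longrightarrow> f x = g x) \<Longrightarrow> smooth_on S f \<Longrightarrow> smooth_on S g"
  using cont_diff_cong[of S f g] by (simp add: smooth_on_def)

lemma smooth_on_subset: "T \<subseteq> S \<Longrightarrow> smooth_on S f \<Longrightarrow> smooth_on T f"
  using cont_diff_subset[of T S] unfolding smooth_on_def by blast

lemma smooth_on_Un: "open S \<Longrightarrow> open T \<Longrightarrow> smooth_on S f \<Longrightarrow> smooth_on T f \<Longrightarrow> smooth_on (S \<union> T) f"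
  by (simp add: smooth_on_def cont_diff_Un)

lemma smooth_on_const: "open S \<Longrightarrow> smooth_on S (\<lambda>x. c)"
  by (simp add: smooth_on_def cont_diff_const)

lemma smooth_on_add: "open S \<Longrightarrow> smooth_on S f \<Longrightarrow> smooth_on S g \<Longrightarrow> smooth_on S (\<lambda>x. f x + g x)"
  by (simp add: smooth_on_def cont_diff_add)

lemma smooth_on_mult:
  fixes f g :: "'a::real_normed_vector \<Rightarrow> real"
  shows "open S \<Longrightarrow> smooth_on S f \<Longrightarrow> smooth_on S g \<Longrightarrow> smooth_on S (\<lambda>x. f x * g x)"
  by (simp add: smooth_on_def cont_diff_mult)

lemma smooth_on_compose:
  fixes g :: "'a::real_normed_vector \<Rightarrow> 'b::real_normed_vector" and f :: "'b \<Rightarrow> real"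
  assumes "is_finite_basis (B :: 'b set)" "open S" "open T" "g ` S \<subseteq> T" "smooth_on T f" "smooth_on S g"
  shows "smooth_on S (\<lambda>x. f (g x))"
  using cont_diff_compose[OF assms(1-4)] assms(5,6) by (simp add: smooth_on_def)

lemma smooth_on_bounded_linear: "bounded_linear f \<Longrightarrow> open S \<Longrightarrow> smooth_on S f"
proof -
  assume f: "bounded_linear f" and S: "open S"
  have id: "cont_diff k S (\<lambda>x. x)" for k
  proof (induction k)
    case (Suc k)
    show ?case
      by (rule cont_diff_SucI[OF S has_derivative_ident cont_diff_const[OF S]])
  qed simp
  show ?thesis
    using cont_diff_bounded_linear[OF f S id] by (simp add: smooth_on_def)
qed

text \<open>
  The composition of \<open>exp (- 1 / t)\<close> with \<open>M\<^sup>2\<close> minus the squared Euclidean distance in coordinates, normalised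
  at the centre.  It vanishes outside a cube of coordinate half-width \<open>M\<close>, which is compact, and \<open>M\<close>
  is chosen so small that the cube lies in the given open set.
\<close>

lemma bump_function_exists:
  fixes B :: "'b::real_normed_vector set" and p :: 'b
  assumes B: "is_finite_basis B" and U: "open U" "p \<in> U"
  shows "\<exists>h K. smooth_on UNIV h \<and> h p = (1::real) \<and> compact K \<and> K \<subseteq> U \<and> (\<forall>x. x \<notin> K \<longrightarrow> h x = 0)"
proof -
  have fin: "finite B" and ind: "independent B" and sp: "v \<in> span B" for v
    using B by (auto simp: is_finite_basis_def)
  let ?c = "representation B"
  obtain e where e: "e > 0" "ball p e \<subseteq> U"
    using U by (auto simp: open_contains_ball)
  \<comment> \<open>In the coordinate cube of half-width \<open>M\<close> around \<open>p\<close>, the distance to \<open>p\<close> is at most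
      \<open>M * (\<Sum>b\<in>B. norm b) < e\<close>.\<close>
  define M where "M = e / (1 + (\<Sum>b\<in>B. norm b))"
  have pos: "1 + (\<Sum>b\<in>B. norm b) > 0"
    by (simp add: add_pos_nonneg sum_nonneg)
  have M: "M > 0"
    using e pos by (simp add: M_def)
  define K where "K = {v. \<forall>b\<in>B. \<bar>?c v b - ?c p b\<bar> \<le> M}"
  have K: "compact K"
    unfolding K_def by (rule compact_coordinate_cube[OF B])
  have KU: "K \<subseteq> U"
  proof
    fix v assume v: "v \<in> K"
    have "norm (v - p) = norm (\<Sum>b\<in>B. ?c (v - p) b *\<^sub>R b)"
      using basis_expansion[OF B, of "v - p"] by simp
    also have "\<dots> \<le> (\<Sum>b\<in>B. norm (?c (v - p) b *\<^sub>R b))"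
      by (rule norm_sum)
    also have "\<dots> \<le> (\<Sum>b\<in>B. M * norm b)"
    proof (rule sum_mono)
      fix b assume "b \<in> B"
      then have "\<bar>?c (v - p) b\<bar> \<le> M"
        using v unfolding representation_diff[OF ind sp sp] by (simp add: K_def)
      then show "norm (?c (v - p) b *\<^sub>R b) \<le> M * norm b"
        by (simp add: mult_right_mono)
    qed
    also have "\<dots> = M * (\<Sum>b\<in>B. norm b)"
      by (simp add: sum_distrib_left)
    also have "\<dots> < M * (1 + (\<Sum>b\<in>B. norm b))"
      using M by (simp add: algebra_simps)
    also have "\<dots> = e"
      using pos by (simp add: M_def)
    finally have "v \<in> ball p e"
      by (simp add: dist_norm norm_minus_commute)
    then show "v \<in> U" using e by blast
  qed
  define u where "u v = M\<^sup>2 + (\<Sum>b\<in>B. - ((?c v b - ?c p b) * (?c v b - ?c p b)))" for v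
  define h where "h v = flat_exp 0 (u v) * (1 / flat_exp 0 (M\<^sup>2))" for v
  have sq: "cont_diff k UNIV (\<lambda>v. - ((?c v b - ?c p b) * (?c v b - ?c p b)))" for k b
  proof -
    have c: "cont_diff k UNIV (\<lambda>v. ?c v b + (- ?c p b))"
      using smooth_on_bounded_linear[OF bounded_linear_representation[OF B] open_UNIV]
      by (intro cont_diff_add[OF open_UNIV] cont_diff_const[OF open_UNIV]) (simp add: smooth_on_def)
    have "cont_diff k UNIV (\<lambda>v. -1 * ((?c v b + (- ?c p b)) * (?c v b + (- ?c p b))))"
      by (rule cont_diff_mult[OF open_UNIV cont_diff_const[OF open_UNIV]
            cont_diff_mult[OF open_UNIV c c]])
    then show ?thesis by simp
  qed
  have "smooth_on UNIV u"
    unfolding smooth_on_def u_def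
    by (intro allI cont_diff_add[OF open_UNIV] cont_diff_sum[OF open_UNIV]
        cont_diff_const[OF open_UNIV] sq)
  then have "smooth_on UNIV (\<lambda>v. flat_exp 0 (u v))"
    by (intro smooth_on_compose[OF is_finite_basis_real open_UNIV open_UNIV _ smooth_flat_exp]) auto
  then have "smooth_on UNIV h"
    unfolding h_def by (rule smooth_on_mult[OF open_UNIV _ smooth_on_const[OF open_UNIV]])
  moreover have "h p = 1"
    using M by (simp add: h_def u_def flat_exp_def)
  moreover have "h v = 0" if vK: "v \<notin> K" for v
  proof -
    obtain b where b: "b \<in> B" "\<bar>?c v b - ?c p b\<bar> > M"
      using vK by (auto simp: K_def not_le)
    have "M\<^sup>2 \<le> (?c v b - ?c p b) * (?c v b - ?c p b)"
      using b(2) M using power_mono[of M "\<bar>?c v b - ?c p b\<bar>" 2] by (simp add: power2_eq_square)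
    also have "\<dots> \<le> (\<Sum>b\<in>B. (?c v b - ?c p b) * (?c v b - ?c p b))"
      using b(1) fin by (intro member_le_sum[where f = "\<lambda>b. (?c v b - ?c p b) * (?c v b - ?c p b)"]) auto
    finally show ?thesis
      by (simp add: h_def u_def flat_exp_def sum_negf)
  qed
  ultimately show ?thesis using K KU by blast
qed

section \<open>Smooth functions on a manifold\<close>

context smooth_manifold
begin

lemma chart_inverse: "(U, \<phi>) \<in> atlas \<Longrightarrow> q \<in> U \<Longrightarrow> inv_into U \<phi> (\<phi> q) = q"
  using chart_homeo by (rule homeomorphism_apply1)

lemma chart_image_open:
  assumes "(U, \<phi>) \<in> atlas" "open W"
  shows "open (\<phi> ` (U \<inter> W))"
proof -
  have "openin (top_of_set (\<phi> ` U)) (\<phi> ` (U \<inter> W))"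
    by (rule homeomorphism_imp_open_map[OF chart_homeo[OF assms(1)]])
      (use assms(2) in \<open>auto simp: openin_open\<close>)
  then show ?thesis
    using chart_open[OF assms(1)] by (meson openin_open_trans)
qed

lemma smooth_fun_cong:
  assumes "open W" "\<And>q. q \<in> W \<Longrightarrow> f q = g q" "smooth_fun atlas W f"
  shows "smooth_fun atlas W g"
proof -
  have "smooth_on (\<phi> ` (U \<inter> W)) (g \<circ> inv_into U \<phi>)" if U: "(U, \<phi>) \<in> atlas" for U \<phi>
  proof (rule smooth_on_cong[OF chart_image_open[OF U assms(1)]])
    show "smooth_on (\<phi> ` (U \<inter> W)) (f \<circ> inv_into U \<phi>)"
      using assms(3) U by (auto simp: smooth_fun_def)
  qed (use assms(2) chart_inverse[OF U] in auto)
  then show ?thesis by (auto simp: smooth_fun_def)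
qed

lemma smooth_fun_subset: "V \<subseteq> W \<Longrightarrow> smooth_fun atlas W f \<Longrightarrow> smooth_fun atlas V f"
  unfolding smooth_fun_def
  by (auto elim!: ballE intro: smooth_on_subset[of "_ ` (_ \<inter> V)" "_ ` (_ \<inter> W)", OF image_mono])

lemma smooth_fun_Un:
  assumes "open V" "open W" "smooth_fun atlas V f" "smooth_fun atlas W f"
  shows "smooth_fun atlas (V \<union> W) f"
  unfolding smooth_fun_def
proof clarify
  fix U \<phi> assume U: "(U, \<phi>) \<in> atlas"
  have "\<phi> ` (U \<inter> (V \<union> W)) = \<phi> ` (U \<inter> V) \<union> \<phi> ` (U \<inter> W)" by auto
  then show "smooth_on (\<phi> ` (U \<inter> (V \<union> W))) (f \<circ> inv_into U \<phi>)"
    using assms U chart_image_open[OF U]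
    by (auto simp: smooth_fun_def intro!: smooth_on_Un)
qed

lemma smooth_fun_const: "open W \<Longrightarrow> smooth_fun atlas W (\<lambda>q. c)"
  by (auto simp: smooth_fun_def o_def intro!: smooth_on_const chart_image_open)

lemma smooth_fun_add:
  "open W \<Longrightarrow> smooth_fun atlas W f \<Longrightarrow> smooth_fun atlas W g \<Longrightarrow> smooth_fun atlas W (\<lambda>q. f q + g q)"
  by (auto simp: smooth_fun_def o_def intro!: smooth_on_add chart_image_open)

lemma smooth_fun_mult:
  "open W \<Longrightarrow> smooth_fun atlas W f \<Longrightarrow> smooth_fun atlas W g \<Longrightarrow> smooth_fun atlas W (\<lambda>q. f q * g q)"
  by (auto simp: smooth_fun_def o_def intro!: smooth_on_mult chart_image_open)

lemma smooth_fun_sum: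
  "open W \<Longrightarrow> (\<And>i. i \<in> I \<Longrightarrow> smooth_fun atlas W (f i)) \<Longrightarrow> smooth_fun atlas W (\<lambda>q. \<Sum>i\<in>I. f i q)"
  by (induction I rule: infinite_finite_induct) (auto intro: smooth_fun_const smooth_fun_add)

lemma smooth_functions_iff: "f \<in> smooth_functions atlas \<longleftrightarrow> smooth_fun atlas UNIV f"
  by (simp add: smooth_functions_def)

lemma smooth_functions_const: "(\<lambda>q. c) \<in> smooth_functions atlas"
  by (simp add: smooth_functions_iff smooth_fun_const)

lemma smooth_functions_mult:
  "f \<in> smooth_functions atlas \<Longrightarrow> g \<in> smooth_functions atlas \<Longrightarrow> (\<lambda>q. f q * g q) \<in> smooth_functions atlas"
  by (simp add: smooth_functions_iff smooth_fun_mult)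

lemma smooth_functions_power:
  "f \<in> smooth_functions atlas \<Longrightarrow> (\<lambda>q. f q ^ n) \<in> smooth_functions atlas"
  by (induction n) (simp_all add: smooth_functions_const smooth_functions_mult)

lemma smooth_functions_local: "f \<in> smooth_functions atlas \<Longrightarrow> smooth_fun atlas W f"
  by (simp add: smooth_functions_iff smooth_fun_subset[OF subset_UNIV])

text \<open>
  The bump function in a chart is continued by zero.  Its support is the image of a compact set,
  hence closed because the manifold is a Hausdorff space; so the manifold is covered by the chart
  domain and the complement of the support, and the function is smooth on both.
\<close>

lemma smooth_cutoff_exists:
  assumes W: "open W" "p \<in> W"
  shows "\<exists>\<theta> C. \<theta> \<in> smooth_functions atlas \<and> \<theta> p = 1 \<and> closed C \<and> C \<subseteq> W \<and> (\<forall>q. q \<notin> C \<longrightarrow> \<theta> q = 0)"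
proof -
  obtain B :: "'b set" where B: "is_finite_basis B"
    using finite_dim is_finite_basis_exists by metis
  have "p \<in> (\<Union>(U, \<phi>)\<in>atlas. U)"
    by (simp only: chart_cover UNIV_I)
  then obtain V \<phi> where V: "(V, \<phi>) \<in> atlas" "p \<in> V"
    by auto
  obtain h K where h: "smooth_on UNIV h" "h (\<phi> p) = (1::real)" and K: "compact K" "K \<subseteq> \<phi> ` (V \<inter> W)"
    and hK: "\<And>x. x \<notin> K \<Longrightarrow> h x = 0"
    using bump_function_exists[OF B chart_image_open[OF V(1) W(1)], of "\<phi> p"] V(2) W(2) by auto
  define C where "C = inv_into V \<phi> ` K"
  define \<theta> where "\<theta> q = (if q \<in> V then h (\<phi> q) else 0)" for q
  have "continuous_on (\<phi> ` V) (inv_into V \<phi>)"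
    using chart_homeo[OF V(1)] by (simp add: homeomorphism_def)
  then have "continuous_on K (inv_into V \<phi>)"
    by (rule continuous_on_subset) (use K(2) in auto)
  then have C: "closed C"
    unfolding C_def by (intro compact_imp_closed compact_continuous_image K(1))
  have CW: "C \<subseteq> V \<inter> W"
    using K(2) chart_inverse[OF V(1)] by (force simp: C_def)
  have \<theta>0: "\<theta> q = 0" if "q \<notin> C" for q
  proof (cases "q \<in> V")
    case True
    then have "\<phi> q \<notin> K"
      using that chart_inverse[OF V(1) True] unfolding C_def by (metis imageI)
    then show ?thesis using hK by (simp add: \<theta>_def)
  qed (simp add: \<theta>_def)
  have "smooth_fun atlas V \<theta>"
  proof (rule smooth_fun_cong[of V "\<lambda>q. h (\<phi> q)"])
    show "open V" using chart_open[OF V(1)] by simp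
    show "smooth_fun atlas V (\<lambda>q. h (\<phi> q))"
      unfolding smooth_fun_def
    proof clarify
      fix U \<psi> assume U: "(U, \<psi>) \<in> atlas"
      have "smooth_on (\<psi> ` (U \<inter> V)) (\<lambda>x. h ((\<phi> \<circ> inv_into U \<psi>) x))"
        by (rule smooth_on_compose[OF B chart_image_open[OF U] open_UNIV _ h(1)
              chart_compatible[OF U V(1)]]) (use chart_open[OF V(1)] in auto)
      then show "smooth_on (\<psi> ` (U \<inter> V)) ((\<lambda>q. h (\<phi> q)) \<circ> inv_into U \<psi>)"
        by (simp add: o_def)
    qed
  qed (simp add: \<theta>_def)
  moreover have "smooth_fun atlas (- C) \<theta>"
    by (rule smooth_fun_cong[of _ "\<lambda>q. 0"]) (use C \<theta>0 in \<open>auto intro: smooth_fun_const\<close>)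
  ultimately have "smooth_fun atlas (V \<union> - C) \<theta>"
    using C chart_open[OF V(1)] by (intro smooth_fun_Un) auto
  moreover have "V \<union> - C = UNIV" using CW by auto
  ultimately have "\<theta> \<in> smooth_functions atlas"
    by (simp add: smooth_functions_iff)
  moreover have "\<theta> p = 1" using V(2) h(2) by (simp add: \<theta>_def)
  ultimately show ?thesis using C CW \<theta>0 by (intro exI[of _ \<theta>] exI[of _ C]) auto
qed

text \<open>
  A set \<open>V\<close> smaller than the whole manifold occurs in the smoothness condition for sections, which
  is imposed on each frame domain.
\<close>

lemma smooth_fun_extend_by_zero:
  assumes \<theta>: "\<theta> \<in> smooth_functions atlas" and C: "closed C" "C \<subseteq> U" "\<And>q. q \<notin> C \<Longrightarrow> \<theta> q = 0"
    and "open U" "open V" and c: "smooth_fun atlas (V \<inter> U) c"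
  shows "smooth_fun atlas V (\<lambda>q. if q \<in> U then \<theta> q * c q else 0)" (is "smooth_fun _ _ ?f")
proof -
  have "smooth_fun atlas (V \<inter> U) ?f"
    by (rule smooth_fun_cong[OF _ _ smooth_fun_mult[OF _ smooth_functions_local[OF \<theta>] c]])
      (use assms in auto)
  moreover have "smooth_fun atlas (V \<inter> - C) ?f"
    by (rule smooth_fun_cong[OF _ _ smooth_fun_const[of _ 0]]) (use assms in auto)
  ultimately have "smooth_fun atlas (V \<inter> U \<union> V \<inter> - C) ?f"
    using assms by (intro smooth_fun_Un) auto
  moreover have "V \<inter> U \<union> V \<inter> - C = V" using C(2) by auto
  ultimately show ?thesis by simp
qed

end

section \<open>The exterior algebra\<close>

lemma vec_add: "vec (u + v) = vec u + vec v"
  by transfer (use ext_ideal.add in \<open>simp add: ext_rel_def algebra_simps\<close>)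

lemma vec_scaleR: "vec (c *\<^sub>R v) = c *\<^sub>R vec v"
  by transfer (use ext_ideal.scale in \<open>simp add: ext_rel_def\<close>)

lemma vec_square: "vec v * vec v = 0"
  by transfer (use ext_ideal.square in \<open>simp add: ext_rel_def\<close>)

lemma vec_zero: "vec 0 = 0"
  using vec_scaleR[of 0 0] by simp

lemma vec_sum: "vec (\<Sum>i\<in>I. f i) = (\<Sum>i\<in>I. vec (f i))"
  by (induction I rule: infinite_finite_induct) (simp_all add: vec_zero vec_add)

lemma vec_anticommute: "vec u * vec v = - (vec v * vec u)"
  using vec_square[of "u + v"]
  by (simp add: vec_add algebra_simps vec_square eq_neg_iff_add_eq_0)

lemma prod_vec_commute_single:
  "prod_list (map vec us) * vec v = (-1) ^ length us *\<^sub>R (vec v * prod_list (map vec us))"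
proof (induction us)
  case (Cons u us)
  have "prod_list (map vec (u # us)) * vec v = vec u * (prod_list (map vec us) * vec v)"
    by (simp add: mult.assoc)
  also have "\<dots> = (-1) ^ length us *\<^sub>R (vec u * vec v * prod_list (map vec us))"
    by (simp add: Cons.IH mult.assoc)
  also have "vec u * vec v = - (vec v * vec u)"
    by (rule vec_anticommute)
  finally show ?case by (simp add: mult.assoc)
qed simp

lemma prod_vec_commute:
  "prod_list (map vec us) * prod_list (map vec vs) =
    (-1) ^ (length us * length vs) *\<^sub>R (prod_list (map vec vs) * prod_list (map vec us))"
proof (induction vs)
  case (Cons v vs)
  have "prod_list (map vec us) * prod_list (map vec (v # vs)) =
      (prod_list (map vec us) * vec v) * prod_list (map vec vs)"
    by (simp add: mult.assoc)
  also have "\<dots> = (-1) ^ length us *\<^sub>R (vec v * (prod_list (map vec us) * prod_list (map vec vs)))"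
    by (simp add: prod_vec_commute_single mult.assoc)
  also have "\<dots> = (-1) ^ length us *\<^sub>R (-1) ^ (length us * length vs) *\<^sub>R
      (vec v * prod_list (map vec vs) * prod_list (map vec us))"
    by (simp add: Cons.IH mult.assoc)
  finally show ?case by (simp add: power_add)
qed simp

lemma ext_power_subspace: "subspace (ext_power k W)"
  by (simp add: ext_power_def)

lemma ext_power_induct [consumes 1, case_names zero add scale decomposable]:
  assumes "P \<in> ext_power k W" and "Q 0"
    and "\<And>x y. Q x \<Longrightarrow> Q y \<Longrightarrow> Q (x + y)" and "\<And>c x. Q x \<Longrightarrow> Q (c *\<^sub>R x)"
    and "\<And>vs. set vs \<subseteq> W \<Longrightarrow> length vs = k \<Longrightarrow> Q (prod_list (map vec vs))"
  shows "Q P"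
proof -
  have "subspace (Collect Q)"
    by (rule subspaceI) (use assms(2-4) in auto)
  moreover have "Q x" if "x \<in> {prod_list (map vec vs) |vs. set vs \<subseteq> W \<and> length vs = k}" for x
    using that assms(5) by auto
  ultimately show ?thesis
    using assms(1) unfolding ext_power_def by (rule span_induct[rotated])
qed

lemma ext_power_commute:
  assumes "P \<in> ext_power k W" "Q \<in> ext_power l W"
  shows "P * Q = (-1) ^ (k * l) *\<^sub>R (Q * P)"
  using assms(1)
proof (induction rule: ext_power_induct)
  case (decomposable us)
  show ?case
    using assms(2)
  proof (induction rule: ext_power_induct)
    case (decomposable vs)
    then show ?case
      using prod_vec_commute[of us vs] \<open>length us = k\<close> by simp
  qed (simp_all add: algebra_simps)
qed (simp_all add: algebra_simps)

definition wedge_of :: "(nat \<Rightarrow> 'v::real_vector) \<Rightarrow> nat list \<Rightarrow> 'v ext" where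
  "wedge_of f is = prod_list (map (\<lambda>i. vec (f i)) is)"

lemma wedge_of_simps [simp]:
  "wedge_of f [] = 1" "wedge_of f (i # is) = vec (f i) * wedge_of f is"
  "wedge_of f (is @ js) = wedge_of f is * wedge_of f js"
  by (simp_all add: wedge_of_def)

lemma vec_mult_wedge_of_repeated: "i \<in> set is \<Longrightarrow> vec (f i) * wedge_of f is = 0"
proof (induction "is")
  case (Cons j js)
  show ?case
  proof (cases "i = j")
    case True
    have "vec (f i) * wedge_of f (j # js) = vec (f j) * vec (f j) * wedge_of f js"
      by (simp add: True mult.assoc)
    then show ?thesis by (simp add: vec_square)
  next
    case False
    then have "vec (f i) * wedge_of f js = 0" using Cons by simp
    have "vec (f i) * wedge_of f (j # js) = vec (f i) * vec (f j) * wedge_of f js"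
      by (simp add: mult.assoc)
    also have "\<dots> = - (vec (f j) * (vec (f i) * wedge_of f js))"
      by (subst vec_anticommute) (simp add: mult.assoc)
    finally show ?thesis using \<open>vec (f i) * wedge_of f js = 0\<close> by simp
  qed
qed simp

lemma vec_mult_wedge_of_insort:
  "\<exists>s::real. \<forall>f::nat \<Rightarrow> 'v::real_vector. vec (f i) * wedge_of f is = s *\<^sub>R wedge_of f (insort i is)"
proof (induction "is")
  case Nil
  show ?case by (intro exI[of _ 1]) simp
next
  case (Cons j js)
  then obtain s :: real where s: "\<And>f::nat \<Rightarrow> 'v. vec (f i) * wedge_of f js = s *\<^sub>R wedge_of f (insort i js)"
    by auto
  show ?case
  proof (cases "i \<le> j")
    case True
    then show ?thesis by (intro exI[of _ 1]) simp
  next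
    case False
    have "vec (f i) * wedge_of f (j # js) = - s *\<^sub>R wedge_of f (insort i (j # js))" for f :: "nat \<Rightarrow> 'v"
    proof -
      have "vec (f i) * wedge_of f (j # js) = vec (f i) * vec (f j) * wedge_of f js"
        by (simp add: mult.assoc)
      also have "\<dots> = - (vec (f j) * (vec (f i) * wedge_of f js))"
        by (subst vec_anticommute) (simp add: mult.assoc)
      finally show ?thesis using False by (simp add: s)
    qed
    then show ?thesis by blast
  qed
qed

text \<open>
  The factor \<open>s\<close> does not depend on the vectors, so it is constant over the domain of a local
  frame and does not affect the smoothness of coefficients.
\<close>

lemma wedge_of_sort:
  "\<exists>s::real. (\<forall>f::nat \<Rightarrow> 'v::real_vector. wedge_of f is = s *\<^sub>R wedge_of f (sorted_list_of_set (set is))) \<and>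
    (\<not> distinct is \<longrightarrow> s = 0)"
proof (induction "is")
  case Nil
  show ?case by (intro exI[of _ 1]) simp
next
  case (Cons i "is")
  then obtain s :: real
    where s: "\<And>f::nat \<Rightarrow> 'v. wedge_of f is = s *\<^sub>R wedge_of f (sorted_list_of_set (set is))"
      and s0: "\<not> distinct is \<Longrightarrow> s = 0" by auto
  show ?case
  proof (cases "i \<in> set is")
    case True
    then show ?thesis
      by (intro exI[of _ 0]) (simp add: vec_mult_wedge_of_repeated)
  next
    case False
    obtain t :: real where t: "\<And>f::nat \<Rightarrow> 'v. vec (f i) * wedge_of f (sorted_list_of_set (set is)) =
        t *\<^sub>R wedge_of f (insort i (sorted_list_of_set (set is)))"
      using vec_mult_wedge_of_insort by blast
    have "insort i (sorted_list_of_set (set is)) = sorted_list_of_set (set (i # is))"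
      using False by simp
    then have "wedge_of f (i # is) = (s * t) *\<^sub>R wedge_of f (sorted_list_of_set (set (i # is)))" for f :: "nat \<Rightarrow> 'v"
      by (simp only: wedge_of_simps s mult_scaleR_right t scaleR_scaleR)
    then show ?thesis
      using s0 False by (intro exI[of _ "s * t"]) auto
  qed
qed

abbreviation basis_wedge :: "(nat \<Rightarrow> 'v::real_vector) \<Rightarrow> nat set \<Rightarrow> 'v ext" where
  "basis_wedge f I \<equiv> wedge_of f (sorted_list_of_set I)"

lemma basis_wedge_mult:
  "\<exists>s :: nat set \<Rightarrow> nat set \<Rightarrow> real. \<forall>I J. finite I \<longrightarrow> finite J \<longrightarrow>
    (\<forall>f::nat \<Rightarrow> 'v::real_vector. basis_wedge f I * basis_wedge f J = s I J *\<^sub>R basis_wedge f (I \<union> J)) \<and>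
    (I \<inter> J \<noteq> {} \<longrightarrow> s I J = 0)"
proof -
  have "\<exists>s::real. finite I \<longrightarrow> finite J \<longrightarrow>
    (\<forall>f::nat \<Rightarrow> 'v. basis_wedge f I * basis_wedge f J = s *\<^sub>R basis_wedge f (I \<union> J)) \<and>
    (I \<inter> J \<noteq> {} \<longrightarrow> s = 0)" for I J
    using wedge_of_sort[of "sorted_list_of_set I @ sorted_list_of_set J"]
    by (cases "finite I"; cases "finite J") auto
  then show ?thesis by metis
qed

section \<open>Multisections of a vector bundle\<close>

lemma prod_list_fun_apply: "prod_list Fs p = prod_list (map (\<lambda>F. F p) Fs)"
  by (induction Fs) simp_all

lemma sum_fun_apply: "(\<Sum>i\<in>I. F i) p = (\<Sum>i\<in>I. F i p)"
  by (induction I rule: infinite_finite_induct) simp_all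

lemma prod_vsec_apply: "prod_list (map vsec (map X is)) p = wedge_of (\<lambda>i. X i p) is"
  by (simp add: prod_list_fun_apply vsec_def wedge_of_def o_def)

lemma wedge_of_scaleR: "wedge_of (\<lambda>i. c *\<^sub>R f i) is = c ^ length is *\<^sub>R wedge_of f is"
  by (induction "is") (simp_all add: vec_scaleR)

lemma fscale_mult_left: "fscale f P * Q = fscale f (P * Q)"
  and fscale_mult_right: "P * fscale f Q = fscale f (P * Q)"
  for P Q :: "'m \<Rightarrow> 'v::real_vector ext"
  by (simp_all add: fscale_def fun_eq_iff)

lemma fscale_diff: "fscale f (P - Q) = fscale f P - fscale f Q"
  for P Q :: "'m \<Rightarrow> 'x::real_vector"
  by (simp_all add: fscale_def fun_eq_iff algebra_simps)

lemma fscale_const: "fscale (\<lambda>p. c) P = c *\<^sub>R P"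
  by (simp add: fscale_def fun_eq_iff)

lemma fscale_zero [simp]: "fscale f 0 = (0 :: 'm \<Rightarrow> 'x::real_vector)"
  by (simp add: fscale_def fun_eq_iff)

lemma fsec_mult: "fsec f * P = fscale f P"
  by (simp add: fsec_def fscale_def fun_eq_iff)

lemma fsec_one: "fsec (\<lambda>p. 1) = 1"
  by (simp add: fsec_def fun_eq_iff)

lemma vsec_add: "vsec (X + Y) = vsec X + vsec Y"
  by (simp add: vsec_def fun_eq_iff vec_add)

context vector_bundle
begin

abbreviation \<Gamma> :: "int \<Rightarrow> ('m \<Rightarrow> 'v ext) set" where
  "\<Gamma> \<equiv> wedge_sections atlas A r frames"

abbreviation \<Gamma>A :: "('m \<Rightarrow> 'v) set" where
  "\<Gamma>A \<equiv> sections atlas A r frames"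

definition multi_indices :: "nat \<Rightarrow> nat set set" where
  "multi_indices n = {I. I \<subseteq> {..<r} \<and> card I = n}"

lemma finite_multi_indices: "finite (multi_indices n)"
  unfolding multi_indices_def by (rule finite_subset[of _ "Pow {..<r}"]) auto

lemma multi_index_finite: "I \<in> multi_indices n \<Longrightarrow> finite I"
  unfolding multi_indices_def using finite_subset by blast

lemma wedge_sections_neg: "k < 0 \<Longrightarrow> \<Gamma> k = {0}"
  by (simp add: wedge_sections_def)

lemma frame_fibre:
  assumes "(U, e) \<in> frames" "p \<in> U" "i < r"
  shows "e i p \<in> A p"
proof -
  have "span ((\<lambda>i. e i p) ` {..<r}) = A p"
    using frame_basis[OF assms(1,2)] by blast
  moreover have "e i p \<in> span ((\<lambda>i. e i p) ` {..<r})"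
    by (rule span_base) (use assms(3) in auto)
  ultimately show ?thesis by simp
qed

lemma frame_exists: "\<exists>U e. (U, e) \<in> frames \<and> p \<in> U"
proof -
  have "p \<in> (\<Union>(U, e)\<in>frames. U)" by (simp only: frame_cover UNIV_I)
  then show ?thesis by auto
qed

lemma wedge_sections_power: "P \<in> \<Gamma> (int n) \<Longrightarrow> P p \<in> ext_power n (A p)"
  by (simp add: wedge_sections_def)

lemma wedge_sections_expansion:
  assumes "P \<in> \<Gamma> (int n)" "(U, e) \<in> frames"
  obtains c where "\<forall>I\<in>multi_indices n. smooth_fun atlas U (c I)"
    and "\<forall>p\<in>U. P p = (\<Sum>I\<in>multi_indices n. c I p *\<^sub>R basis_wedge (\<lambda>i. e i p) I)"
proof -
  have "\<forall>(U, e)\<in>frames. \<exists>c. (\<forall>I\<in>multi_indices n. smooth_fun atlas U (c I)) \<and>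
    (\<forall>p\<in>U. P p = (\<Sum>I\<in>multi_indices n. c I p *\<^sub>R basis_wedge (\<lambda>i. e i p) I))"
    using assms(1) by (simp add: wedge_sections_def multi_indices_def wedge_of_def Ball_def)
  from bspec[OF this assms(2)]
  have "\<exists>c. (\<forall>I\<in>multi_indices n. smooth_fun atlas U (c I)) \<and>
    (\<forall>p\<in>U. P p = (\<Sum>I\<in>multi_indices n. c I p *\<^sub>R basis_wedge (\<lambda>i. e i p) I))"
    by (simp only: prod.case)
  then show ?thesis by (elim exE conjE) (rule that)
qed

lemma sections_expansion:
  assumes "X \<in> \<Gamma>A" "(U, e) \<in> frames"
  obtains c where "\<forall>i<r. smooth_fun atlas U (c i)"
    and "\<forall>p\<in>U. X p = (\<Sum>i<r. c i p *\<^sub>R e i p)"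
proof -
  have "\<forall>(U, e)\<in>frames. \<exists>c. (\<forall>i<r. smooth_fun atlas U (c i)) \<and>
      (\<forall>p\<in>U. X p = (\<Sum>i<r. c i p *\<^sub>R e i p))"
    using assms(1)[unfolded sections_def] by simp
  from bspec[OF this assms(2)]
  have "\<exists>c. (\<forall>i<r. smooth_fun atlas U (c i)) \<and> (\<forall>p\<in>U. X p = (\<Sum>i<r. c i p *\<^sub>R e i p))"
    by (simp only: prod.case)
  then show ?thesis by (elim exE conjE) (rule that)
qed

text \<open>
  The fibrewise condition is a consequence of the local expansions because the frame domains cover
  the manifold.
\<close>

lemma wedge_sectionsI:
  assumes "\<And>U e. (U, e) \<in> frames \<Longrightarrow> \<exists>c. (\<forall>I\<in>multi_indices n. smooth_fun atlas U (c I)) \<and>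
    (\<forall>p\<in>U. P p = (\<Sum>I\<in>multi_indices n. c I p *\<^sub>R basis_wedge (\<lambda>i. e i p) I))"
  shows "P \<in> \<Gamma> (int n)"
proof -
  have "P p \<in> ext_power n (A p)" for p
  proof -
    obtain U e where U: "(U, e) \<in> frames" "p \<in> U"
      using frame_exists by blast
    obtain c where c: "P p = (\<Sum>I\<in>multi_indices n. c I p *\<^sub>R basis_wedge (\<lambda>i. e i p) I)"
      using assms[OF U(1)] U(2) by blast
    have "basis_wedge (\<lambda>i. e i p) I \<in> ext_power n (A p)" if I: "I \<in> multi_indices n" for I
      unfolding ext_power_def wedge_of_def
    proof (rule span_base, intro CollectI exI conjI)
      show "prod_list (map (\<lambda>i. vec (e i p)) (sorted_list_of_set I)) =
          prod_list (map vec (map (\<lambda>i. e i p) (sorted_list_of_set I)))"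
        by (simp add: o_def)
      show "set (map (\<lambda>i. e i p) (sorted_list_of_set I)) \<subseteq> A p"
        using I multi_index_finite[OF I] frame_fibre[OF U] by (auto simp: multi_indices_def)
      show "length (map (\<lambda>i. e i p) (sorted_list_of_set I)) = n"
        using I by (simp add: multi_indices_def)
    qed
    then show ?thesis
      unfolding c by (intro subspace_sum subspace_scale ext_power_subspace)
  qed
  moreover have "\<forall>(U, e)\<in>frames. \<exists>c. (\<forall>I\<in>multi_indices n. smooth_fun atlas U (c I)) \<and>
    (\<forall>p\<in>U. P p = (\<Sum>I\<in>multi_indices n. c I p *\<^sub>R basis_wedge (\<lambda>i. e i p) I))"
    using assms by blast
  ultimately show ?thesis
    by (simp add: wedge_sections_def multi_indices_def wedge_of_def Ball_def)
qed

lemma fscale_closed: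
  assumes f: "f \<in> smooth_functions atlas" and P: "P \<in> \<Gamma> k"
  shows "fscale f P \<in> \<Gamma> k"
proof (cases k rule: int_cases)
  case (nonneg n)
  have "fscale f P \<in> \<Gamma> (int n)"
  proof (rule wedge_sectionsI)
    fix U e assume U: "(U, e) \<in> frames"
    obtain c where "\<forall>I\<in>multi_indices n. smooth_fun atlas U (c I)"
        "\<forall>p\<in>U. P p = (\<Sum>I\<in>multi_indices n. c I p *\<^sub>R basis_wedge (\<lambda>i. e i p) I)"
      by (rule wedge_sections_expansion[OF P[unfolded nonneg] U])
    note c = this[rule_format]
    show "\<exists>c. (\<forall>I\<in>multi_indices n. smooth_fun atlas U (c I)) \<and>
        (\<forall>p\<in>U. fscale f P p = (\<Sum>I\<in>multi_indices n. c I p *\<^sub>R basis_wedge (\<lambda>i. e i p) I))"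
    proof (intro exI conjI ballI)
      show "smooth_fun atlas U (\<lambda>p. f p * c I p)" if "I \<in> multi_indices n" for I
        by (rule smooth_fun_mult[OF frame_open[OF U] smooth_functions_local[OF f] c(1)[OF that]])
      show "fscale f P p = (\<Sum>I\<in>multi_indices n. (f p * c I p) *\<^sub>R basis_wedge (\<lambda>i. e i p) I)"
        if "p \<in> U" for p
        using c(2)[OF that] by (simp add: fscale_def scaleR_sum_right)
    qed
  qed
  then show ?thesis by (simp add: nonneg)
next
  case (neg n)
  then have "k < 0" by simp
  then show ?thesis using P wedge_sections_neg by simp
qed

lemma wedge_sections_subspace: "subspace (\<Gamma> k)"
proof (cases k rule: int_cases)
  case (nonneg n)
  have "subspace (\<Gamma> (int n))"
  proof (rule subspaceI)
    show "0 \<in> \<Gamma> (int n)"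
    proof (rule wedge_sectionsI)
      fix U e assume U: "(U, e) \<in> frames"
      show "\<exists>c. (\<forall>I\<in>multi_indices n. smooth_fun atlas U (c I)) \<and>
          (\<forall>p\<in>U. 0 p = (\<Sum>I\<in>multi_indices n. c I p *\<^sub>R basis_wedge (\<lambda>i. e i p) I))"
        by (rule exI[of _ "\<lambda>I p. 0"]) (simp add: smooth_fun_const[OF frame_open[OF U]])
    qed
    show "P + Q \<in> \<Gamma> (int n)" if P: "P \<in> \<Gamma> (int n)" and Q: "Q \<in> \<Gamma> (int n)" for P Q
    proof (rule wedge_sectionsI)
      fix U e assume U: "(U, e) \<in> frames"
      obtain c where "\<forall>I\<in>multi_indices n. smooth_fun atlas U (c I)"
          "\<forall>p\<in>U. P p = (\<Sum>I\<in>multi_indices n. c I p *\<^sub>R basis_wedge (\<lambda>i. e i p) I)"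
        by (rule wedge_sections_expansion[OF P U])
      note c = this[rule_format]
      obtain d where "\<forall>I\<in>multi_indices n. smooth_fun atlas U (d I)"
          "\<forall>p\<in>U. Q p = (\<Sum>I\<in>multi_indices n. d I p *\<^sub>R basis_wedge (\<lambda>i. e i p) I)"
        by (rule wedge_sections_expansion[OF Q U])
      note d = this[rule_format]
      show "\<exists>c. (\<forall>I\<in>multi_indices n. smooth_fun atlas U (c I)) \<and>
          (\<forall>p\<in>U. (P + Q) p = (\<Sum>I\<in>multi_indices n. c I p *\<^sub>R basis_wedge (\<lambda>i. e i p) I))"
      proof (intro exI conjI ballI)
        show "smooth_fun atlas U (\<lambda>p. c I p + d I p)" if "I \<in> multi_indices n" for I
          by (rule smooth_fun_add[OF frame_open[OF U] c(1)[OF that] d(1)[OF that]])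
        show "(P + Q) p = (\<Sum>I\<in>multi_indices n. (c I p + d I p) *\<^sub>R basis_wedge (\<lambda>i. e i p) I)"
          if "p \<in> U" for p
          by (simp add: c(2)[OF that] d(2)[OF that] scaleR_add_left sum.distrib)
      qed
    qed
    show "c *\<^sub>R P \<in> \<Gamma> (int n)" if "P \<in> \<Gamma> (int n)" for c P
      using fscale_closed[OF smooth_functions_const that, of c] by (simp add: fscale_const)
  qed
  then show ?thesis by (simp add: nonneg)
next
  case (neg n)
  then show ?thesis by (simp add: wedge_sections_neg)
qed

lemma vsec_closed:
  assumes X: "X \<in> \<Gamma>A"
  shows "vsec X \<in> \<Gamma> 1"
proof -
  have idx: "multi_indices 1 = (\<lambda>i. {i}) ` {..<r}"
    by (auto simp: multi_indices_def card_1_singleton_iff)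
  have "vsec X \<in> \<Gamma> (int 1)"
  proof (rule wedge_sectionsI)
    fix U e assume U: "(U, e) \<in> frames"
    obtain c where "\<forall>i<r. smooth_fun atlas U (c i)" "\<forall>p\<in>U. X p = (\<Sum>i<r. c i p *\<^sub>R e i p)"
      by (rule sections_expansion[OF X U])
    note c = this[rule_format]
    show "\<exists>c. (\<forall>I\<in>multi_indices 1. smooth_fun atlas U (c I)) \<and>
        (\<forall>p\<in>U. vsec X p = (\<Sum>I\<in>multi_indices 1. c I p *\<^sub>R basis_wedge (\<lambda>i. e i p) I))"
    proof (rule exI[of _ "\<lambda>I. c (the_elem I)"], intro conjI ballI)
      show "smooth_fun atlas U (c (the_elem I))" if "I \<in> multi_indices 1" for I
        using that[unfolded idx] c(1) by auto
      show "vsec X p = (\<Sum>I\<in>multi_indices 1. c (the_elem I) p *\<^sub>R basis_wedge (\<lambda>i. e i p) I)"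
        if "p \<in> U" for p
        unfolding idx
        by (subst sum.reindex) (auto simp: vsec_def c(2)[OF that] vec_sum vec_scaleR inj_on_def)
    qed
  qed
  then show ?thesis by simp
qed

lemma fsec_closed:
  assumes f: "f \<in> smooth_functions atlas"
  shows "fsec f \<in> \<Gamma> 0"
proof -
  have idx: "multi_indices 0 = {{}}"
    by (auto simp: multi_indices_def dest: finite_subset[OF _ finite_lessThan])
  have "fsec f \<in> \<Gamma> (int 0)"
  proof (rule wedge_sectionsI)
    fix U e assume U: "(U, e) \<in> frames"
    show "\<exists>c. (\<forall>I\<in>multi_indices 0. smooth_fun atlas U (c I)) \<and>
        (\<forall>p\<in>U. fsec f p = (\<Sum>I\<in>multi_indices 0. c I p *\<^sub>R basis_wedge (\<lambda>i. e i p) I))"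
      by (rule exI[of _ "\<lambda>I. f"]) (simp add: idx fsec_def smooth_functions_local[OF f])
  qed
  then show ?thesis by simp
qed

text \<open>
  The coefficients of a product are sums of products of the coefficients with constant signs.
\<close>

lemma wedge_sections_mult:
  assumes P: "P \<in> \<Gamma> (int n)" and Q: "Q \<in> \<Gamma> (int m)"
  shows "P * Q \<in> \<Gamma> (int (n + m))"
proof (rule wedge_sectionsI)
  fix U e assume U: "(U, e) \<in> frames"
  obtain c where "\<forall>I\<in>multi_indices n. smooth_fun atlas U (c I)"
      "\<forall>p\<in>U. P p = (\<Sum>I\<in>multi_indices n. c I p *\<^sub>R basis_wedge (\<lambda>i. e i p) I)"
    by (rule wedge_sections_expansion[OF P U])
  note c = this[rule_format]
  obtain d where "\<forall>I\<in>multi_indices m. smooth_fun atlas U (d I)"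
      "\<forall>p\<in>U. Q p = (\<Sum>I\<in>multi_indices m. d I p *\<^sub>R basis_wedge (\<lambda>i. e i p) I)"
    by (rule wedge_sections_expansion[OF Q U])
  note d = this[rule_format]
  obtain s :: "nat set \<Rightarrow> nat set \<Rightarrow> real" where s:
      "\<And>I J (f :: nat \<Rightarrow> 'v). finite I \<Longrightarrow> finite J \<Longrightarrow>
        basis_wedge f I * basis_wedge f J = s I J *\<^sub>R basis_wedge f (I \<union> J)"
      "\<And>I J. finite I \<Longrightarrow> finite J \<Longrightarrow> I \<inter> J \<noteq> {} \<Longrightarrow> s I J = 0"
    using basis_wedge_mult[where 'v = 'v] by metis
  \<comment> \<open>Overlapping \<open>I\<close> and \<open>J\<close> have \<open>s I J = 0\<close>, so every nonzero term has \<open>card (I \<union> J) = n + m\<close>.\<close>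
  define b where "b K p = (\<Sum>I\<in>multi_indices n. \<Sum>J\<in>multi_indices m.
      (if I \<union> J = K then s I J else 0) * (c I p * d J p))" for K p
  show "\<exists>b. (\<forall>K\<in>multi_indices (n + m). smooth_fun atlas U (b K)) \<and>
      (\<forall>p\<in>U. (P * Q) p = (\<Sum>K\<in>multi_indices (n + m). b K p *\<^sub>R basis_wedge (\<lambda>i. e i p) K))"
  proof (intro exI conjI ballI)
    show "smooth_fun atlas U (b K)" for K
      unfolding b_def
      by (intro smooth_fun_sum frame_open[OF U] smooth_fun_mult smooth_fun_const c(1) d(1))
    fix p assume p: "p \<in> U"
    let ?w = "basis_wedge (\<lambda>i. e i p)"
    have "(P * Q) p = (\<Sum>I\<in>multi_indices n. \<Sum>J\<in>multi_indices m.
        (c I p * d J p) *\<^sub>R (?w I * ?w J))"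
      by (simp add: c(2)[OF p] d(2)[OF p] sum_product mult.commute)
    also have "\<dots> = (\<Sum>I\<in>multi_indices n. \<Sum>J\<in>multi_indices m. \<Sum>K\<in>multi_indices (n + m).
        ((if I \<union> J = K then s I J else 0) * (c I p * d J p)) *\<^sub>R ?w K)"
    proof (intro sum.cong[OF refl])
      fix I J assume I: "I \<in> multi_indices n" and J: "J \<in> multi_indices m"
      note fin = multi_index_finite[OF I] multi_index_finite[OF J]
      have "(\<Sum>K\<in>multi_indices (n + m).
          ((if I \<union> J = K then s I J else 0) * (c I p * d J p)) *\<^sub>R ?w K) =
        (\<Sum>K\<in>multi_indices (n + m).
          if I \<union> J = K then (s I J * (c I p * d J p)) *\<^sub>R ?w K else 0)"
        by (intro sum.cong) auto
      also have "\<dots> = (if I \<union> J \<in> multi_indices (n + m) then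
          (s I J * (c I p * d J p)) *\<^sub>R ?w (I \<union> J) else 0)"
        by (rule sum.delta'[OF finite_multi_indices])
      also have "\<dots> = (s I J * (c I p * d J p)) *\<^sub>R ?w (I \<union> J)"
      proof (cases "I \<inter> J = {}")
        case True
        then have "I \<union> J \<in> multi_indices (n + m)"
          using I J card_Un_disjoint[OF fin] by (simp add: multi_indices_def)
        then show ?thesis by simp
      next
        case False
        then show ?thesis using s(2)[OF fin] by simp
      qed
      finally show "(c I p * d J p) *\<^sub>R (?w I * ?w J) = (\<Sum>K\<in>multi_indices (n + m).
          ((if I \<union> J = K then s I J else 0) * (c I p * d J p)) *\<^sub>R ?w K)"
        by (simp add: s(1)[OF fin] mult.commute)
    qed
    also have "\<dots> = (\<Sum>I\<in>multi_indices n. \<Sum>K\<in>multi_indices (n + m). \<Sum>J\<in>multi_indices m.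
        ((if I \<union> J = K then s I J else 0) * (c I p * d J p)) *\<^sub>R ?w K)"
      by (intro sum.cong[OF refl] sum.swap)
    also have "\<dots> = (\<Sum>K\<in>multi_indices (n + m). \<Sum>I\<in>multi_indices n. \<Sum>J\<in>multi_indices m.
        ((if I \<union> J = K then s I J else 0) * (c I p * d J p)) *\<^sub>R ?w K)"
      by (rule sum.swap)
    also have "\<dots> = (\<Sum>K\<in>multi_indices (n + m). b K p *\<^sub>R ?w K)"
      by (simp add: b_def scaleR_sum_left)
    finally show "(P * Q) p = (\<Sum>K\<in>multi_indices (n + m). b K p *\<^sub>R ?w K)" .
  qed
qed

lemma graded_commutative_algebra_wedge_sections: "graded_commutative_algebra \<Gamma>"
proof
  fix k p q P Q
  show "subspace (\<Gamma> k)" by (rule wedge_sections_subspace)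
  show "1 \<in> \<Gamma> 0"
    using fsec_closed[OF smooth_functions_const[of 1]] by (simp add: fsec_one)
  assume P: "P \<in> \<Gamma> p" and Q: "Q \<in> \<Gamma> q"
  show "P * Q \<in> \<Gamma> (p + q)" and "P * Q = (-1) powi (p * q) *\<^sub>R (Q * P)"
  proof -
    have "P * Q \<in> \<Gamma> (p + q) \<and> P * Q = (-1) powi (p * q) *\<^sub>R (Q * P)"
    proof (cases "p < 0 \<or> q < 0")
      case True
      then have "P = 0 \<or> Q = 0" using P Q wedge_sections_neg by blast
      then show ?thesis using subspace_0[OF wedge_sections_subspace] by auto
    next
      case False
      then obtain n m where nm: "p = int n" "q = int m"
        using zero_le_imp_eq_int[of p] zero_le_imp_eq_int[of q] by auto
      have "P x * Q x = (-1) powi (p * q) *\<^sub>R (Q x * P x)" for x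
      proof -
        have "P x * Q x = (-1) ^ (n * m) *\<^sub>R (Q x * P x)"
          by (rule ext_power_commute[OF wedge_sections_power[OF P[unfolded nm]]
                wedge_sections_power[OF Q[unfolded nm]]])
        moreover have "(-1::real) powi (p * q) = (-1) ^ (n * m)"
          unfolding nm by (simp flip: of_nat_mult)
        ultimately show ?thesis by simp
      qed
      then show ?thesis
        using wedge_sections_mult[of P n Q m] P Q by (simp add: nm fun_eq_iff)
    qed
    then show "P * Q \<in> \<Gamma> (p + q)" and "P * Q = (-1) powi (p * q) *\<^sub>R (Q * P)"
      by auto
  qed
qed

sublocale graded_commutative_algebra \<Gamma>
  by (rule graded_commutative_algebra_wedge_sections)

lemma prod_vsec_closed:
  "set Xs \<subseteq> \<Gamma>A \<Longrightarrow> prod_list (map vsec Xs) \<in> \<Gamma> (int (length Xs))"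
proof (induction Xs)
  case Nil
  show ?case
    using one by (simp only: list.map prod_list.Nil list.size of_nat_0)
next
  case (Cons X Xs)
  then have "vsec X * prod_list (map vsec Xs) \<in> \<Gamma> (1 + int (length Xs))"
    by (intro mult vsec_closed) auto
  then show ?case
    by (simp only: list.map prod_list.Cons list.size of_nat_add of_nat_Suc of_nat_0 add_0_right add.commute)
qed

text \<open>
  If \<open>\<theta>\<close> is a cutoff function for a frame domain, then the \<open>\<theta> e\<^sub>i\<close> and the \<open>\<theta> c\<^sub>I\<close> continued by
  zero are global sections and functions, and their combination is \<open>\<theta>\<^bsup>n+1\<^esup> P\<close>: one factor \<open>\<theta>\<close> comes
  from the coefficient and \<open>n\<close> factors come from the frame vectors.
\<close>

lemma local_decomposition:
  assumes P: "P \<in> \<Gamma> (int n)"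
  shows "\<exists>g F X. g \<in> smooth_functions atlas \<and> g p = 1 \<and>
    (\<forall>I\<in>multi_indices n. F I \<in> smooth_functions atlas) \<and> (\<forall>i<r. X i \<in> \<Gamma>A) \<and>
    fscale g P = (\<Sum>I\<in>multi_indices n.
      fscale (F I) (prod_list (map vsec (map X (sorted_list_of_set I)))))"
proof -
  obtain U e where U: "(U, e) \<in> frames" "p \<in> U"
    using frame_exists by blast
  obtain c where "\<forall>I\<in>multi_indices n. smooth_fun atlas U (c I)"
      "\<forall>p\<in>U. P p = (\<Sum>I\<in>multi_indices n. c I p *\<^sub>R basis_wedge (\<lambda>i. e i p) I)"
    by (rule wedge_sections_expansion[OF P U(1)])
  note c = this[rule_format]
  obtain \<theta> C where \<theta>: "\<theta> \<in> smooth_functions atlas" "\<theta> p = 1"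
    and C: "closed C" "C \<subseteq> U" "\<And>q. q \<notin> C \<Longrightarrow> \<theta> q = 0"
    using smooth_cutoff_exists[OF frame_open[OF U(1)] U(2)] by auto
  define F where "F I q = (if q \<in> U then \<theta> q * c I q else 0)" for I q
  define X where "X i q = (if q \<in> U then \<theta> q *\<^sub>R e i q else 0)" for i q
  have extend: "smooth_fun atlas V (\<lambda>q. if q \<in> U then \<theta> q * c q else 0)"
    if "open V" "smooth_fun atlas (V \<inter> U) c" for V c
    by (rule smooth_fun_extend_by_zero[OF \<theta>(1) C(1,2) _ frame_open[OF U(1)] that]) (rule C(3))
  have "F I \<in> smooth_functions atlas" if "I \<in> multi_indices n" for I
    unfolding F_def smooth_functions_iff using c(1)[OF that] by (intro extend) auto
  moreover have "X i \<in> \<Gamma>A" if i: "i < r" for i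
  proof -
    have "X i q \<in> A q" for q
      using frame_fibre[OF U(1) _ i, of q] fibre_subspace[of q]
      by (auto simp: X_def intro: subspace_scale subspace_0)
    moreover have "\<exists>c. (\<forall>j<r. smooth_fun atlas V (c j)) \<and> (\<forall>q\<in>V. X i q = (\<Sum>j<r. c j q *\<^sub>R e' j q))"
      if V: "(V, e') \<in> frames" for V e'
    proof -
      obtain g where "(\<forall>i<r. \<forall>j<r. smooth_fun atlas (V \<inter> U) (g i j)) \<and>
          (\<forall>q\<in>V \<inter> U. \<forall>i<r. e i q = (\<Sum>j<r. g i j q *\<^sub>R e' j q))"
        using frame_transition[OF V U(1)] by (rule exE)
      then have g: "\<And>i j. i < r \<Longrightarrow> j < r \<Longrightarrow> smooth_fun atlas (V \<inter> U) (g i j)"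
          "\<And>q i. q \<in> V \<inter> U \<Longrightarrow> i < r \<Longrightarrow> e i q = (\<Sum>j<r. g i j q *\<^sub>R e' j q)"
        by simp_all
      show "\<exists>c. (\<forall>j<r. smooth_fun atlas V (c j)) \<and> (\<forall>q\<in>V. X i q = (\<Sum>j<r. c j q *\<^sub>R e' j q))"
      proof (rule exI[of _ "\<lambda>j q. if q \<in> U then \<theta> q * g i j q else 0"], intro conjI allI impI ballI)
        show "smooth_fun atlas V (\<lambda>q. if q \<in> U then \<theta> q * g i j q else 0)" if "j < r" for j
          by (rule extend[OF frame_open[OF V] g(1)[OF i that]])
        show "X i q = (\<Sum>j<r. (if q \<in> U then \<theta> q * g i j q else 0) *\<^sub>R e' j q)" if "q \<in> V" for q
          using g(2)[of q i] that i by (simp add: X_def scaleR_sum_right)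
      qed
    qed
    ultimately show ?thesis unfolding sections_def by auto
  qed
  moreover have "fscale (\<lambda>q. \<theta> q ^ Suc n) P = (\<Sum>I\<in>multi_indices n.
      fscale (F I) (prod_list (map vsec (map X (sorted_list_of_set I)))))"
  proof
    fix q
    have "(\<Sum>I\<in>multi_indices n.
        fscale (F I) (prod_list (map vsec (map X (sorted_list_of_set I))))) q =
      (\<Sum>I\<in>multi_indices n. F I q *\<^sub>R basis_wedge (\<lambda>i. X i q) I)"
      by (simp only: sum_fun_apply fscale_def prod_vsec_apply)
    also have "\<dots> = fscale (\<lambda>q. \<theta> q ^ Suc n) P q"
    proof (cases "q \<in> U")
      case True
      have "F I q *\<^sub>R basis_wedge (\<lambda>i. X i q) I =
          \<theta> q ^ Suc n *\<^sub>R c I q *\<^sub>R basis_wedge (\<lambda>i. e i q) I" if "I \<in> multi_indices n" for I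
        using True that by (simp add: F_def X_def wedge_of_scaleR multi_indices_def)
      then show ?thesis
        using c(2)[OF True] by (simp add: fscale_def scaleR_sum_right)
    next
      case False
      then have "\<theta> q = 0" using C by blast
      then show ?thesis using False by (simp add: fscale_def F_def)
    qed
    finally show "fscale (\<lambda>q. \<theta> q ^ Suc n) P q = (\<Sum>I\<in>multi_indices n.
        fscale (F I) (prod_list (map vsec (map X (sorted_list_of_set I))))) q" ..
  qed
  moreover have "(\<lambda>q. \<theta> q ^ Suc n) \<in> smooth_functions atlas"
    by (rule smooth_functions_power[OF \<theta>(1)])
  moreover have "\<theta> p ^ Suc n = 1" using \<theta>(2) by simp
  ultimately show ?thesis
    by (intro exI[of _ "\<lambda>q. \<theta> q ^ Suc n"] exI[of _ F] exI[of _ X]) simp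
qed

text \<open>
  At a point \<open>p\<close>, the value of \<open>\<Phi> P\<close> is that of \<open>\<Phi> (g P)\<close> for a smooth function \<open>g\<close> with \<open>g p = 1\<close>, and \<open>g\<close>
  can be chosen such that \<open>g P\<close> is a combination of products of sections.
\<close>

lemma tensorial_map_eq_0:
  fixes \<Phi> :: "('m \<Rightarrow> 'v ext) \<Rightarrow> 'm \<Rightarrow> 'v ext"
  assumes add: "\<And>P Q. P \<in> \<Gamma> k \<Longrightarrow> Q \<in> \<Gamma> k \<Longrightarrow> \<Phi> (P + Q) = \<Phi> P + \<Phi> Q"
    and scale: "\<And>f P. f \<in> smooth_functions atlas \<Longrightarrow> P \<in> \<Gamma> k \<Longrightarrow> \<Phi> (fscale f P) = fscale f (\<Phi> P)"
    and dec: "\<And>Xs. set Xs \<subseteq> \<Gamma>A \<Longrightarrow> \<Phi> (prod_list (map vsec Xs)) = 0"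
    and P: "P \<in> \<Gamma> k"
  shows "\<Phi> P = 0"
proof -
  have zero: "\<Phi> 0 = 0"
    using add[OF zero_closed zero_closed] by simp
  show ?thesis
  proof (cases k rule: int_cases)
    case (nonneg n)
    have "\<Phi> P p = 0" for p
    proof -
      obtain g F X where g: "g \<in> smooth_functions atlas" "g p = 1"
        and F: "\<And>I. I \<in> multi_indices n \<Longrightarrow> F I \<in> smooth_functions atlas"
        and X: "\<And>i. i < r \<Longrightarrow> X i \<in> \<Gamma>A"
        and eq: "fscale g P = (\<Sum>I\<in>multi_indices n.
          fscale (F I) (prod_list (map vsec (map X (sorted_list_of_set I)))))"
        using local_decomposition[of P n p] P nonneg by auto
      let ?t = "\<lambda>I. fscale (F I) (prod_list (map vsec (map X (sorted_list_of_set I))))"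
      have t: "?t I \<in> \<Gamma> k \<and> \<Phi> (?t I) = 0" if I: "I \<in> multi_indices n" for I
      proof -
        have set: "set (map X (sorted_list_of_set I)) \<subseteq> \<Gamma>A"
          using I X multi_index_finite[OF I] by (auto simp: multi_indices_def)
        have "prod_list (map vsec (map X (sorted_list_of_set I))) \<in> \<Gamma> k"
          using prod_vsec_closed[OF set] I by (simp add: nonneg multi_indices_def del: map_map)
        then show ?thesis
          using scale[OF F[OF I]] dec[OF set] fscale_closed[OF F[OF I]] by (simp only: fscale_zero)
      qed
      have "sum ?t S \<in> \<Gamma> k \<and> \<Phi> (sum ?t S) = 0" if "S \<subseteq> multi_indices n" for S
        using finite_subset[OF that finite_multi_indices] that
      proof (induction S rule: finite_induct)
        case empty
        show ?case unfolding sum.empty using zero zero_closed by blast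
      next
        case (insert I S)
        then have "sum ?t S \<in> \<Gamma> k" "\<Phi> (sum ?t S) = 0" and I: "I \<in> multi_indices n" by auto
        then show ?case
          using t[OF I] add[of "?t I" "sum ?t S"] add_closed[of "?t I" k "sum ?t S"]
          unfolding sum.insert[OF insert(1,2)] by (simp only: add_0_left)
      qed
      then have "\<Phi> (fscale g P) = 0" unfolding eq by blast
      then have "fscale g (\<Phi> P) p = 0" using scale[OF g(1) P] by simp
      then show ?thesis using g(2) by (simp add: fscale_def)
    qed
    then show ?thesis by (simp add: fun_eq_iff)
  next
    case (neg n)
    then have "P = 0" using P wedge_sections_neg[of k] by simp
    then show ?thesis using zero by simp
  qed
qed

end

section \<open>Derivations and biderivations of multisections\<close>

context vector_bundle
begin

lemma vsec_mult_closed: "X \<in> \<Gamma>A \<Longrightarrow> P \<in> \<Gamma> k \<Longrightarrow> vsec X * P \<in> \<Gamma> (1 + k)"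
  by (intro mult vsec_closed)

context
  fixes N :: "'m \<Rightarrow> 'v \<Rightarrow> 'v" and D :: "('m \<Rightarrow> 'v ext) \<Rightarrow> ('m \<Rightarrow> 'v ext)"
  assumes N: "\<forall>X\<in>\<Gamma>A. bundle_app N X \<in> \<Gamma>A"
    and D: "derivation_extension atlas A r frames N D"
begin

lemma ext_closed: "P \<in> \<Gamma> k \<Longrightarrow> D P \<in> \<Gamma> k"
  using D unfolding derivation_extension_def Let_def by (elim conjE) blast

lemma ext_add: "P \<in> \<Gamma> k \<Longrightarrow> Q \<in> \<Gamma> k \<Longrightarrow> D (P + Q) = D P + D Q"
  using D unfolding derivation_extension_def Let_def by (elim conjE) blast

lemma ext_fscale: "P \<in> \<Gamma> k \<Longrightarrow> f \<in> smooth_functions atlas \<Longrightarrow> D (fscale f P) = fscale f (D P)"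
  using D unfolding derivation_extension_def Let_def by (elim conjE) blast

lemma ext_fsec: "f \<in> smooth_functions atlas \<Longrightarrow> D (fsec f) = 0"
  using D unfolding derivation_extension_def Let_def by (elim conjE) blast

lemma ext_decomposable:
  assumes "set Ps \<subseteq> \<Gamma>A"
  shows "D (prod_list (map vsec Ps)) =
    (\<Sum>i<length Ps. prod_list (map vsec (Ps[i := bundle_app N (Ps ! i)])))"
proof (cases "Ps = []")
  case True
  have "D 1 = 0"
    using ext_fsec[OF smooth_functions_const[of 1]] by (simp only: fsec_one)
  then show ?thesis
    by (simp only: True list.map prod_list.Nil list.size lessThan_0 sum.empty)
next
  case False
  then show ?thesis
    using D assms unfolding derivation_extension_def Let_def by (elim conjE) blast
qed

lemma ext_vsec_mult_decomposable:
  assumes "set (X # Xs) \<subseteq> \<Gamma>A"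
  shows "D (vsec X * prod_list (map vsec Xs)) =
    vsec (bundle_app N X) * prod_list (map vsec Xs) + vsec X * D (prod_list (map vsec Xs))"
proof -
  have "D (prod_list (map vsec (X # Xs))) = (\<Sum>i<Suc (length Xs).
      prod_list (map vsec ((X # Xs)[i := bundle_app N ((X # Xs) ! i)])))"
    using ext_decomposable[OF assms] by (simp only: list.size add_0_right add_Suc_right)
  also have "\<dots> = vsec (bundle_app N X) * prod_list (map vsec Xs) +
      (\<Sum>i<length Xs. vsec X * prod_list (map vsec (Xs[i := bundle_app N (Xs ! i)])))"
    unfolding sum.lessThan_Suc_shift
    by (simp only: nth_Cons_0 nth_Cons_Suc list_update_code list.map prod_list.Cons)
  also have "\<dots> = vsec (bundle_app N X) * prod_list (map vsec Xs) + vsec X * D (prod_list (map vsec Xs))"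
    using ext_decomposable[of Xs] assms by (simp only: sum_distrib_left set_subset_Cons list.set insert_subset)
  finally show ?thesis
    by (simp only: list.map prod_list.Cons)
qed

lemma ext_vsec: "X \<in> \<Gamma>A \<Longrightarrow> D (vsec X) = vsec (bundle_app N X)"
  using ext_vsec_mult_decomposable[of X "[]"] ext_fsec[OF smooth_functions_const[of 1]]
  unfolding fsec_one list.map prod_list.Nil by simp

lemma ext_vsec_mult:
  assumes X: "X \<in> \<Gamma>A" and P: "P \<in> \<Gamma> k"
  shows "D (vsec X * P) = vsec (bundle_app N X) * P + vsec X * D P"
proof -
  let ?\<Phi> = "\<lambda>P. D (vsec X * P) - vsec (bundle_app N X) * P - vsec X * D P"
  have "?\<Phi> P = 0"
  proof (rule tensorial_map_eq_0[OF _ _ _ P])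
    show "?\<Phi> (P + Q) = ?\<Phi> P + ?\<Phi> Q" if "P \<in> \<Gamma> k" "Q \<in> \<Gamma> k" for P Q
      unfolding distrib_left ext_add[OF that] ext_add[OF vsec_mult_closed[OF X that(1)] vsec_mult_closed[OF X that(2)]]
      by (simp add: algebra_simps)
    show "?\<Phi> (fscale f P) = fscale f (?\<Phi> P)" if "f \<in> smooth_functions atlas" "P \<in> \<Gamma> k" for f P
      unfolding fscale_mult_right ext_fscale[OF that(2,1)]
        ext_fscale[OF vsec_mult_closed[OF X that(2)] that(1)] fscale_diff ..
    show "?\<Phi> (prod_list (map vsec Xs)) = 0" if "set Xs \<subseteq> \<Gamma>A" for Xs
      using ext_vsec_mult_decomposable[of X Xs] X that by simp
  qed
  then show ?thesis by (simp add: algebra_simps)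
qed

text \<open>
  The defect of the Leibniz rule is linear over the smooth functions in the first factor, so
  products of sections suffice; these are peeled off one at a time.
\<close>

lemma ext_mult:
  assumes P: "P \<in> \<Gamma> p" and Q: "Q \<in> \<Gamma> q"
  shows "D (P * Q) = D P * Q + P * D Q"
proof -
  let ?\<Phi> = "\<lambda>P. D (P * Q) - D P * Q - P * D Q"
  have "?\<Phi> P = 0"
  proof (rule tensorial_map_eq_0[OF _ _ _ P])
    show "?\<Phi> (P + R) = ?\<Phi> P + ?\<Phi> R" if "P \<in> \<Gamma> p" "R \<in> \<Gamma> p" for P R
      unfolding distrib_right ext_add[OF that] ext_add[OF mult[OF that(1) Q] mult[OF that(2) Q]]
      by (simp add: algebra_simps)
    show "?\<Phi> (fscale f P) = fscale f (?\<Phi> P)" if "f \<in> smooth_functions atlas" "P \<in> \<Gamma> p" for f P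
      unfolding fscale_mult_left ext_fscale[OF that(2,1)] ext_fscale[OF mult[OF that(2) Q] that(1)]
        fscale_diff ..
    show "?\<Phi> (prod_list (map vsec Xs)) = 0" if "set Xs \<subseteq> \<Gamma>A" for Xs
      using that
    proof (induction Xs)
      case Nil
      have "D 1 = 0"
        using ext_fsec[OF smooth_functions_const[of 1]] by (simp only: fsec_one)
      then show ?case
        by (simp only: list.map prod_list.Nil mult_1_left mult_zero_left diff_zero diff_self)
    next
      case (Cons X Xs)
      let ?R = "prod_list (map vsec Xs)"
      have X: "X \<in> \<Gamma>A" and Xs: "set Xs \<subseteq> \<Gamma>A" using Cons.prems by auto
      have IH: "D (?R * Q) = D ?R * Q + ?R * D Q"
        using Cons.IH[OF Xs] by (simp only: diff_diff_eq right_minus_eq)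
      have "D (vsec X * ?R * Q) = vsec (bundle_app N X) * (?R * Q) + vsec X * D (?R * Q)"
        unfolding mult.assoc by (rule ext_vsec_mult[OF X mult[OF prod_vsec_closed[OF Xs] Q]])
      moreover have "D (vsec X * ?R) = vsec (bundle_app N X) * ?R + vsec X * D ?R"
        by (rule ext_vsec_mult[OF X prod_vsec_closed[OF Xs]])
      ultimately have "D (vsec X * ?R * Q) = D (vsec X * ?R) * Q + vsec X * ?R * D Q"
        unfolding IH by (simp only: distrib_left distrib_right mult.assoc add.assoc)
      then show ?case
        by (simp only: list.map prod_list.Cons diff_diff_eq right_minus_eq)
    qed
  qed
  then show ?thesis by (simp add: algebra_simps)
qed

lemma derivation_ext: "derivation D"
proof -
  have "D (c *\<^sub>R P) = c *\<^sub>R D P" if "P \<in> \<Gamma> k" for c P k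
    using ext_fscale[OF that smooth_functions_const[of c]] by (simp only: fscale_const)
  then show ?thesis
    unfolding derivation_def using ext_closed ext_add ext_mult by blast
qed

end

lemma derivation_extensions_commute:
  assumes N: "\<forall>X\<in>\<Gamma>A. bundle_app N X \<in> \<Gamma>A" and D: "derivation_extension atlas A r frames N D"
    and M: "\<forall>X\<in>\<Gamma>A. bundle_app M X \<in> \<Gamma>A" and K: "derivation_extension atlas A r frames M K"
    and NM: "\<And>X. X \<in> \<Gamma>A \<Longrightarrow> bundle_app N (bundle_app M X) = bundle_app M (bundle_app N X)"
    and P: "P \<in> \<Gamma> k"
  shows "D (K P) = K (D P)"
proof -
  note Dc = ext_closed[OF N D] and Da = ext_add[OF N D] and Ds = ext_fscale[OF N D]
    and Dm = ext_vsec_mult[OF N D]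
  note Kc = ext_closed[OF M K] and Ka = ext_add[OF M K] and Ks = ext_fscale[OF M K]
    and Km = ext_vsec_mult[OF M K]
  let ?\<Phi> = "\<lambda>P. D (K P) - K (D P)"
  have "?\<Phi> P = 0"
  proof (rule tensorial_map_eq_0[OF _ _ _ P])
    show "?\<Phi> (P + Q) = ?\<Phi> P + ?\<Phi> Q" if "P \<in> \<Gamma> k" "Q \<in> \<Gamma> k" for P Q
      unfolding Da[OF that] Ka[OF that] Da[OF Kc[OF that(1)] Kc[OF that(2)]]
        Ka[OF Dc[OF that(1)] Dc[OF that(2)]]
      by (simp add: algebra_simps)
    show "?\<Phi> (fscale f P) = fscale f (?\<Phi> P)" if "f \<in> smooth_functions atlas" "P \<in> \<Gamma> k" for f P
      unfolding Ds[OF that(2,1)] Ks[OF that(2,1)] Ds[OF Kc[OF that(2)] that(1)]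
        Ks[OF Dc[OF that(2)] that(1)] fscale_diff ..
    show "?\<Phi> (prod_list (map vsec Xs)) = 0" if "set Xs \<subseteq> \<Gamma>A" for Xs
      using that
    proof (induction Xs)
      case Nil
      have "D 1 = 0" "K 1 = 0" "D 0 = 0" "K 0 = 0"
        using D_one D_zero derivation_ext[OF N D] derivation_ext[OF M K] by auto
      then show ?case by (simp only: list.map prod_list.Nil diff_self)
    next
      case (Cons X Xs)
      let ?R = "prod_list (map vsec Xs)"
      have X: "X \<in> \<Gamma>A" and Xs: "set Xs \<subseteq> \<Gamma>A" using Cons.prems by auto
      note R = prod_vsec_closed[OF Xs]
      have IH: "D (K ?R) = K (D ?R)"
        using Cons.IH[OF Xs] by (simp only: right_minus_eq)
      have "D (K (vsec X * ?R)) = D (vsec (bundle_app M X) * ?R) + D (vsec X * K ?R)"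
        unfolding Km[OF X R]
        by (rule Da[OF vsec_mult_closed[OF M[rule_format, OF X] R] vsec_mult_closed[OF X Kc[OF R]]])
      also have "\<dots> = vsec (bundle_app N (bundle_app M X)) * ?R + vsec (bundle_app M X) * D ?R +
          (vsec (bundle_app N X) * K ?R + vsec X * D (K ?R))"
        unfolding Dm[OF M[rule_format, OF X] R] Dm[OF X Kc[OF R]] ..
      finally have 1: "D (K (vsec X * ?R)) = \<dots>" .
      have "K (D (vsec X * ?R)) = K (vsec (bundle_app N X) * ?R) + K (vsec X * D ?R)"
        unfolding Dm[OF X R]
        by (rule Ka[OF vsec_mult_closed[OF N[rule_format, OF X] R] vsec_mult_closed[OF X Dc[OF R]]])
      also have "\<dots> = vsec (bundle_app M (bundle_app N X)) * ?R + vsec (bundle_app N X) * K ?R +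
          (vsec (bundle_app M X) * D ?R + vsec X * K (D ?R))"
        unfolding Km[OF N[rule_format, OF X] R] Km[OF X Dc[OF R]] ..
      finally have "D (K (vsec X * ?R)) = K (D (vsec X * ?R))"
        unfolding 1 IH NM[OF X] by (simp only: add_ac)
      then show ?case
        by (simp only: list.map prod_list.Cons diff_self)
    qed
  qed
  then show ?thesis by (simp only: right_minus_eq)
qed

lemma biderivation_diff:
  assumes B: "biderivation B" and B': "biderivation B'"
  shows "biderivation (\<lambda>P Q. B P Q - B' P Q)"
  unfolding biderivation_def
proof (intro conjI allI ballI)
  fix p q P Q assume P: "P \<in> \<Gamma> p" and Q: "Q \<in> \<Gamma> q"
  show "B P Q - B' P Q \<in> \<Gamma> (p + q - 1)"
    by (rule diff_closed[OF B_closed[OF B P Q] B_closed[OF B' P Q]])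
next
  fix p q P Q R assume P: "P \<in> \<Gamma> p" and Q: "Q \<in> \<Gamma> q" and R: "R \<in> \<Gamma> q"
  show "B P (Q + R) - B' P (Q + R) = B P Q - B' P Q + (B P R - B' P R)"
    unfolding B_add[OF B P Q R] B_add[OF B' P Q R] by (simp only: add_diff_add)
next
  fix p q P Q c assume P: "P \<in> \<Gamma> p" and Q: "Q \<in> \<Gamma> q"
  show "B P (c *\<^sub>R Q) - B' P (c *\<^sub>R Q) = c *\<^sub>R (B P Q - B' P Q)"
    unfolding B_scale[OF B P Q] B_scale[OF B' P Q] by (simp only: scaleR_diff_right)
next
  fix p q P Q assume P: "P \<in> \<Gamma> p" and Q: "Q \<in> \<Gamma> q"
  define s :: real where "s = (-1) powi ((p - 1) * (q - 1))"
  have "B P Q - B' P Q = - (s *\<^sub>R B Q P) - - (s *\<^sub>R B' Q P)"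
    using B_skew[OF B P Q] B_skew[OF B' P Q] by (simp only: s_def)
  also have "\<dots> = - (s *\<^sub>R (B Q P - B' Q P))"
    by (simp only: scaleR_diff_right minus_diff_minus)
  finally show "B P Q - B' P Q = - ((-1) powi ((p - 1) * (q - 1)) *\<^sub>R (B Q P - B' Q P))"
    by (simp only: s_def)
next
  fix p q s P Q R assume P: "P \<in> \<Gamma> p" and Q: "Q \<in> \<Gamma> q" and R: "R \<in> \<Gamma> s"
  define t :: real where "t = (-1) powi ((p - 1) * q)"
  have "B P (Q * R) - B' P (Q * R) =
      (B P Q * R + t *\<^sub>R (Q * B P R)) - (B' P Q * R + t *\<^sub>R (Q * B' P R))"
    using B_mult[OF B P Q R] B_mult[OF B' P Q R] by (simp only: t_def)
  also have "\<dots> = (B P Q - B' P Q) * R + t *\<^sub>R (Q * (B P R - B' P R))"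
    by (simp add: algebra_simps)
  finally show "B P (Q * R) - B' P (Q * R) =
      (B P Q - B' P Q) * R + (-1) powi ((p - 1) * q) *\<^sub>R (Q * (B P R - B' P R))"
    by (simp only: t_def)
qed

text \<open>
  The operation \<open>T P\<close> is linear over the smooth functions because it kills them.
\<close>

lemma biderivation_eq_0_right:
  assumes T: "biderivation T" and P: "P \<in> \<Gamma> p"
    and f: "\<And>f. f \<in> smooth_functions atlas \<Longrightarrow> T P (fsec f) = 0"
    and X: "\<And>X. X \<in> \<Gamma>A \<Longrightarrow> T P (vsec X) = 0"
    and Q: "Q \<in> \<Gamma> q"
  shows "T P Q = 0"
proof (rule tensorial_map_eq_0[OF _ _ _ Q])
  show "T P (Q + R) = T P Q + T P R" if "Q \<in> \<Gamma> q" "R \<in> \<Gamma> q" for Q R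
    by (rule B_add[OF T P that])
  show "T P (fscale g Q) = fscale g (T P Q)" if g: "g \<in> smooth_functions atlas" and Q: "Q \<in> \<Gamma> q" for g Q
    using B_mult[OF T P fsec_closed[OF g] Q] f[OF g] by (simp add: fsec_mult)
  show "T P (prod_list (map vsec Xs)) = 0" if "set Xs \<subseteq> \<Gamma>A" for Xs
    using that
  proof (induction Xs)
    case Nil
    show ?case unfolding list.map prod_list.Nil by (rule B_one[OF T P])
  next
    case (Cons X Xs)
    then have X': "X \<in> \<Gamma>A" and Xs: "set Xs \<subseteq> \<Gamma>A" by auto
    show ?case
      unfolding list.map prod_list.Cons B_mult[OF T P vsec_closed[OF X'] prod_vsec_closed[OF Xs]]
        X[OF X'] Cons.IH[OF Xs]
      by (simp only: mult_zero_left mult_zero_right scaleR_zero_right add_0_left)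
  qed
qed

text \<open>
  The first argument is treated in two steps: skew-symmetry moves a general first argument into the
  second place, where vanishing for functions and sections in the first place is already known.
\<close>

lemma biderivation_eq_0:
  assumes T: "biderivation T"
    and Xf: "\<And>X f. X \<in> \<Gamma>A \<Longrightarrow> f \<in> smooth_functions atlas \<Longrightarrow> T (vsec X) (fsec f) = 0"
    and XY: "\<And>X Y. X \<in> \<Gamma>A \<Longrightarrow> Y \<in> \<Gamma>A \<Longrightarrow> T (vsec X) (vsec Y) = 0"
    and P: "P \<in> \<Gamma> p" and Q: "Q \<in> \<Gamma> q"
  shows "T P Q = 0"
proof -
  \<comment> \<open>The value has exterior degree -1.\<close>
  have fg: "T (fsec f) (fsec g) = 0" if "f \<in> smooth_functions atlas" "g \<in> smooth_functions atlas" for f g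
    using B_closed[OF T fsec_closed[OF that(1)] fsec_closed[OF that(2)]] wedge_sections_neg[of "-1"]
    by simp
  have swap: "T P Q = 0" if "P \<in> \<Gamma> p" "Q \<in> \<Gamma> q" "T Q P = 0" for p q P Q
    unfolding B_skew[OF T that(1,2)] that(3) by simp
  have fP: "T (fsec f) Q = 0" if f: "f \<in> smooth_functions atlas" and Q: "Q \<in> \<Gamma> q" for f q Q
    by (rule biderivation_eq_0_right[OF T fsec_closed[OF f] _ _ Q])
      (use fg[OF f] swap[OF fsec_closed[OF f] vsec_closed Xf[OF _ f]] in blast)+
  have XP: "T (vsec X) Q = 0" if X: "X \<in> \<Gamma>A" and Q: "Q \<in> \<Gamma> q" for X q Q
    by (rule biderivation_eq_0_right[OF T vsec_closed[OF X] Xf[OF X] XY[OF X] Q])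
  show ?thesis
  proof (rule biderivation_eq_0_right[OF T P _ _ Q])
    show "T P (fsec f) = 0" if f: "f \<in> smooth_functions atlas" for f
      by (rule swap[OF P fsec_closed[OF f] fP[OF f P]])
    show "T P (vsec X) = 0" if X: "X \<in> \<Gamma>A" for X
      by (rule swap[OF P vsec_closed[OF X] XP[OF X P]])
  qed
qed

end

section \<open>The Nijenhuis identity for a Lie algebroid\<close>

context lie_algebroid
begin

lemma biderivation_schouten_nijenhuis:
  assumes "schouten_nijenhuis atlas A r frames br \<rho> SN"
  shows "biderivation SN"
  using assms unfolding schouten_nijenhuis_def Let_def biderivation_def by (elim conjE) (intro conjI)

text \<open>
  Both sides are biderivations.  On two sections the difference is
  \<open>2 ([N X, N Y] - N [N X, Y] - N [X, N Y] + N (N [X, Y]))\<close>, which is twice the torsion of \<open>N\<close>.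
\<close>

lemma nijenhuis_bracket_deriv:
  assumes nij: "nijenhuis_endo atlas A r frames br N"
    and SN: "schouten_nijenhuis atlas A r frames br \<rho> SN"
    and D: "derivation_extension atlas A r frames N D"
    and K: "derivation_extension atlas A r frames (\<lambda>p. N p \<circ> N p) K"
    and P: "P \<in> \<Gamma> p" and Q: "Q \<in> \<Gamma> q"
  shows "bracket_deriv D (bracket_deriv D SN) P Q = bracket_deriv K SN P Q"
proof -
  let ?N = "bundle_app N"
  have Nb: "\<forall>X\<in>\<Gamma>A. ?N X \<in> \<Gamma>A"
    using nij by (simp add: nijenhuis_endo_def bundle_endo_def)
  have NN: "bundle_app (\<lambda>p. N p \<circ> N p) X = ?N (?N X)" for X
    by (simp add: bundle_app_def)
  note N = bspec[OF Nb]
  have N2: "\<forall>X\<in>\<Gamma>A. bundle_app (\<lambda>p. N p \<circ> N p) X \<in> \<Gamma>A"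
    unfolding NN by (intro ballI N)
  have N_lin: "?N (X + Y - Z) = ?N X + ?N Y - ?N Z" if "X \<in> \<Gamma>A" "Y \<in> \<Gamma>A" "Z \<in> \<Gamma>A" for X Y Z
  proof
    fix x
    have mem: "X x \<in> A x" "Y x \<in> A x" "Z x \<in> A x"
      using that by (simp_all add: sections_def)
    have add: "N x (u + v) = N x u + N x v" and scale: "N x (c *\<^sub>R u) = c *\<^sub>R N x u"
      if "u \<in> A x" "v \<in> A x" for u v c
      using nij that by (simp_all add: nijenhuis_endo_def bundle_endo_def)
    have neg: "(-1) *\<^sub>R Z x \<in> A x"
      using mem subspace_scale[OF fibre_subspace] by blast
    have "N x (X x + Y x + (-1) *\<^sub>R Z x) = N x (X x) + N x (Y x) + (-1) *\<^sub>R N x (Z x)"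
      using add[OF subspace_add[OF fibre_subspace mem(1,2)] neg] add[OF mem(1,2)]
        scale[OF mem(3,3), of "-1"] by simp
    then show "?N (X + Y - Z) x = (?N X + ?N Y - ?N Z) x"
      by (simp add: bundle_app_def)
  qed
  have torsion: "br (?N X) (?N Y) = ?N (br (?N X) Y) + ?N (br X (?N Y)) - ?N (?N (br X Y))"
    if X: "X \<in> \<Gamma>A" and Y: "Y \<in> \<Gamma>A" for X Y
  proof -
    have "br (?N X) (?N Y) = ?N (br (?N X) Y + br X (?N Y) - ?N (br X Y))"
      using nij X Y unfolding nijenhuis_endo_def right_minus_eq by blast
    then show ?thesis
      using N_lin[OF br_closed[OF N[OF X] Y] br_closed[OF X N[OF Y]] N[OF br_closed[OF X Y]]] by simp
  qed
  note dD = derivation_ext[OF Nb D] and dK = derivation_ext[OF N2 K]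
  note bi = biderivation_schouten_nijenhuis[OF SN]
  note bi' = biderivation_bracket_deriv[OF bi dD]
  note Dv = ext_vsec[OF Nb D] and Kv = ext_vsec[OF N2 K, unfolded NN]
  have SNv: "SN (vsec X) (vsec Y) = vsec (br X Y)" if "X \<in> \<Gamma>A" "Y \<in> \<Gamma>A" for X Y
    using SN that unfolding schouten_nijenhuis_def Let_def by (elim conjE) blast
  have SNf: "SN (vsec X) (fsec f) = fsec (anchor_app \<rho> X f)"
    if "X \<in> \<Gamma>A" "f \<in> smooth_functions atlas" for X f
    using SN that unfolding schouten_nijenhuis_def Let_def by (elim conjE) blast
  let ?T = "\<lambda>P Q. bracket_deriv D (bracket_deriv D SN) P Q - bracket_deriv K SN P Q"
  have "?T P Q = 0"
  proof (rule biderivation_eq_0[OF _ _ _ P Q])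
    show "biderivation ?T"
      by (rule biderivation_diff[OF biderivation_bracket_deriv[OF bi' dD]
            biderivation_bracket_deriv[OF bi dK]])
  next
    fix X f assume X: "X \<in> \<Gamma>A" and f: "f \<in> smooth_functions atlas"
    \<comment> \<open>Since \<open>D\<close> and \<open>K\<close> kill functions, only the terms in which they act on the section remain.\<close>
    have D0: "D (fsec g) = 0" "K (fsec g) = 0" if "g \<in> smooth_functions atlas" for g
      using ext_fsec[OF Nb D that] ext_fsec[OF N2 K that] by auto
    have DSN: "bracket_deriv D SN (vsec Y) (fsec f) = fsec (anchor_app \<rho> (?N Y) f)" if Y: "Y \<in> \<Gamma>A" for Y
      unfolding bracket_deriv_def Dv[OF Y] D0(1)[OF f] SNf[OF Y f] SNf[OF N[OF Y] f]
        D0(1)[OF anchor_smooth[OF Y f]] B_zero[OF bi vsec_closed[OF Y]] by simp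
    have "bracket_deriv D (bracket_deriv D SN) (vsec X) (fsec f) = fsec (anchor_app \<rho> (?N (?N X)) f)"
      unfolding bracket_deriv_def[of D "bracket_deriv D SN"] Dv[OF X] D0(1)[OF f] DSN[OF X]
        DSN[OF N[OF X]] D0(1)[OF anchor_smooth[OF N[OF X] f]] B_zero[OF bi' vsec_closed[OF X]] by simp
    moreover have "bracket_deriv K SN (vsec X) (fsec f) = fsec (anchor_app \<rho> (?N (?N X)) f)"
      unfolding bracket_deriv_def Kv[OF X] D0(2)[OF f] SNf[OF X f] SNf[OF N[OF N[OF X]] f]
        D0(2)[OF anchor_smooth[OF X f]] B_zero[OF bi vsec_closed[OF X]] by simp
    ultimately show "?T (vsec X) (fsec f) = 0" by simp
  next
    fix X Y assume X: "X \<in> \<Gamma>A" and Y: "Y \<in> \<Gamma>A"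
    have DSN: "bracket_deriv D SN (vsec X) (vsec Y) =
        vsec (br (?N X) Y) + vsec (br X (?N Y)) - vsec (?N (br X Y))"
      if X: "X \<in> \<Gamma>A" and Y: "Y \<in> \<Gamma>A" for X Y
      unfolding bracket_deriv_def Dv[OF X] Dv[OF Y] SNv[OF N[OF X] Y] SNv[OF X N[OF Y]]
        SNv[OF X Y] Dv[OF br_closed[OF X Y]] ..
    note c1 = br_closed[OF N[OF X] Y] and c2 = br_closed[OF X N[OF Y]] and c3 = N[OF br_closed[OF X Y]]
    have DDSN: "D (bracket_deriv D SN (vsec X) (vsec Y)) =
        vsec (?N (br (?N X) Y)) + vsec (?N (br X (?N Y))) - vsec (?N (?N (br X Y)))"
      unfolding DSN[OF X Y]
        D_diff[OF dD add_closed[OF vsec_closed[OF c1] vsec_closed[OF c2]] vsec_closed[OF c3]]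
        D_add[OF dD vsec_closed[OF c1] vsec_closed[OF c2]] Dv[OF c1] Dv[OF c2] Dv[OF c3] ..
    have vsec_diff: "vsec (U - V) = vsec U - vsec V" for U V :: "'m \<Rightarrow> 'v"
      using vsec_add[of "U - V" V] by (simp add: eq_diff_eq)
    have tor: "vsec (br (?N X) (?N Y)) =
        vsec (?N (br (?N X) Y)) + vsec (?N (br X (?N Y))) - vsec (?N (?N (br X Y)))"
      unfolding torsion[OF X Y] vsec_diff vsec_add ..
    have 1: "bracket_deriv D (bracket_deriv D SN) (vsec X) (vsec Y) =
      (vsec (br (?N (?N X)) Y) + vsec (br (?N X) (?N Y)) - vsec (?N (br (?N X) Y))) +
      (vsec (br (?N X) (?N Y)) + vsec (br X (?N (?N Y))) - vsec (?N (br X (?N Y)))) -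
      (vsec (?N (br (?N X) Y)) + vsec (?N (br X (?N Y))) - vsec (?N (?N (br X Y))))"
      unfolding bracket_deriv_def[of D "bracket_deriv D SN"] DDSN Dv[OF X] Dv[OF Y]
        DSN[OF N[OF X] Y] DSN[OF X N[OF Y]] ..
    have 2: "bracket_deriv K SN (vsec X) (vsec Y) =
        vsec (br (?N (?N X)) Y) + vsec (br X (?N (?N Y))) - vsec (?N (?N (br X Y)))"
      unfolding bracket_deriv_def Kv[OF X] Kv[OF Y] SNv[OF N[OF N[OF X]] Y] SNv[OF X N[OF N[OF Y]]]
        SNv[OF X Y] Kv[OF br_closed[OF X Y]] ..
    show "?T (vsec X) (vsec Y) = 0"
      unfolding 1 2 tor by (simp add: algebra_simps)
  qed
  then show ?thesis by (simp only: right_minus_eq)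
qed

end

theorem theorem2p7:
  fixes atlas :: "('m::{t2_space, second_countable_topology}, 'b::real_normed_vector) atlas"
    and A :: "'m \<Rightarrow> 'v::real_vector set"
    and r :: nat
    and frames :: "('m, 'v) frames"
    and br :: "('m \<Rightarrow> 'v) \<Rightarrow> ('m \<Rightarrow> 'v) \<Rightarrow> ('m \<Rightarrow> 'v)"
    and \<rho> :: "'m \<Rightarrow> 'v \<Rightarrow> ('m \<Rightarrow> real) \<Rightarrow> real"
    and N :: "'m \<Rightarrow> 'v \<Rightarrow> 'v"
    and SN :: "('m \<Rightarrow> 'v ext) \<Rightarrow> ('m \<Rightarrow> 'v ext) \<Rightarrow> ('m \<Rightarrow> 'v ext)"
    and D Dsq :: "('m \<Rightarrow> 'v ext) \<Rightarrow> ('m \<Rightarrow> 'v ext)"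
    and a :: "nat \<Rightarrow> real"
  assumes "lie_algebroid atlas A r frames br \<rho>"
    and "nijenhuis_endo atlas A r frames br N"
    and "schouten_nijenhuis atlas A r frames br \<rho> SN"
    and "derivation_extension atlas A r frames N D"
    and "derivation_extension atlas A r frames (\<lambda>p. N p \<circ> N p) Dsq"
  shows "nijenhuis_vform (multisection_space atlas A r frames)
           (mu_form SN a) (vform_of_map D) (vform_of_map Dsq)"
proof -
  interpret lie_algebroid atlas A r frames br \<rho> by fact
  have N: "\<forall>X\<in>\<Gamma>A. bundle_app N X \<in> \<Gamma>A"
    using assms(2) by (simp add: nijenhuis_endo_def bundle_endo_def)
  have NN: "bundle_app (\<lambda>p. N p \<circ> N p) X = bundle_app N (bundle_app N X)" for X
    by (simp add: bundle_app_def)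
  have N2: "\<forall>X\<in>\<Gamma>A. bundle_app (\<lambda>p. N p \<circ> N p) X \<in> \<Gamma>A"
    unfolding NN using N by blast
  have bi: "biderivation SN"
    by (rule biderivation_schouten_nijenhuis[OF assms(3)])
  have "nijenhuis_vform (\<lambda>d. \<Gamma> (- d)) (mu_form SN a) (vform_of_map D) (vform_of_map Dsq)"
  proof (rule nijenhuis_vform_bracket_sum[OF bi derivation_ext[OF N assms(4)]
        derivation_ext[OF N2 assms(5)]])
    show "D (Dsq P) = Dsq (D P)" if "P \<in> \<Gamma> k" for k P
      by (rule derivation_extensions_commute[OF N assms(4) N2 assms(5) _ that]) (simp_all add: NN)
    show "bracket_deriv D (bracket_deriv D SN) P Q = bracket_deriv Dsq SN P Q"
      if "P \<in> \<Gamma> p" "Q \<in> \<Gamma> q" for p q P Q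
      by (rule nijenhuis_bracket_deriv[OF assms(2-5) that])
    show "comp (mu_form SN a) n xs = a n *\<^sub>R bracket_sum SN xs"
      if "length xs = n" "homogeneous xs" for n xs
      using l_form_eq_bracket_sum[OF graded_commutative_algebra_axioms bi that(2,1)]
      by (simp add: mu_form_def)
  qed
  moreover have "(\<lambda>d. \<Gamma> (- d)) = multisection_space atlas A r frames"
    by (simp add: multisection_space_def fun_eq_iff)
  ultimately show ?thesis by simp
qed

end
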